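(* Let $0<c<1/4$, $p>1$ and $\omega>0$. Then there exists $u\in\mathcal{N}$ with $u\geq 0$ almost everywhere such that $S(u)=m$.
   Context: $\mathbb{R}^+=(0,\infty)$. For $u\in H^1_0(\mathbb{R}^+)$ (complex valued) set $H(u)=\int_0^\infty\left(|u'|^2-\frac{c}{x^2}|u|^2\right)dx$, $S(u)=\frac12H(u)+\frac\omega2\|u\|_{L^2}^2-\frac1{p+1}\|u\|_{L^{p+1}}^{p+1}$, $J(u)=H(u)+\omega\|u\|_{L^2}^2-\|u\|_{L^{p+1}}^{p+1}$. The Nehari manifold is $\mathcal{N}=\{u\in H^1_0(\mathbb{R}^+)\setminus\{0\}: J(u)=0\}$ and $m=\inf\{S(u):u\in\mathcal{N}\}$. *)

theory Defs
  imports "HOL-Analysis.Analysis"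
begin

text \<open>
  Functions on \<open>(0,\<infinity>)\<close> are represented by total functions of type \<open>real \<Rightarrow> complex\<close>.
  Every notion below looks at them only through \<open>lebesgue_on {0<..}\<close>, so the values on
  \<open>{..0}\<close> and on null sets are irrelevant; elements of the function spaces are representatives
  rather than equivalence classes.
\<close>

abbreviation half_line :: "real measure" where
  "half_line \<equiv> lebesgue_on {0<..}"

definition Lp_space :: "real \<Rightarrow> (real \<Rightarrow> complex) set" where
  "Lp_space q = {u \<in> borel_measurable half_line.
                   integrable half_line (\<lambda>x. norm (u x) powr q)}"

definition Lp_norm :: "real \<Rightarrow> (real \<Rightarrow> complex) \<Rightarrow> real" where
  "Lp_norm q u = (LINT x|half_line. norm (u x) powr q) powr (1 / q)"

text \<open>
  \<open>C\<^sub>c\<^sup>\<infinity>(0,\<infinity>)\<close>, each function being extended by zero to the whole line; \<open>D n\<close> is the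
  \<open>n\<close>-th derivative.
\<close>

definition test_functions :: "(real \<Rightarrow> complex) set" where
  "test_functions = {\<phi>.
     (\<exists>D. D 0 = \<phi> \<and> (\<forall>n x. (D n has_vector_derivative D (Suc n) x) (at x))) \<and>
     compact (closure {x. \<phi> x \<noteq> 0}) \<and> closure {x. \<phi> x \<noteq> 0} \<subseteq> {0<..}}"

definition is_weak_derivative :: "(real \<Rightarrow> complex) \<Rightarrow> (real \<Rightarrow> complex) \<Rightarrow> bool" where
  "is_weak_derivative u v \<longleftrightarrow>
     (\<forall>\<phi>\<in>test_functions.
        (LINT x|half_line. u x * vector_derivative \<phi> (at x)) =
        - (LINT x|half_line. v x * \<phi> x))"

definition H1 :: "(real \<Rightarrow> complex) set" where
  "H1 = {u \<in> Lp_space 2. \<exists>v\<in>Lp_space 2. is_weak_derivative u v}"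

text \<open>
  The weak derivative of an element of \<open>H1\<close> is unique almost everywhere, so the choice of
  representative does not affect the integrals below.
\<close>

definition weak_deriv :: "(real \<Rightarrow> complex) \<Rightarrow> real \<Rightarrow> complex" where
  "weak_deriv u = (SOME v. v \<in> Lp_space 2 \<and> is_weak_derivative u v)"

definition H1_norm :: "(real \<Rightarrow> complex) \<Rightarrow> real" where
  "H1_norm u = sqrt ((Lp_norm 2 u)\<^sup>2 + (Lp_norm 2 (weak_deriv u))\<^sup>2)"

text \<open>\<open>H10\<close> is the closure of \<open>C\<^sub>c\<^sup>\<infinity>(0,\<infinity>)\<close> in \<open>H1\<close>.\<close>

definition H10 :: "(real \<Rightarrow> complex) set" where
  "H10 = {u \<in> H1. \<forall>\<epsilon>>0. \<exists>\<phi>\<in>test_functions. H1_norm (\<lambda>x. u x - \<phi> x) < \<epsilon>}"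

text \<open>
  For \<open>u \<in> H10\<close> the integrand of \<open>H_form\<close> is integrable by Hardy's inequality, and
  \<open>H10 \<subseteq> Lp_space (p + 1)\<close> for \<open>p > 1\<close>.
\<close>

definition H_form :: "real \<Rightarrow> (real \<Rightarrow> complex) \<Rightarrow> real" where
  "H_form c u =
     (LINT x|half_line. (norm (weak_deriv u x))\<^sup>2 - c / x\<^sup>2 * (norm (u x))\<^sup>2)"

definition S_action :: "real \<Rightarrow> real \<Rightarrow> real \<Rightarrow> (real \<Rightarrow> complex) \<Rightarrow> real" where
  "S_action c \<omega> p u =
     1 / 2 * H_form c u + \<omega> / 2 * (Lp_norm 2 u)\<^sup>2
     - 1 / (p + 1) * Lp_norm (p + 1) u powr (p + 1)"

definition J_functional :: "real \<Rightarrow> real \<Rightarrow> real \<Rightarrow> (real \<Rightarrow> complex) \<Rightarrow> real" where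
  "J_functional c \<omega> p u =
     H_form c u + \<omega> * (Lp_norm 2 u)\<^sup>2 - Lp_norm (p + 1) u powr (p + 1)"

definition Nehari :: "real \<Rightarrow> real \<Rightarrow> real \<Rightarrow> (real \<Rightarrow> complex) set" where
  "Nehari c \<omega> p = {u \<in> H10. \<not> (AE x in half_line. u x = 0) \<and> J_functional c \<omega> p u = 0}"

text \<open>
  For \<open>\<omega> > 0\<close>, \<open>0 < c < 1/4\<close> and \<open>p > 1\<close> the Nehari manifold is nonempty, and \<open>S_action\<close>
  equals \<open>(1/2 - 1/(p+1)) * Lp_norm (p+1) u powr (p+1) \<ge> 0\<close> on it, so the real-valued infimum
  is the true one.
\<close>

definition m_level :: "real \<Rightarrow> real \<Rightarrow> real \<Rightarrow> real" where
  "m_level c \<omega> p = (INF u\<in>Nehari c \<omega> p. S_action c \<omega> p u)"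

end

theory Submission
  imports Defs "HOL-Complex_Analysis.Great_Picard"
begin

text \<open>
  Put \<open>E(u) = H(u) + \<omega> \<parallel>u\<parallel>\<^sup>2\<close>; by Hardy's inequality this is a quadratic form equivalent to the squared
  \<open>H\<^sup>1\<close> norm, and it does not increase under \<open>u \<mapsto> \<bar>u\<bar>\<close>. Along rays the problem becomes: minimise \<open>E\<close>
  among \<open>u \<ge> 0\<close> with \<open>\<integral> u powr (p + 1) = 1\<close>; call the infimum \<open>q\<close>.

  Cutting \<open>u\<close> near a point of \<open>[L, 2 L]\<close> where it is small splits \<open>E\<close> into the energies of two pieces,
  up to \<open>O(1 / L)\<close>. The right piece hardly sees the potential, so its energy is governed by the
  constant \<open>q_line\<close> of the problem without potential. The soliton centred at \<open>R\<close> and cut off at the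
  origin gains order \<open>1 / R\<^sup>2\<close> from the potential and loses only exponentially little, whence
  \<open>q < q_line\<close>. As \<open>\<theta> = 2 / (p + 1) < 1\<close>, a minimising sequence therefore keeps almost all its mass on
  a bounded interval. Along a pointwise convergent subsequence the midpoint of two members then has
  mass close to \<open>1\<close>, hence energy at least \<open>q - o(1)\<close>, and the parallelogram identity makes the
  sequence Cauchy in \<open>H\<^sup>1\<close>; no weak compactness is needed.
\<close>

section \<open>Square integrable functions\<close>

text \<open>The potential is critical at the origin: \<open>c / x\<^sup>2\<close> scales like the
  square of a derivative, so under weak convergence its integral need not pass to the limit. It is
  therefore never split off in the compactness argument: \<open>energy\<close> is used as one
  nonnegative quadratic form, and smallness in it controls both \<open>L2\<close> norms because
  Hardy's constant \<open>4\<close> leaves the factor \<open>1 - 4 * c > 0\<close>. What remains to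
  be excluded is escape of mass to infinity. A second obstacle is the language of the statement:
  \<open>weak_deriv\<close> is a choice of representative and \<open>H10\<close> is a closure. The
  variational estimates are made for real primitives that vanish at \<open>0\<close>, each paired
  with its derivative. The dictionary is needed in both directions: elements of \<open>H10\<close>
  agree almost everywhere with primitives, which brings the Nehari manifold under the estimates, and
  square integrable real primitives with square integrable derivative belong to \<open>H10\<close>,
  which brings the minimiser back.\<close>

lemma L2_mult_integrable:
  fixes f g :: "'a \<Rightarrow> real"
  assumes [measurable]: "f \<in> borel_measurable M" "g \<in> borel_measurable M"
    and f: "integrable M (\<lambda>x. (f x)\<^sup>2)" and g: "integrable M (\<lambda>x. (g x)\<^sup>2)"
  shows "integrable M (\<lambda>x. f x * g x)"
proof (rule Bochner_Integration.integrable_bound)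
  show "integrable M (\<lambda>x. (f x)\<^sup>2 + (g x)\<^sup>2)" using f g by simp
  show "AE x in M. norm (f x * g x) \<le> norm ((f x)\<^sup>2 + (g x)\<^sup>2)"
  proof (rule AE_I2)
    fix x
    have "2 * (\<bar>f x\<bar> * \<bar>g x\<bar>) \<le> \<bar>f x\<bar>\<^sup>2 + \<bar>g x\<bar>\<^sup>2"
      using sum_squares_bound[of "\<bar>f x\<bar>" "\<bar>g x\<bar>"] by (simp add: mult.assoc)
    moreover have "0 \<le> \<bar>f x\<bar> * \<bar>g x\<bar>" by simp
    ultimately have "\<bar>f x\<bar> * \<bar>g x\<bar> \<le> \<bar>f x\<bar>\<^sup>2 + \<bar>g x\<bar>\<^sup>2" by linarith
    then show "norm (f x * g x) \<le> norm ((f x)\<^sup>2 + (g x)\<^sup>2)"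
      by (simp add: abs_mult)
  qed
qed measurable

lemma L2_lincomb_integrable:
  fixes f g :: "'a \<Rightarrow> real"
  assumes "f \<in> borel_measurable M" "g \<in> borel_measurable M"
    and "integrable M (\<lambda>x. (f x)\<^sup>2)" "integrable M (\<lambda>x. (g x)\<^sup>2)"
  shows "integrable M (\<lambda>x. (a * f x + b * g x)\<^sup>2)"
proof -
  have "(a * f x + b * g x)\<^sup>2 = a\<^sup>2 * (f x)\<^sup>2 + b\<^sup>2 * (g x)\<^sup>2 + (2 * a * b) * (f x * g x)" for x
    by (simp add: power2_eq_square algebra_simps)
  then show ?thesis using L2_mult_integrable[OF assms] assms(3,4) by simp
qed

lemma L2_triangle:
  fixes u v w :: "'a \<Rightarrow> real"
  assumes m: "u \<in> borel_measurable M" "v \<in> borel_measurable M" "w \<in> borel_measurable M"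
    and i: "integrable M (\<lambda>x. (u x)\<^sup>2)" "integrable M (\<lambda>x. (v x)\<^sup>2)" "integrable M (\<lambda>x. (w x)\<^sup>2)"
  shows "(LINT x|M. (u x - w x)\<^sup>2) \<le> 2 * (LINT x|M. (u x - v x)\<^sup>2) + 2 * (LINT x|M. (v x - w x)\<^sup>2)"
proof -
  have d: "integrable M (\<lambda>x. (u x - v x)\<^sup>2)" "integrable M (\<lambda>x. (v x - w x)\<^sup>2)" "integrable M (\<lambda>x. (u x - w x)\<^sup>2)"
    using L2_lincomb_integrable[OF m(1,2) i(1,2), of 1 "-1"] L2_lincomb_integrable[OF m(2,3) i(2,3), of 1 "-1"]
      L2_lincomb_integrable[OF m(1,3) i(1,3), of 1 "-1"] by simp_all
  have "(LINT x|M. (u x - w x)\<^sup>2) \<le> (LINT x|M. 2 * (u x - v x)\<^sup>2 + 2 * (v x - w x)\<^sup>2)"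
  proof (rule integral_mono)
    fix x
    have "0 \<le> ((u x - v x) - (v x - w x))\<^sup>2" by simp
    then show "(u x - w x)\<^sup>2 \<le> 2 * (u x - v x)\<^sup>2 + 2 * (v x - w x)\<^sup>2"
      by (simp add: power2_eq_square algebra_simps)
  qed (use d in auto)
  then show ?thesis using d by simp
qed

text \<open>Discriminant criterion, kept abstract because it serves both the \<open>L2\<close> inner
  product and the polar form of the energy. With \<open>C = 0\<close> the form is affine in
  \<open>t\<close> for \<open>s = 1\<close>, which forces \<open>B = 0\<close>.\<close>

lemma quadratic_form_Cauchy_Schwarz:
  fixes A B C :: real
  assumes "\<And>s t. 0 \<le> s\<^sup>2 * A + 2 * s * t * B + t\<^sup>2 * C"
  shows "B\<^sup>2 \<le> A * C"
proof (cases "C = 0")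
  case True
  show ?thesis
  proof (rule ccontr)
    assume "\<not> ?thesis"
    then have "B \<noteq> 0" using True by auto
    have "0 \<le> A + 2 * (-(A + 1) / (2 * B)) * B"
      using assms[of 1 "-(A + 1) / (2 * B)"] True by simp
    also have "\<dots> = -1" using \<open>B \<noteq> 0\<close> by (simp add: field_simps)
    finally show False by simp
  qed
next
  case False
  have "C \<ge> 0" using assms[of 0 1] by simp
  then have "C > 0" using False by simp
  \<comment> \<open>The minimising ratio \<open>t / s = - B / C\<close>, cleared of its
    denominator.\<close>
  have "0 \<le> C\<^sup>2 * A + 2 * C * (-B) * B + (-B)\<^sup>2 * C" using assms[of C "-B"] .
  also have "\<dots> = C * (A * C - B\<^sup>2)" by (simp add: power2_eq_square algebra_simps)
  finally show ?thesis using \<open>C > 0\<close> by (simp add: zero_le_mult_iff)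
qed

lemma integral_Cauchy_Schwarz:
  fixes f g :: "'a \<Rightarrow> real"
  assumes m: "f \<in> borel_measurable M" "g \<in> borel_measurable M"
    and f: "integrable M (\<lambda>x. (f x)\<^sup>2)" and g: "integrable M (\<lambda>x. (g x)\<^sup>2)"
  shows "(LINT x|M. f x * g x)\<^sup>2 \<le> (LINT x|M. (f x)\<^sup>2) * (LINT x|M. (g x)\<^sup>2)"
proof -
  define A B C where "A = (LINT x|M. (f x)\<^sup>2)" and "B = (LINT x|M. f x * g x)"
    and "C = (LINT x|M. (g x)\<^sup>2)"
  have fg: "integrable M (\<lambda>x. f x * g x)" by (rule L2_mult_integrable[OF m f g])
  have *: "0 \<le> s\<^sup>2 * A + 2 * s * t * B + t\<^sup>2 * C" for s t
  proof -
    have "0 \<le> (LINT x|M. (s * f x + t * g x)\<^sup>2)" by simp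
    also have "\<dots> = (LINT x|M. s\<^sup>2 * (f x)\<^sup>2 + (2 * s * t) * (f x * g x) + t\<^sup>2 * (g x)\<^sup>2)"
      by (rule Bochner_Integration.integral_cong) (simp_all add: power2_eq_square algebra_simps)
    also have "\<dots> = s\<^sup>2 * A + 2 * s * t * B + t\<^sup>2 * C"
      using f g fg by (simp add: A_def B_def C_def)
    finally show ?thesis .
  qed
  show ?thesis
    using quadratic_form_Cauchy_Schwarz[OF *] by (simp add: A_def B_def C_def)
qed

text \<open>Integrability of the limit is part of the conclusion, which is how limits of minimising
  sequences and the integrand of Hardy's inequality are shown to be integrable. The bound is only
  eventual, so it may be one that late members satisfy up to a small error.\<close>

lemma Fatou_real:
  fixes f :: "nat \<Rightarrow> 'a \<Rightarrow> real"
  assumes int: "\<And>n. integrable M (f n)" and nn: "\<And>n x. 0 \<le> f n x"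
    and [measurable]: "g \<in> borel_measurable M"
    and lim: "AE x in M. (\<lambda>n. f n x) \<longlonglongrightarrow> g x"
    and bd: "eventually (\<lambda>n. (LINT x|M. f n x) \<le> C) sequentially"
  shows "integrable M g" "(LINT x|M. g x) \<le> C"
proof -
  note [measurable] = borel_measurable_integrable[OF int]
  have g0: "AE x in M. 0 \<le> g x"
    using lim by eventually_elim (rule LIMSEQ_le_const, auto simp: nn)
  have C0: "0 \<le> C"
  proof -
    obtain n where "(LINT x|M. f n x) \<le> C" using bd eventually_happens by fastforce
    then show ?thesis using Bochner_Integration.integral_nonneg[of M "f n"] nn
      by (meson order_trans)
  qed
  have "(\<integral>\<^sup>+x. ennreal (g x) \<partial>M) = (\<integral>\<^sup>+x. liminf (\<lambda>n. ennreal (f n x)) \<partial>M)"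
  proof (rule nn_integral_cong_AE)
    show "AE x in M. ennreal (g x) = liminf (\<lambda>n. ennreal (f n x))"
      using lim
    proof eventually_elim
      case (elim x)
      then have "(\<lambda>n. ennreal (f n x)) \<longlonglongrightarrow> ennreal (g x)" by (rule tendsto_ennrealI)
      then show ?case by (simp add: lim_imp_Liminf)
    qed
  qed
  also have "\<dots> \<le> liminf (\<lambda>n. \<integral>\<^sup>+x. ennreal (f n x) \<partial>M)"
    by (rule nn_integral_liminf) measurable
  also have "\<dots> = liminf (\<lambda>n. ennreal (LINT x|M. f n x))"
    by (simp add: nn_integral_eq_integral int nn)
  also have "\<dots> \<le> ennreal C"
  proof (rule Liminf_le)
    show "\<forall>\<^sub>F n in sequentially. ennreal (LINT x|M. f n x) \<le> ennreal C"
      using bd by eventually_elim (rule ennreal_leI)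
  qed simp
  finally have le: "(\<integral>\<^sup>+x. ennreal (g x) \<partial>M) \<le> ennreal C" .
  show i: "integrable M g"
    by (rule integrableI_nonneg) (use g0 le in \<open>auto simp: top_unique less_top[symmetric]\<close>)
  have "ennreal (LINT x|M. g x) \<le> ennreal C"
    using le nn_integral_eq_integral[OF i g0] by simp
  then show "(LINT x|M. g x) \<le> C" using C0 by simp
qed

text \<open>Riesz-Fischer. A subsequence with fast decaying increments converges almost everywhere,
  and Fatou applied to \<open>f m - f (r k)\<close> as \<open>k\<close> grows turns the Cauchy
  condition into convergence of the whole sequence.\<close>

lemma L2_complete:
  fixes f :: "nat \<Rightarrow> 'a \<Rightarrow> real"
  assumes meas[measurable]: "\<And>n. f n \<in> borel_measurable M"
    and int: "\<And>n. integrable M (\<lambda>x. (f n x)\<^sup>2)"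
    and cauchy: "\<And>e. e > 0 \<Longrightarrow> \<exists>N. \<forall>m\<ge>N. \<forall>n\<ge>N. (LINT x|M. (f m x - f n x)\<^sup>2) < e"
  obtains g where "g \<in> borel_measurable M" "integrable M (\<lambda>x. (g x)\<^sup>2)"
    "(\<lambda>n. LINT x|M. (f n x - g x)\<^sup>2) \<longlonglongrightarrow> 0"
proof -
  have intd: "integrable M (\<lambda>x. (f m x - f n x)\<^sup>2)" for m n
    using L2_lincomb_integrable[OF meas[of m] meas[of n] int int, of 1 "-1"] by simp
  have "\<exists>r. \<forall>n. (\<forall>i\<ge>r n. \<forall>j\<ge>r n. (LINT x|M. (f i x - f j x)\<^sup>2) < (1 / 16) ^ n) \<and> (r (Suc n) > r n)"
  proof (intro dependent_nat_choice, goal_cases)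
    case 1
    then show ?case using cauchy[of 1] by simp
  next
    case (2 x n)
    obtain N where N: "\<forall>i\<ge>N. \<forall>j\<ge>N. (LINT x|M. (f i x - f j x)\<^sup>2) < (1 / 16) ^ Suc n"
      using cauchy[of "(1 / 16) ^ Suc n"] by auto
    then show ?case by (intro exI[of _ "max N (Suc x)"]) auto
  qed
  then obtain r where r: "\<And>n i j. i \<ge> r n \<Longrightarrow> j \<ge> r n \<Longrightarrow> (LINT x|M. (f i x - f j x)\<^sup>2) < (1 / 16) ^ n"
    and "\<And>n. r (Suc n) > r n" by blast
  then have sm: "strict_mono r" by (simp add: strict_mono_Suc_iff)
  \<comment> \<open>Increments of squared norm at most \<open>(1 / 16) ^ n\<close> leave room for
    the weight \<open>4 ^ n\<close>: the integrals stay summable, and boundedness of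
    \<open>d n x\<close> in \<open>n\<close> forces increments of order
    \<open>(1 / 2) ^ n\<close>.\<close>
  define d where "d n x = 4 ^ n * (f (r (Suc n)) x - f (r n) x)\<^sup>2" for n x
  have dint: "integrable M (d n)" for n unfolding d_def using intd by simp
  have dle: "(LINT x|M. d n x) \<le> (1 / 4) ^ n" for n
  proof -
    have "(LINT x|M. d n x) = 4 ^ n * (LINT x|M. (f (r (Suc n)) x - f (r n) x)\<^sup>2)"
      unfolding d_def using intd by simp
    also have "\<dots> \<le> 4 ^ n * (1 / 16) ^ n"
      using r[of n "r (Suc n)" "r n"] sm by (intro mult_left_mono) (auto simp: strict_mono_leD less_imp_le)
    also have "\<dots> = (1 / 4 :: real) ^ n" by (simp flip: power_mult_distrib)
    finally show ?thesis .
  qed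
  have "(\<integral>\<^sup>+x. (\<Sum>n. ennreal (d n x)) \<partial>M) = (\<Sum>n. \<integral>\<^sup>+x. ennreal (d n x) \<partial>M)"
    by (rule nn_integral_suminf) (simp add: d_def)
  also have "\<dots> = (\<Sum>n. ennreal (LINT x|M. d n x))"
    by (intro arg_cong[where f = suminf] ext nn_integral_eq_integral dint) (simp add: d_def)
  also have "\<dots> \<le> (\<Sum>n. ennreal ((1 / 4) ^ n))"
    by (intro suminf_le ennreal_leI dle) auto
  also have "\<dots> = ennreal (\<Sum>n. (1 / 4) ^ n)"
    by (rule suminf_ennreal2) (auto simp: summable_geometric)
  finally have "(\<integral>\<^sup>+x. (\<Sum>n. ennreal (d n x)) \<partial>M) \<noteq> \<infinity>"
    by (auto simp: top_unique)
  then have "AE x in M. (\<Sum>n. ennreal (d n x)) \<noteq> \<infinity>"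
    by (intro nn_integral_PInf_AE) (auto simp: d_def)
  then have ae: "AE x in M. Cauchy (\<lambda>n. f (r n) x)"
  proof eventually_elim
    case (elim x)
    have sd: "summable (\<lambda>n. d n x)"
      using elim by (intro summable_suminf_not_top) (auto simp: d_def)
    then have "(\<lambda>n. d n x) \<longlonglongrightarrow> 0" by (rule summable_LIMSEQ_zero)
    then obtain K where K: "\<And>n. norm (d n x) \<le> K"
      using convergent_imp_Bseq convergentI by (meson BseqE)
    have b: "\<bar>f (r (Suc n)) x - f (r n) x\<bar> \<le> sqrt K * (1 / 2) ^ n" for n
    proof -
      have "(2 ^ n * \<bar>f (r (Suc n)) x - f (r n) x\<bar>)\<^sup>2 \<le> K"
      proof -
        have "(2 ^ n * \<bar>f (r (Suc n)) x - f (r n) x\<bar>)\<^sup>2 = (2\<^sup>2) ^ n * (f (r (Suc n)) x - f (r n) x)\<^sup>2"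
          by (simp only: power_mult_distrib power2_abs flip: power_mult) (simp add: mult.commute)
        then show ?thesis using K[of n] by (simp add: d_def)
      qed
      then have "2 ^ n * \<bar>f (r (Suc n)) x - f (r n) x\<bar> \<le> sqrt K" by (simp add: real_le_rsqrt)
      then show ?thesis by (simp add: field_simps power_one_over)
    qed
    have "summable (\<lambda>n. f (r (Suc n)) x - f (r n) x)"
      by (rule summable_comparison_test'[of "\<lambda>n. sqrt K * (1 / 2) ^ n" 0])
        (use b in \<open>auto intro!: summable_mult summable_geometric\<close>)
    then have "convergent (\<lambda>n. \<Sum>i<n. f (r (Suc i)) x - f (r i) x)"
      by (simp add: summable_iff_convergent)
    then have "convergent (\<lambda>n. f (r n) x - f (r 0) x)"
      by (simp add: sum_lessThan_telescope[of "\<lambda>i. f (r i) x"])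
    then have "convergent (\<lambda>n. (f (r n) x - f (r 0) x) + f (r 0) x)"
      by (intro convergent_add convergent_const)
    then show ?case by (simp add: convergent_Cauchy)
  qed
  define g where "g x = lim (\<lambda>n. f (r n) x)" for x
  have [measurable]: "g \<in> borel_measurable M" unfolding g_def by measurable
  have lim: "AE x in M. (\<lambda>n. f (r n) x) \<longlonglongrightarrow> g x"
    using ae by eventually_elim (simp add: g_def Cauchy_convergent_iff convergent_LIMSEQ_iff)
  have key: "integrable M (\<lambda>x. (f m x - g x)\<^sup>2) \<and> (LINT x|M. (f m x - g x)\<^sup>2) \<le> (1/16) ^ n"
    if "m \<ge> r n" for m n
  proof -
    have L: "AE x in M. (\<lambda>k. (f m x - f (r k) x)\<^sup>2) \<longlonglongrightarrow> (f m x - g x)\<^sup>2"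
      using lim by eventually_elim (intro tendsto_intros)
    have E: "\<forall>\<^sub>F k in sequentially. (LINT x|M. (f m x - f (r k) x)\<^sup>2) \<le> (1/16) ^ n"
      using eventually_ge_at_top[of n]
    proof eventually_elim
      case (elim k)
      then show ?case using r[of n m "r k"] that sm by (simp add: strict_mono_leD less_imp_le)
    qed
    show ?thesis
      using Fatou_real[OF intd _ _ L E] by auto
  qed
  have "integrable M (\<lambda>x. (f (r 0) x - g x)\<^sup>2)" using key[of 0 "r 0"] by simp
  then have "integrable M (\<lambda>x. (1 * f (r 0) x + (-1) * (f (r 0) x - g x))\<^sup>2)"
    by (intro L2_lincomb_integrable int) auto
  then have "integrable M (\<lambda>x. (g x)\<^sup>2)" by simp
  moreover have "(\<lambda>n. LINT x|M. (f n x - g x)\<^sup>2) \<longlonglongrightarrow> 0"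
  proof (rule LIMSEQ_I)
    fix e :: real assume "e > 0"
    then obtain n where n: "(1/16::real) ^ n < e" using real_arch_pow_inv[of e "1/16"] by auto
    show "\<exists>no. \<forall>m\<ge>no. norm ((LINT x|M. (f m x - g x)\<^sup>2) - 0) < e"
    proof (intro exI[of _ "r n"] allI impI)
      fix m assume "r n \<le> m"
      moreover have "0 \<le> (LINT x|M. (f m x - g x)\<^sup>2)" by simp
      ultimately show "norm ((LINT x|M. (f m x - g x)\<^sup>2) - 0) < e" using key[of n m] n by simp
    qed
  qed
  ultimately show ?thesis using that[of g] by simp
qed

section \<open>The chain rule for indefinite integrals\<close>

lemma Ioc_in_half_line: "0 \<le> a \<Longrightarrow> {a<..b} \<in> sets half_line"
  by (subst sets_restrict_space_iff) auto

lemma borel_measurable_half_line: "f \<in> borel_measurable borel \<Longrightarrow> f \<in> borel_measurable half_line"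
  by (intro measurable_restrict_space1 measurable_completion) simp

lemma continuous_on_Ioc_measurable:
  fixes f :: "real \<Rightarrow> 'a::euclidean_space"
  assumes "continuous_on {a..b} f"
  shows "(\<lambda>x. indicat_real {a<..b} x *\<^sub>R f x) \<in> borel_measurable half_line"
proof (rule borel_measurable_half_line)
  have "continuous_on {a<..b} f" by (rule continuous_on_subset[OF assms]) auto
  then show "(\<lambda>x. indicat_real {a<..b} x *\<^sub>R f x) \<in> borel_measurable borel"
    by (intro borel_measurable_continuous_on_indicator) auto
qed

lemma set_integral_Ioc_split:
  fixes v :: "real \<Rightarrow> 'a::euclidean_space"
  assumes "0 \<le> a" "a \<le> s" "s \<le> t" "t \<le> r" "r \<le> b" and v: "set_integrable half_line {a<..b} v"
  shows "(LINT x:{s<..r}|half_line. v x) = (LINT x:{s<..t}|half_line. v x) + (LINT x:{t<..r}|half_line. v x)"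
proof -
  have "{s<..r} = {s<..t} \<union> {t<..r}" using assms by auto
  moreover have "set_integrable half_line {s<..t} v" "set_integrable half_line {t<..r} v"
    using assms by (auto intro!: set_integrable_subset[OF v] Ioc_in_half_line)
  ultimately show ?thesis by (simp add: set_integral_Un)
qed

lemma continuous_inner_set_integrable:
  fixes v W :: "real \<Rightarrow> 'a::euclidean_space"
  assumes W: "continuous_on {a..b} W" and v: "set_integrable half_line {a<..b} v"
  shows "set_integrable half_line {a<..b} (\<lambda>x. W x \<bullet> v x)"
proof -
  obtain K where K: "\<And>x. x \<in> {a..b} \<Longrightarrow> norm (W x) \<le> K"
    using compact_imp_bounded[OF compact_continuous_image[OF W compact_Icc]]
    by (force simp: bounded_iff)
  have eq: "indicat_real {a<..b} x *\<^sub>R (W x \<bullet> v x)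
     = (indicat_real {a<..b} x *\<^sub>R W x) \<bullet> (indicat_real {a<..b} x *\<^sub>R v x)" for x
    by (auto simp: indicator_def)
  show ?thesis unfolding set_integrable_def
  proof (rule Bochner_Integration.integrable_bound)
    show "integrable half_line (\<lambda>x. K * norm (indicat_real {a<..b} x *\<^sub>R v x))"
      using v unfolding set_integrable_def by (intro integrable_mult_right integrable_norm)
    show "(\<lambda>x. indicat_real {a<..b} x *\<^sub>R (W x \<bullet> v x)) \<in> borel_measurable half_line"
      unfolding eq
      by (intro borel_measurable_inner continuous_on_Ioc_measurable[OF W]
          borel_measurable_integrable[OF v[unfolded set_integrable_def]])
    show "AE x in half_line. norm (indicat_real {a<..b} x *\<^sub>R (W x \<bullet> v x))
        \<le> norm (K * norm (indicat_real {a<..b} x *\<^sub>R v x))"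
    proof (rule AE_I2)
      fix x
      have "\<bar>W x \<bullet> v x\<bar> \<le> K * norm (v x)" if "x \<in> {a<..b}"
      proof -
        have "\<bar>W x \<bullet> v x\<bar> \<le> norm (W x) * norm (v x)" by (rule Cauchy_Schwarz_ineq2)
        also have "\<dots> \<le> K * norm (v x)" using K[of x] that by (intro mult_right_mono) auto
        finally show ?thesis .
      qed
      then have "\<bar>W x \<bullet> v x\<bar> \<le> \<bar>K * norm (v x)\<bar>" if "x \<in> {a<..b}"
        using that by (meson abs_ge_self order_trans)
      then show "norm (indicat_real {a<..b} x *\<^sub>R (W x \<bullet> v x))
        \<le> norm (K * norm (indicat_real {a<..b} x *\<^sub>R v x))"
        by (cases "x \<in> {a<..b}") simp_all
    qed
  qed
qed

lemma set_integral_inner_right: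
  fixes v :: "real \<Rightarrow> 'a::euclidean_space"
  assumes "set_integrable M A v"
  shows "set_integrable M A (\<lambda>x. c \<bullet> v x)"
    and "(LINT x:A|M. c \<bullet> v x) = c \<bullet> (LINT x:A|M. v x)"
proof -
  have i: "integrable M (\<lambda>x. indicat_real A x *\<^sub>R v x)"
    using assms by (simp only: set_integrable_def)
  have eq: "indicat_real A x *\<^sub>R (c \<bullet> v x) = c \<bullet> (indicat_real A x *\<^sub>R v x)" for x
    by (cases "x \<in> A") simp_all
  show "set_integrable M A (\<lambda>x. c \<bullet> v x)" unfolding set_integrable_def eq
    by (rule integrable_inner_right) (rule i)
  show "(LINT x:A|M. c \<bullet> v x) = c \<bullet> (LINT x:A|M. v x)" unfolding set_lebesgue_integral_def eq
    by (rule integral_inner_right) (rule i)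
qed

lemma set_integral_norm_le:
  fixes v :: "real \<Rightarrow> 'a::euclidean_space"
  shows "norm (LINT x:A|M. v x) \<le> (LINT x:A|M. norm (v x))"
proof -
  have "norm (indicat_real A x *\<^sub>R v x) = indicat_real A x *\<^sub>R norm (v x)" for x
    by (simp add: indicator_def)
  then show ?thesis
    using integral_norm_bound[of M "\<lambda>x. indicat_real A x *\<^sub>R v x"]
    by (simp only: set_lebesgue_integral_def)
qed

text \<open>
  The error bound \<open>e * \<integral> norm v\<close> is additive over adjacent intervals and holds on short intervals
  around each point, so bisection (\<open>Bolzano\<close>) yields it on \<open>{a..b}\<close>.
\<close>

lemma chain_rule_indefinite_integral:
  fixes u v :: "real \<Rightarrow> 'a::euclidean_space" and f :: "'a \<Rightarrow> real" and D :: "'a \<Rightarrow> 'a"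
  assumes ab: "0 \<le> a" "a \<le> b"
    and vi: "set_integrable half_line {a<..b} v"
    and inc: "\<And>s t. a \<le> s \<Longrightarrow> s \<le> t \<Longrightarrow> t \<le> b \<Longrightarrow> u t - u s = (LINT x:{s<..t}|half_line. v x)"
    and cu: "continuous_on {a..b} u"
    and S: "open S" "\<And>x. x \<in> {a..b} \<Longrightarrow> u x \<in> S"
    and fd: "\<And>y. y \<in> S \<Longrightarrow> (f has_derivative (\<lambda>h. D y \<bullet> h)) (at y)"
    and Dc: "continuous_on S D"
  shows "set_integrable half_line {a<..b} (\<lambda>x. D (u x) \<bullet> v x)"
    and "f (u b) - f (u a) = (LINT x:{a<..b}|half_line. D (u x) \<bullet> v x)"
proof -
  have W: "continuous_on {a..b} (\<lambda>x. D (u x))"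
    by (rule continuous_on_compose2[OF Dc cu]) (use S in auto)
  show Wi: "set_integrable half_line {a<..b} (\<lambda>x. D (u x) \<bullet> v x)"
    by (rule continuous_inner_set_integrable[OF W vi])
  define V where "V s t = (LINT x:{s<..t}|half_line. norm (v x))" for s t
  define I where "I s t = (LINT x:{s<..t}|half_line. D (u x) \<bullet> v x)" for s t
  have vn: "set_integrable half_line {a<..b} (\<lambda>x. norm (v x))"
    using vi unfolding set_integrable_def by (auto dest: integrable_norm)
  have sub: "set_integrable half_line {s<..t} w" if "set_integrable half_line {a<..b} w" "a \<le> s" "t \<le> b"
    for w :: "real \<Rightarrow> 'c::euclidean_space" and s t
    by (rule set_integrable_subset[OF that(1)]) (use that ab in \<open>auto intro!: Ioc_in_half_line\<close>)
  define P where "P e s t \<longleftrightarrow> (a \<le> s \<and> s \<le> t \<and> t \<le> b \<longrightarrow> \<bar>f (u t) - f (u s) - I s t\<bar> \<le> e * V s t)"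
    for e s t
  have "P e a b" if "e > 0" for e
    using ab(2)
  proof (induction rule: Bolzano)
    case (trans s t r)
    show ?case unfolding P_def
    proof (intro impI)
      assume h: "a \<le> s \<and> s \<le> r \<and> r \<le> b"
      have "V s r = V s t + V t r" unfolding V_def
        by (rule set_integral_Ioc_split[OF ab(1) _ _ _ _ vn]) (use h trans in auto)
      moreover have "I s r = I s t + I t r" unfolding I_def
        by (rule set_integral_Ioc_split[OF ab(1) _ _ _ _ Wi]) (use h trans in auto)
      moreover have "\<bar>f (u t) - f (u s) - I s t\<bar> \<le> e * V s t" "\<bar>f (u r) - f (u t) - I t r\<bar> \<le> e * V t r"
        using trans h by (auto simp: P_def)
      ultimately show "\<bar>f (u r) - f (u s) - I s r\<bar> \<le> e * V s r"
        using distrib_left[of e "V s t" "V t r"] by (simp only:)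
    qed
  next
    case (local x)
    then have x: "x \<in> {a..b}" by simp
    have "isCont D (u x)" using Dc S(1) S(2)[OF x] by (simp add: continuous_on_eq_continuous_at)
    then have "(D \<longlongrightarrow> D (u x)) (nhds (u x))" by (simp add: continuous_at_imp_continuous_within isCont_def tendsto_at_iff_tendsto_nhds)
    then have "\<forall>\<^sub>F y in nhds (u x). dist (D y) (D (u x)) < e / 2"
      using \<open>e > 0\<close> by (intro tendstoD) auto
    moreover have "\<forall>\<^sub>F y in nhds (u x). y \<in> S" using S(1) S(2)[OF x] by (rule eventually_nhds_in_open)
    ultimately have "\<forall>\<^sub>F y in nhds (u x). dist (D y) (D (u x)) < e / 2 \<and> y \<in> S" by (rule eventually_conj)
    then obtain r where r: "r > 0" "\<And>y. dist y (u x) < r \<Longrightarrow> dist (D y) (D (u x)) < e / 2 \<and> y \<in> S"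
      unfolding eventually_nhds_metric by auto
    obtain d where d: "d > 0" "\<And>t. t \<in> {a..b} \<Longrightarrow> dist t x < d \<Longrightarrow> dist (u t) (u x) < r"
    proof -
      have "\<exists>d>0. \<forall>t\<in>{a..b}. dist t x < d \<longrightarrow> dist (u t) (u x) < r"
        using cu x r(1) unfolding continuous_on_iff by blast
      then show ?thesis using that by blast
    qed
    show ?case
    proof (intro exI[of _ d] conjI allI impI d(1))
      fix s t assume st: "s \<le> x \<and> x \<le> t \<and> t - s < d"
      show "P e s t" unfolding P_def
      proof (intro impI)
        assume h: "a \<le> s \<and> s \<le> t \<and> t \<le> b"
        have near: "u y \<in> ball (u x) r" if "y \<in> {s..t}" for y
          using d(2)[of y] that st h by (auto simp: dist_real_def dist_commute)
        have vst: "set_integrable half_line {s<..t} v" "set_integrable half_line {s<..t} (\<lambda>x. norm (v x))"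
          "set_integrable half_line {s<..t} (\<lambda>x. D (u x) \<bullet> v x)"
          using h by (auto intro!: sub vi vn Wi)
        have u: "u t - u s = (LINT x:{s<..t}|half_line. v x)" using inc h by simp
        then have un: "norm (u t - u s) \<le> V s t" by (simp add: V_def set_integral_norm_le)
        \<comment> \<open>Mean value inequality for \<open>f\<close> minus its linearisation at
          \<open>u x\<close>; on the ball the gradient of the difference is at most
          \<open>e / 2\<close>. The other half of \<open>e\<close> pays for replacing
          \<open>D (u x)\<close> by \<open>D (u y)\<close> under the integral.\<close>
        have "norm ((f (u t) - D (u x) \<bullet> u t) - (f (u s) - D (u x) \<bullet> u s)) \<le> e / 2 * norm (u t - u s)"
        proof (rule differentiable_bound[where S = "ball (u x) r" and f' = "\<lambda>y h. (D y - D (u x)) \<bullet> h"])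
          fix y assume y: "y \<in> ball (u x) r"
          then have "((\<lambda>y. f y - D (u x) \<bullet> y) has_derivative (\<lambda>h. D y \<bullet> h - D (u x) \<bullet> h)) (at y)"
            using r(2)[of y] by (intro derivative_intros fd) (auto simp: dist_commute)
          then show "((\<lambda>y. f y - D (u x) \<bullet> y) has_derivative (\<lambda>h. (D y - D (u x)) \<bullet> h)) (at y within ball (u x) r)"
            by (simp add: inner_diff_left has_derivative_at_withinI)
          have "norm (D y - D (u x)) \<le> e / 2" using r(2)[of y] y by (simp add: dist_norm dist_commute norm_minus_commute less_imp_le)
          then show "onorm (\<lambda>h. (D y - D (u x)) \<bullet> h) \<le> e / 2"
            by (intro onorm_le order_trans[OF Cauchy_Schwarz_ineq2[folded real_norm_def]] mult_right_mono) auto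
        qed (use near st in auto)
        also have "\<dots> \<le> e / 2 * V s t" using un \<open>e > 0\<close> by (intro mult_left_mono) auto
        finally have 1: "\<bar>f (u t) - f (u s) - D (u x) \<bullet> (u t - u s)\<bar> \<le> e / 2 * V s t"
          by (simp add: inner_diff_right algebra_simps)
        have "D (u x) \<bullet> (u t - u s) - I s t = (LINT y:{s<..t}|half_line. D (u x) \<bullet> v y) - I s t"
          using u set_integral_inner_right(2)[OF vst(1)] by simp
        also have "\<dots> = (LINT y:{s<..t}|half_line. D (u x) \<bullet> v y - D (u y) \<bullet> v y)"
          unfolding I_def by (rule set_integral_diff(2)[symmetric, OF set_integral_inner_right(1)[OF vst(1)] vst(3)])
        finally have e2: "D (u x) \<bullet> (u t - u s) - I s t
           = (LINT y:{s<..t}|half_line. D (u x) \<bullet> v y - D (u y) \<bullet> v y)" .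
        have "\<bar>D (u x) \<bullet> (u t - u s) - I s t\<bar> \<le> (LINT y:{s<..t}|half_line. e / 2 * norm (v y))"
          unfolding e2 set_lebesgue_integral_def real_norm_def[symmetric]
        proof (rule Bochner_Integration.integral_norm_bound_integral)
          show "integrable half_line (\<lambda>y. indicat_real {s<..t} y *\<^sub>R (D (u x) \<bullet> v y - D (u y) \<bullet> v y))"
            using set_integral_diff(1)[OF set_integral_inner_right(1)[OF vst(1), of "D (u x)"] vst(3)]
            unfolding set_integrable_def .
          show "integrable half_line (\<lambda>y. indicat_real {s<..t} y *\<^sub>R (e / 2 * norm (v y)))"
            using set_integrable_mult_right[of "e / 2", OF vst(2)] unfolding set_integrable_def .
          fix y
          have "\<bar>D (u x) \<bullet> v y - D (u y) \<bullet> v y\<bar> \<le> e / 2 * norm (v y)" if "y \<in> {s<..t}"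
          proof -
            have "\<bar>(D (u x) - D (u y)) \<bullet> v y\<bar> \<le> norm (D (u x) - D (u y)) * norm (v y)"
              by (rule Cauchy_Schwarz_ineq2)
            also have "\<dots> \<le> e / 2 * norm (v y)"
              using near[of y] that r(2)[of "u y"]
              by (intro mult_right_mono) (auto simp: dist_norm norm_minus_commute less_imp_le)
            finally show ?thesis by (simp add: inner_diff_left)
          qed
          then show "norm (indicat_real {s<..t} y *\<^sub>R (D (u x) \<bullet> v y - D (u y) \<bullet> v y))
              \<le> indicat_real {s<..t} y *\<^sub>R (e / 2 * norm (v y))"
            by (auto simp: indicator_def)
        qed
        then have "\<bar>D (u x) \<bullet> (u t - u s) - I s t\<bar> \<le> e / 2 * V s t" by (simp add: V_def)
        with 1 show "\<bar>f (u t) - f (u s) - I s t\<bar> \<le> e * V s t" by linarith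
      qed
    qed
  qed
  then have le: "\<bar>f (u b) - f (u a) - I a b\<bar> \<le> e * V a b" if "e > 0" for e
    using that ab by (auto simp: P_def)
  have V0: "0 \<le> V a b" unfolding V_def set_lebesgue_integral_def by simp
  have "\<bar>f (u b) - f (u a) - I a b\<bar> \<le> 0"
  proof (rule field_le_epsilon)
    fix e :: real assume "e > 0"
    have "\<bar>f (u b) - f (u a) - I a b\<bar> \<le> e / (V a b + 1) * V a b"
      using \<open>e > 0\<close> V0 by (intro le) auto
    also have "\<dots> \<le> e" using V0 \<open>e > 0\<close> by (simp add: field_simps)
    finally show "\<bar>f (u b) - f (u a) - I a b\<bar> \<le> 0 + e" by simp
  qed
  then show "f (u b) - f (u a) = (LINT x:{a<..b}|half_line. D (u x) \<bullet> v x)" by (simp add: I_def)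
qed

section \<open>Integrals over bounded subintervals of the half-line\<close>

lemma space_half_line: "space half_line = {0<..}"
  by (simp add: space_restrict_space)

lemma set_integrable_half_line:
  fixes f :: "real \<Rightarrow> 'a::euclidean_space"
  assumes "A \<subseteq> {0<..}"
  shows "set_integrable half_line A f \<longleftrightarrow> set_integrable lebesgue A f"
proof -
  have "indicat_real {0<..} x *\<^sub>R indicat_real A x *\<^sub>R f x = indicat_real A x *\<^sub>R f x" for x
    using assms by (auto simp: indicator_def)
  then show ?thesis unfolding set_integrable_def
    by (subst integrable_restrict_space) (simp, simp only:)
qed

lemma set_integral_half_line:
  fixes f :: "real \<Rightarrow> 'a::euclidean_space"
  assumes "A \<subseteq> {0<..}"
  shows "(LINT x:A|half_line. f x) = (LINT x:A|lebesgue. f x)"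
proof -
  have "indicat_real {0<..} x *\<^sub>R indicat_real A x *\<^sub>R f x = indicat_real A x *\<^sub>R f x" for x
    using assms by (auto simp: indicator_def)
  then show ?thesis unfolding set_lebesgue_integral_def by (subst integral_restrict_space) (simp, simp only:)
qed

lemma continuous_set_integrable_Ioc:
  fixes f :: "real \<Rightarrow> 'a::euclidean_space"
  assumes "0 \<le> a" "continuous_on {a..b} f"
  shows "set_integrable half_line {a<..b} f"
proof -
  have "f absolutely_integrable_on {a..b}" by (rule absolutely_integrable_continuous_real[OF assms(2)])
  then have "f absolutely_integrable_on {a<..b}" by (rule set_integrable_subset) auto
  moreover have "{a<..b} \<subseteq> {0<..}" using assms(1) by auto
  ultimately show ?thesis by (simp add: set_integrable_half_line)
qed

lemma set_integral_Ioc_eq_integral: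
  fixes f :: "real \<Rightarrow> 'a::euclidean_space"
  assumes "0 \<le> a" "set_integrable half_line {a<..b} f"
  shows "(LINT x:{a<..b}|half_line. f x) = integral {a..b} f"
proof -
  have s: "{a<..b} \<subseteq> {0<..}" using assms(1) by auto
  then have "(LINT x:{a<..b}|half_line. f x) = integral {a<..b} f"
    using assms(2) by (simp add: set_integral_half_line set_integrable_half_line set_lebesgue_integral_eq_integral)
  also have "\<dots> = integral {a..b} f"
    by (rule integral_subset_negligible[symmetric, THEN sym]) (auto intro: negligible_subset[of "{a}"])
  finally show ?thesis .
qed

lemma FTC_half_line:
  fixes f f' :: "real \<Rightarrow> 'a::euclidean_space"
  assumes "0 \<le> a" "a \<le> b" "continuous_on {a..b} f'"
    and "\<And>x. x \<in> {a..b} \<Longrightarrow> (f has_vector_derivative f' x) (at x within {a..b})"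
  shows "f b - f a = (LINT x:{a<..b}|half_line. f' x)"
proof -
  have "(f' has_integral (f b - f a)) {a..b}"
    by (rule fundamental_theorem_of_calculus) (use assms in auto)
  then show ?thesis
    using set_integral_Ioc_eq_integral[OF assms(1) continuous_set_integrable_Ioc[OF assms(1,3)]]
    by (simp add: integral_unique)
qed

lemma integrable_indicator_Ioc: "0 \<le> a \<Longrightarrow> integrable half_line (indicat_real {a<..b})"
  using continuous_set_integrable_Ioc[of a b "\<lambda>_. 1::real"] by (simp add: set_integrable_def)

lemma integral_indicator_Ioc:
  assumes "0 \<le> a" "a \<le> b" shows "(LINT x|half_line. indicat_real {a<..b} x) = b - a"
  using FTC_half_line[of a b "\<lambda>_. 1::real" "\<lambda>x. x"] assms
  by (simp add: set_lebesgue_integral_def has_real_derivative_iff_has_vector_derivative[symmetric])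

lemma set_integral_mono_half_line:
  fixes f :: "real \<Rightarrow> real"
  assumes "integrable half_line f" "\<And>x. 0 < x \<Longrightarrow> 0 \<le> f x" "A \<in> sets half_line"
  shows "(LINT x:A|half_line. f x) \<le> (LINT x|half_line. f x)"
  unfolding set_lebesgue_integral_def
  by (rule integral_mono[OF integrable_mult_indicator[OF assms(3,1)] assms(1)])
    (use assms(2) in \<open>auto simp: indicator_def space_half_line\<close>)

lemma set_integrable_from_integrable:
  fixes f :: "real \<Rightarrow> 'a::euclidean_space"
  shows "integrable M f \<Longrightarrow> A \<in> sets M \<Longrightarrow> set_integrable M A f"
  unfolding set_integrable_def by (rule integrable_mult_indicator)

section \<open>Primitives of square integrable functions\<close>

text \<open>Integration from \<open>0\<close> builds in the boundary condition of \<open>H10\<close>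
  at the origin. The derivative is carried as a second argument, so no choice of
  \<open>weak_deriv\<close> enters the estimates; values of \<open>u\<close> at negative arguments
  are left free.\<close>

definition L2_primitive :: "(real \<Rightarrow> 'a::euclidean_space) \<Rightarrow> (real \<Rightarrow> 'a) \<Rightarrow> bool" where
  "L2_primitive u v \<longleftrightarrow> v \<in> borel_measurable half_line \<and> integrable half_line (\<lambda>x. (norm (v x))\<^sup>2) \<and>
     (\<forall>x\<ge>0. u x = (LINT t:{0<..x}|half_line. v t))"

lemma L2_set_integrable:
  fixes v :: "real \<Rightarrow> 'a::euclidean_space"
  assumes m: "v \<in> borel_measurable half_line" and i: "integrable half_line (\<lambda>x. (norm (v x))\<^sup>2)"
    and a: "0 \<le> a"
  shows "set_integrable half_line {a<..b} v"
  unfolding set_integrable_def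
proof (rule Bochner_Integration.integrable_bound)
  show "integrable half_line (\<lambda>x. indicat_real {a<..b} x + (norm (v x))\<^sup>2)"
    using i integrable_indicator_Ioc[OF a] by (rule Bochner_Integration.integrable_add[rotated])
  show "(\<lambda>x. indicat_real {a<..b} x *\<^sub>R v x) \<in> borel_measurable half_line"
    using m Ioc_in_half_line[OF a] by (intro borel_measurable_scaleR borel_measurable_indicator)
  have "norm (v x) \<le> 1 + (norm (v x))\<^sup>2" for x
    using sum_squares_bound[of 1 "norm (v x)"] norm_ge_zero[of "v x"] unfolding one_power2 mult_1_right by linarith
  then show "AE x in half_line. norm (indicat_real {a<..b} x *\<^sub>R v x)
      \<le> norm (indicat_real {a<..b} x + (norm (v x))\<^sup>2)"
    by (auto simp: indicator_def)
qed

text \<open>Cauchy-Schwarz against the indicator of the interval, whose squared norm is its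
  length.\<close>

lemma L2_Holder:
  fixes v :: "real \<Rightarrow> 'a::euclidean_space"
  assumes m: "v \<in> borel_measurable half_line" and i: "integrable half_line (\<lambda>x. (norm (v x))\<^sup>2)"
    and ab: "0 \<le> a" "a \<le> b"
  shows "(norm (LINT x:{a<..b}|half_line. v x))\<^sup>2 \<le> (b - a) * (LINT x:{a<..b}|half_line. (norm (v x))\<^sup>2)"
proof -
  let ?I = "indicat_real {a<..b}"
  have sq: "(?I x)\<^sup>2 = ?I x" "(?I x * norm (v x))\<^sup>2 = ?I x * (norm (v x))\<^sup>2"
    "?I x * (?I x * norm (v x)) = ?I x * norm (v x)" for x
    by (auto simp: indicator_def)
  have mi[measurable]: "?I \<in> borel_measurable half_line"
    by (intro borel_measurable_indicator Ioc_in_half_line ab)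
  have i2: "integrable half_line (\<lambda>x. ?I x * (norm (v x))\<^sup>2)"
    using integrable_mult_indicator[OF Ioc_in_half_line[OF ab(1)] i] by simp
  have "(LINT x|half_line. ?I x * (?I x * norm (v x)))\<^sup>2
     \<le> (LINT x|half_line. (?I x)\<^sup>2) * (LINT x|half_line. (?I x * norm (v x))\<^sup>2)"
    by (rule integral_Cauchy_Schwarz) (use m i2 integrable_indicator_Ioc[OF ab(1)] in \<open>auto simp: sq(1,2)\<close>)
  then have "(LINT x:{a<..b}|half_line. norm (v x))\<^sup>2 \<le> (b - a) * (LINT x:{a<..b}|half_line. (norm (v x))\<^sup>2)"
    unfolding sq integral_indicator_Ioc[OF ab] by (simp add: set_lebesgue_integral_def)
  moreover have "(norm (LINT x:{a<..b}|half_line. v x))\<^sup>2 \<le> (LINT x:{a<..b}|half_line. norm (v x))\<^sup>2"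
    by (intro power_mono set_integral_norm_le) auto
  ultimately show ?thesis by linarith
qed

context
  fixes u v :: "real \<Rightarrow> 'a::euclidean_space"
  assumes uv: "L2_primitive u v"
begin

lemma L2_primitiveD:
  "v \<in> borel_measurable half_line" "integrable half_line (\<lambda>x. (norm (v x))\<^sup>2)"
  "0 \<le> x \<Longrightarrow> u x = (LINT t:{0<..x}|half_line. v t)"
  using uv by (auto simp: L2_primitive_def)

lemma L2_primitive_set_integrable: "0 \<le> a \<Longrightarrow> set_integrable half_line {a<..b} v"
  by (rule L2_set_integrable[OF L2_primitiveD(1,2)])

lemma L2_primitive_0: "u 0 = 0"
  using L2_primitiveD(3)[of 0] by (simp add: set_lebesgue_integral_def)

lemma L2_primitive_diff:
  assumes "0 \<le> s" "s \<le> t" shows "u t - u s = (LINT x:{s<..t}|half_line. v x)"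
  using set_integral_Ioc_split[OF order_refl, of 0 s t t v] L2_primitive_set_integrable[of 0 t] assms L2_primitiveD(3)
  by (simp add: set_integral_Ioc_split[of 0 0 s t t v])

lemma L2_primitive_Holder:
  assumes "0 \<le> s" "s \<le> t"
  shows "(norm (u t - u s))\<^sup>2 \<le> (t - s) * (LINT x:{s<..t}|half_line. (norm (v x))\<^sup>2)"
  unfolding L2_primitive_diff[OF assms] by (rule L2_Holder[OF L2_primitiveD(1,2) assms])

text \<open>Hoelder continuity of exponent \<open>1/2\<close> with a constant that depends only on
  the norm of the derivative: an energy bound thus makes a whole sequence equicontinuous.\<close>

lemma L2_primitive_Holder':
  assumes "0 \<le> s" "0 \<le> t"
  shows "norm (u t - u s) \<le> sqrt \<bar>t - s\<bar> * sqrt (LINT x|half_line. (norm (v x))\<^sup>2)"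
proof -
  have *: "norm (u t - u s) \<le> sqrt \<bar>t - s\<bar> * sqrt (LINT x|half_line. (norm (v x))\<^sup>2)" if "0 \<le> s" "s \<le> t" for s t
  proof -
    have "(norm (u t - u s))\<^sup>2 \<le> (t - s) * (LINT x|half_line. (norm (v x))\<^sup>2)"
      using L2_primitive_Holder[OF that]
      by (rule order_trans)
        (use that in \<open>intro mult_left_mono set_integral_mono_half_line L2_primitiveD Ioc_in_half_line, auto\<close>)
    then show ?thesis using that by (simp add: real_le_rsqrt flip: real_sqrt_mult)
  qed
  show ?thesis using *[of s t] *[of t s] assms by (cases "s \<le> t") (auto simp: norm_minus_commute abs_minus_commute)
qed

lemma L2_primitive_continuous: "continuous_on {0..} u"
proof -
  define K where "K = (LINT x|half_line. (norm (v x))\<^sup>2)"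
  show ?thesis unfolding continuous_on_iff
  proof (intro ballI allI impI)
    fix x e :: real assume xe: "x \<in> {0..}" "0 < e"
    have K0: "0 \<le> K" by (simp add: K_def)
    define d where "d = e\<^sup>2 / (K + 1)"
    have "dist (u y) (u x) < e" if "y \<in> {0..}" "dist y x < d" for y
    proof -
      have "norm (u y - u x) \<le> sqrt \<bar>y - x\<bar> * sqrt K"
        unfolding K_def by (rule L2_primitive_Holder') (use that xe in auto)
      also have "\<dots> = sqrt (\<bar>y - x\<bar> * K)" by (simp add: real_sqrt_mult)
      also have "\<dots> < sqrt (e\<^sup>2)"
      proof -
        have "\<bar>y - x\<bar> * K \<le> \<bar>y - x\<bar> * (K + 1)" by (intro mult_left_mono) auto
        also have "\<dots> < d * (K + 1)" using that K0 by (intro mult_strict_right_mono) (auto simp: dist_real_def)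
        also have "\<dots> = e\<^sup>2" using K0 by (simp add: d_def)
        finally show ?thesis by (rule real_sqrt_less_mono)
      qed
      finally show ?thesis using xe by (simp add: dist_norm)
    qed
    moreover have "d > 0" using xe K0 by (simp add: d_def)
    ultimately show "\<exists>d>0. \<forall>y\<in>{0..}. dist y x < d \<longrightarrow> dist (u y) (u x) < e" by blast
  qed
qed

lemma L2_primitive_continuous_Icc: "0 \<le> a \<Longrightarrow> continuous_on {a..b} u"
  by (rule continuous_on_subset[OF L2_primitive_continuous]) auto

lemma L2_primitive_measurable: "u \<in> borel_measurable half_line"
proof (rule continuous_imp_measurable_on_sets_lebesgue)
  show "continuous_on {0<..} u"
    by (rule continuous_on_subset[OF L2_primitive_continuous]) auto
qed simp

lemma L2_primitive_chain_rule:
  assumes ab: "0 \<le> a" "a \<le> b"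
    and S: "open S" "\<And>x. x \<in> {a..b} \<Longrightarrow> u x \<in> S"
    and fd: "\<And>y. y \<in> S \<Longrightarrow> (f has_derivative (\<lambda>h. D y \<bullet> h)) (at y)"
    and Dc: "continuous_on S D"
  shows "set_integrable half_line {a<..b} (\<lambda>x. D (u x) \<bullet> v x)"
    and "f (u b) - f (u a) = (LINT x:{a<..b}|half_line. D (u x) \<bullet> v x)"
proof -
  note * = chain_rule_indefinite_integral[OF ab L2_primitive_set_integrable[OF ab(1)] _
      L2_primitive_continuous_Icc[OF ab(1)] S fd Dc]
  show "set_integrable half_line {a<..b} (\<lambda>x. D (u x) \<bullet> v x)"
    by (rule *(1)) (use ab in \<open>auto intro: L2_primitive_diff\<close>)
  show "f (u b) - f (u a) = (LINT x:{a<..b}|half_line. D (u x) \<bullet> v x)"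
    by (rule *(2)) (use ab in \<open>auto intro: L2_primitive_diff\<close>)
qed

text \<open>
  Differentiate \<open>sqrt (u \<bullet> u + e)\<close> and let \<open>e\<close> tend to \<open>0\<close>. Where \<open>u\<close> vanishes the quotient below
  is \<open>0\<close>, since \<open>x / 0 = 0\<close>.
\<close>

lemma L2_primitive_norm:
  "L2_primitive (\<lambda>x. norm (u x)) (\<lambda>x. (u x \<bullet> v x) / norm (u x))"
  and norm_derivative_le: "\<bar>(u x \<bullet> v x) / norm (u x)\<bar> \<le> norm (v x)"
proof -
  note [measurable] = L2_primitiveD(1) L2_primitive_measurable
  show le: "\<bar>(u x \<bullet> v x) / norm (u x)\<bar> \<le> norm (v x)" for x
    using Cauchy_Schwarz_ineq2[of "u x" "v x"] by (cases "u x = 0") (auto simp: field_simps abs_div)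
  have int: "integrable half_line (\<lambda>x. (norm ((u x \<bullet> v x) / norm (u x)))\<^sup>2)"
    by (rule Bochner_Integration.integrable_bound[OF L2_primitiveD(2)])
      (auto intro!: AE_I2 power_mono le simp del: power_divide abs_divide simp: power_mono[OF le, of _ 2, simplified])
  show "L2_primitive (\<lambda>x. norm (u x)) (\<lambda>x. (u x \<bullet> v x) / norm (u x))"
    unfolding L2_primitive_def
  proof (intro conjI allI impI int)
    show "(\<lambda>x. u x \<bullet> v x / norm (u x)) \<in> borel_measurable half_line" by measurable
    fix b :: real assume b: "0 \<le> b"
    define e where "e n = 1 / real (Suc n)" for n
    have e: "e n > 0" for n by (simp add: e_def)
    have elim: "e \<longlonglongrightarrow> 0" unfolding e_def by (rule LIMSEQ_Suc[OF lim_1_over_n])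
    have pos: "z \<bullet> z + e n > 0" for n and z :: 'a using e[of n] inner_ge_zero[of z] by linarith
    have eq: "sqrt (u b \<bullet> u b + e n) - sqrt (e n)
        = (LINT x:{0<..b}|half_line. (u x \<bullet> v x) / sqrt (u x \<bullet> u x + e n))" for n
    proof -
      have "sqrt (u b \<bullet> u b + e n) - sqrt (u 0 \<bullet> u 0 + e n)
         = (LINT x:{0<..b}|half_line. ((1 / sqrt (u x \<bullet> u x + e n)) *\<^sub>R u x) \<bullet> v x)"
      proof (rule L2_primitive_chain_rule(2)[where S = UNIV and f = "\<lambda>z. sqrt (z \<bullet> z + e n)"
            and D = "\<lambda>z. (1 / sqrt (z \<bullet> z + e n)) *\<^sub>R z"])
        fix y :: 'a
        show "((\<lambda>z. sqrt (z \<bullet> z + e n)) has_derivative (\<lambda>h. (1 / sqrt (y \<bullet> y + e n)) *\<^sub>R y \<bullet> h)) (at y)"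
          using pos[of y n]
          by (auto intro!: derivative_eq_intros simp: fun_eq_iff inner_commute field_simps)
      next
        show "continuous_on UNIV (\<lambda>z. (1 / sqrt (z \<bullet> z + e n)) *\<^sub>R (z::'a))"
          using pos[of _ n] by (intro continuous_intros) (metis less_irrefl real_sqrt_eq_zero_cancel_iff)
      qed (use b in auto)
      then show ?thesis by (simp add: L2_primitive_0)
    qed
    have "(\<lambda>n. LINT x:{0<..b}|half_line. (u x \<bullet> v x) / sqrt (u x \<bullet> u x + e n))
       \<longlonglongrightarrow> (LINT x:{0<..b}|half_line. (u x \<bullet> v x) / norm (u x))"
      unfolding set_lebesgue_integral_def
    proof (rule integral_dominated_convergence)
      show "integrable half_line (\<lambda>x. norm (indicat_real {0<..b} x *\<^sub>R v x))"
        using L2_primitive_set_integrable[of 0 b] unfolding set_integrable_def by (intro integrable_norm) simp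
      have I[measurable]: "indicat_real {0<..b} \<in> borel_measurable half_line"
        by (intro borel_measurable_indicator Ioc_in_half_line) simp
      show "(\<lambda>x. indicat_real {0<..b} x *\<^sub>R (u x \<bullet> v x / norm (u x))) \<in> borel_measurable half_line" by measurable
      show "(\<lambda>x. indicat_real {0<..b} x *\<^sub>R (u x \<bullet> v x / sqrt (u x \<bullet> u x + e n))) \<in> borel_measurable half_line" for n
        by measurable
      show "AE x in half_line. (\<lambda>n. indicat_real {0<..b} x *\<^sub>R (u x \<bullet> v x / sqrt (u x \<bullet> u x + e n)))
          \<longlonglongrightarrow> indicat_real {0<..b} x *\<^sub>R (u x \<bullet> v x / norm (u x))"
      proof (rule AE_I2)
        fix x
        have "(\<lambda>n. sqrt (u x \<bullet> u x + e n)) \<longlonglongrightarrow> sqrt (u x \<bullet> u x + 0)"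
          by (intro tendsto_intros elim)
        then have "(\<lambda>n. sqrt (u x \<bullet> u x + e n)) \<longlonglongrightarrow> norm (u x)" by (simp add: norm_eq_sqrt_inner)
        then show "(\<lambda>n. indicat_real {0<..b} x *\<^sub>R (u x \<bullet> v x / sqrt (u x \<bullet> u x + e n)))
          \<longlonglongrightarrow> indicat_real {0<..b} x *\<^sub>R (u x \<bullet> v x / norm (u x))"
          by (cases "u x = 0") (auto intro!: tendsto_intros)
      qed
      fix n
      have "\<bar>u x \<bullet> v x / sqrt (u x \<bullet> u x + e n)\<bar> \<le> norm (v x)" for x
      proof -
        have "norm (u x) \<le> sqrt (u x \<bullet> u x + e n)" using e[of n] by (simp add: norm_eq_sqrt_inner)
        then have "norm (u x) * norm (v x) \<le> sqrt (u x \<bullet> u x + e n) * norm (v x)" by (rule mult_right_mono) simp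
        then have "\<bar>u x \<bullet> v x\<bar> \<le> sqrt (u x \<bullet> u x + e n) * norm (v x)"
          using Cauchy_Schwarz_ineq2[of "u x" "v x"] by linarith
        then show ?thesis using pos[of "u x" n] by (simp add: abs_div field_simps)
      qed
      then show "AE x in half_line. norm (indicat_real {0<..b} x *\<^sub>R (u x \<bullet> v x / sqrt (u x \<bullet> u x + e n)))
          \<le> norm (indicat_real {0<..b} x *\<^sub>R v x)"
        by (auto simp: indicator_def)
    qed
    moreover have "(\<lambda>n. sqrt (u b \<bullet> u b + e n) - sqrt (e n)) \<longlonglongrightarrow> sqrt (u b \<bullet> u b + 0) - sqrt 0"
      by (intro tendsto_intros elim)
    ultimately show "norm (u b) = (LINT x:{0<..b}|half_line. (u x \<bullet> v x) / norm (u x))"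
      unfolding eq by (simp add: norm_eq_sqrt_inner LIMSEQ_unique)
  qed
qed

end

section \<open>Hardy's inequality and truncation\<close>

text \<open>Polarisation of the chain rule for the square.\<close>

lemma product_rule_indefinite_integral:
  fixes u1 v1 u2 v2 :: "real \<Rightarrow> real"
  assumes ab: "0 \<le> a" "a \<le> b"
    and v: "set_integrable half_line {a<..b} v1" "set_integrable half_line {a<..b} v2"
    and inc1: "\<And>s t. a \<le> s \<Longrightarrow> s \<le> t \<Longrightarrow> t \<le> b \<Longrightarrow> u1 t - u1 s = (LINT x:{s<..t}|half_line. v1 x)"
    and inc2: "\<And>s t. a \<le> s \<Longrightarrow> s \<le> t \<Longrightarrow> t \<le> b \<Longrightarrow> u2 t - u2 s = (LINT x:{s<..t}|half_line. v2 x)"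
    and c: "continuous_on {a..b} u1" "continuous_on {a..b} u2"
  shows "set_integrable half_line {a<..b} (\<lambda>x. u1 x * v2 x + u2 x * v1 x)"
    and "u1 b * u2 b - u1 a * u2 a = (LINT x:{a<..b}|half_line. u1 x * v2 x + u2 x * v1 x)"
proof -
  have i: "set_integrable half_line {a<..b} (\<lambda>x. u x * w x)"
    if "continuous_on {a..b} u" "set_integrable half_line {a<..b} w" for u w :: "real \<Rightarrow> real"
    using continuous_inner_set_integrable[OF that] by simp
  show si: "set_integrable half_line {a<..b} (\<lambda>x. u1 x * v2 x + u2 x * v1 x)"
    by (intro set_integral_add i c v)
  have sq: "(u b)\<^sup>2 - (u a)\<^sup>2 = 2 * (LINT x:{a<..b}|half_line. u x * w x)"
    if "set_integrable half_line {a<..b} w" "continuous_on {a..b} u"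
      "\<And>s t. a \<le> s \<Longrightarrow> s \<le> t \<Longrightarrow> t \<le> b \<Longrightarrow> u t - u s = (LINT x:{s<..t}|half_line. w x)"
    for u w :: "real \<Rightarrow> real"
  proof -
    have "(u b)\<^sup>2 - (u a)\<^sup>2 = (LINT x:{a<..b}|half_line. (2 * u x) \<bullet> w x)"
    proof (rule chain_rule_indefinite_integral(2)[OF ab that(1) that(3) that(2), where S = UNIV and D = "\<lambda>y. 2 * y"])
      show "((\<lambda>y. y\<^sup>2) has_derivative (\<bullet>) (2 * y)) (at y)" for y :: real
        by (auto intro!: derivative_eq_intros simp: fun_eq_iff)
    qed (auto intro!: continuous_intros)
    also have "\<dots> = (LINT x:{a<..b}|half_line. 2 * (u x * w x))" by (simp add: mult.assoc)
    finally show ?thesis by simp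
  qed
  have "((\<lambda>x. u1 x + u2 x) b)\<^sup>2 - ((\<lambda>x. u1 x + u2 x) a)\<^sup>2
     = 2 * (LINT x:{a<..b}|half_line. (u1 x + u2 x) * (v1 x + v2 x))"
  proof (rule sq)
    fix s t assume st: "a \<le> s" "s \<le> t" "t \<le> b"
    have "set_integrable half_line {s<..t} v1" "set_integrable half_line {s<..t} v2"
      using st ab by (auto intro!: set_integrable_subset[OF v(1)] set_integrable_subset[OF v(2)] Ioc_in_half_line)
    then show "u1 t + u2 t - (u1 s + u2 s) = (LINT x:{s<..t}|half_line. v1 x + v2 x)"
      using inc1[OF st] inc2[OF st] by simp
  qed (use v c in \<open>auto intro!: continuous_intros set_integral_add\<close>)
  also have "(LINT x:{a<..b}|half_line. (u1 x + u2 x) * (v1 x + v2 x))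
     = (LINT x:{a<..b}|half_line. (u1 x * v1 x + u2 x * v2 x) + (u1 x * v2 x + u2 x * v1 x))"
    by (simp add: algebra_simps)
  also have "\<dots> = (LINT x:{a<..b}|half_line. u1 x * v1 x) + (LINT x:{a<..b}|half_line. u2 x * v2 x)
     + (LINT x:{a<..b}|half_line. u1 x * v2 x + u2 x * v1 x)"
    using i[OF c(1) v(1)] i[OF c(2) v(2)] si by (simp only: set_integral_add)
  finally show "u1 b * u2 b - u1 a * u2 a = (LINT x:{a<..b}|half_line. u1 x * v2 x + u2 x * v1 x)"
    using sq[OF v(1) c(1) inc1] sq[OF v(2) c(2) inc2]
    by (simp add: power2_eq_square algebra_simps)
qed

text \<open>Hoelder's inequality starting from \<open>U 0 = 0\<close>. As the integral tends to
  \<open>0\<close> with \<open>x\<close>, it follows that \<open>U\<^sup>2\<close> is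
  \<open>o(x)\<close> at the origin, which removes the boundary term in Hardy's inequality.\<close>

lemma L2_primitive_sq_le:
  fixes U g :: "real \<Rightarrow> real"
  assumes "L2_primitive U g" "0 \<le> x"
  shows "(U x)\<^sup>2 \<le> x * (LINT t:{0<..x}|half_line. (g t)\<^sup>2)"
  using L2_primitive_Holder[OF assms(1) order_refl assms(2)] L2_primitive_0[OF assms(1)] by simp

lemma half_line_pos_AE: "AE x in half_line. 0 < x"
  by (rule AE_I2) (simp add: space_half_line)

lemma set_integral_Ioc_0_tendsto:
  fixes f :: "real \<Rightarrow> real"
  assumes "integrable half_line f"
  shows "(\<lambda>n. LINT x:{0<..1 / real (Suc n)}|half_line. f x) \<longlonglongrightarrow> 0"
proof -
  have "(\<lambda>n. LINT x:{0<..1 / real (Suc n)}|half_line. f x) \<longlonglongrightarrow> (LINT x|half_line. 0)"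
    unfolding set_lebesgue_integral_def
  proof (rule integral_dominated_convergence)
    show "integrable half_line (\<lambda>x. norm (f x))" using assms by (rule integrable_norm)
    show "(\<lambda>x. indicat_real {0<..1 / real (Suc n)} x *\<^sub>R f x) \<in> borel_measurable half_line" for n
      using assms by (intro borel_measurable_scaleR borel_measurable_indicator Ioc_in_half_line) auto
    show "AE x in half_line. (\<lambda>n. indicat_real {0<..1 / real (Suc n)} x *\<^sub>R f x) \<longlonglongrightarrow> 0"
      using half_line_pos_AE
    proof eventually_elim
      case (elim x)
      have "(\<lambda>n. 1 / real (Suc n)) \<longlonglongrightarrow> 0" by (rule LIMSEQ_Suc[OF lim_1_over_n])
      then have "\<forall>\<^sub>F n in sequentially. 1 / real (Suc n) < x" using elim by (rule order_tendstoD)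
      then have "\<forall>\<^sub>F n in sequentially. indicat_real {0<..1 / real (Suc n)} x *\<^sub>R f x = 0"
        by eventually_elim (simp add: indicator_def)
      then show ?case by (rule tendsto_eventually)
    qed
    show "AE x in half_line. norm (indicat_real {0<..1 / real (Suc n)} x *\<^sub>R f x) \<le> norm (f x)" for n
      by (auto simp: indicator_def)
  qed simp
  then show ?thesis by simp
qed

text \<open>On \<open>{a..b}\<close> the estimate follows by integrating the derivative of \<open>U\<^sup>2 / x\<close>.\<close>

lemma Hardy:
  fixes U g :: "real \<Rightarrow> real"
  assumes Ug: "L2_primitive U g"
  shows "integrable half_line (\<lambda>x. (U x)\<^sup>2 / x\<^sup>2)"
    and "(LINT x|half_line. (U x)\<^sup>2 / x\<^sup>2) \<le> 4 * (LINT x|half_line. (g x)\<^sup>2)"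
proof -
  note [measurable] = L2_primitiveD(1)[OF Ug] L2_primitive_measurable[OF Ug]
  have [measurable]: "(\<lambda>x. x) \<in> borel_measurable half_line" by (rule borel_measurable_half_line) simp
  have g2: "integrable half_line (\<lambda>x. (g x)\<^sup>2)" using L2_primitiveD(2)[OF Ug] by simp
  define K where "K = (LINT x|half_line. (g x)\<^sup>2)"
  \<comment> \<open>The last term dominates the boundary contribution of
    \<open>U\<^sup>2 / x\<close> at \<open>a\<close>. It is kept explicit because it vanishes as
    \<open>a\<close> tends to \<open>0\<close>, so that the constant \<open>4\<close> survives in
    the limit.\<close>
  have loc: "set_integrable half_line {a<..b} (\<lambda>x. (U x)\<^sup>2 / x\<^sup>2) \<and>
     (LINT x:{a<..b}|half_line. (U x)\<^sup>2 / x\<^sup>2) \<le> 4 * K + 2 * (LINT x:{0<..a}|half_line. (g x)\<^sup>2)"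
    if ab: "0 < a" "a \<le> b" for a b
  proof -
    have a0: "0 \<le> a" using ab by simp
    have cU: "continuous_on {s..t} U" if "0 \<le> s" for s t by (rule L2_primitive_continuous_Icc[OF Ug that])
    have gi: "set_integrable half_line {s<..t} g" if "0 \<le> s" for s t by (rule L2_primitive_set_integrable[OF Ug that])
    have c1: "continuous_on {a..b} (\<lambda>x. U x * U x)" "continuous_on {a..b} (\<lambda>x. 1 / x)"
      "continuous_on {a..b} (\<lambda>x. - 1 / x\<^sup>2)" "continuous_on {a..b} (\<lambda>x. (U x)\<^sup>2 / x\<^sup>2)"
      using ab cU[OF a0] by (auto intro!: continuous_intros)
    have UU: "set_integrable half_line {s<..t} (\<lambda>x. U x * g x + U x * g x)"
        "U t * U t - U s * U s = (LINT x:{s<..t}|half_line. U x * g x + U x * g x)"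
      if "0 \<le> s" "s \<le> t" for s t
      by (rule product_rule_indefinite_integral[OF that gi gi _ _ cU cU];
          use that in \<open>simp add: L2_primitive_diff[OF Ug]\<close>)+
    have pr: "set_integrable half_line {a<..b} (\<lambda>x. (U x * U x) * (- 1 / x\<^sup>2) + (1 / x) * (U x * g x + U x * g x))"
      "U b * U b * (1 / b) - U a * U a * (1 / a)
        = (LINT x:{a<..b}|half_line. (U x * U x) * (- 1 / x\<^sup>2) + (1 / x) * (U x * g x + U x * g x))"
    proof -
      have inc1: "U t * U t - U s * U s = (LINT x:{s<..t}|half_line. U x * g x + U x * g x)"
        if "a \<le> s" "s \<le> t" "t \<le> b" for s t using UU(2)[of s t] that ab by simp
      have inc2: "1 / t - 1 / s = (LINT x:{s<..t}|half_line. - 1 / x\<^sup>2)"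
        if "a \<le> s" "s \<le> t" "t \<le> b" for s t
      proof (rule FTC_half_line)
        show "continuous_on {s..t} (\<lambda>x. - 1 / x\<^sup>2)" using that ab by (auto intro!: continuous_intros)
        fix x assume "x \<in> {s..t}"
        then have "((\<lambda>x. 1 / x) has_real_derivative - 1 / x\<^sup>2) (at x)"
          using that ab by (auto intro!: derivative_eq_intros simp: power2_eq_square)
        then show "((\<lambda>x. 1 / x) has_vector_derivative - 1 / x\<^sup>2) (at x within {s..t})"
          using has_real_derivative_iff_has_vector_derivative has_vector_derivative_at_within by blast
      qed (use that ab in auto)
      have i2: "set_integrable half_line {a<..b} (\<lambda>x. - 1 / x\<^sup>2)"
        by (rule continuous_set_integrable_Ioc[OF a0 c1(3)])
      note P = product_rule_indefinite_integral[OF a0 ab(2) UU(1)[OF a0 ab(2)] i2 inc1 inc2 c1(1,2)]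
      show "set_integrable half_line {a<..b} (\<lambda>x. (U x * U x) * (- 1 / x\<^sup>2) + (1 / x) * (U x * g x + U x * g x))"
        by (rule P(1))
      show "U b * U b * (1 / b) - U a * U a * (1 / a)
        = (LINT x:{a<..b}|half_line. (U x * U x) * (- 1 / x\<^sup>2) + (1 / x) * (U x * g x + U x * g x))"
        by (rule P(2))
    qed
    have q: "set_integrable half_line {a<..b} (\<lambda>x. (U x)\<^sup>2 / x\<^sup>2)"
      by (rule continuous_set_integrable_Ioc[OF a0 c1(4)])
    have g2i: "set_integrable half_line {s<..t} (\<lambda>x. (g x)\<^sup>2)" if "0 \<le> s" for s t
      by (rule set_integrable_from_integrable[OF g2 Ioc_in_half_line[OF that]])
    have "(LINT x:{a<..b}|half_line. (1 / 2) * ((U x)\<^sup>2 / x\<^sup>2))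
       \<le> (LINT x:{a<..b}|half_line. 2 * (g x)\<^sup>2 - ((U x * U x) * (- 1 / x\<^sup>2) + (1 / x) * (U x * g x + U x * g x)))"
    proof (rule set_integral_mono)
      show "set_integrable half_line {a<..b} (\<lambda>x. 2 * (g x)\<^sup>2 - ((U x * U x) * (- 1 / x\<^sup>2) + (1 / x) * (U x * g x + U x * g x)))"
        by (intro set_integral_diff pr set_integrable_mult_right g2i a0)
      fix x assume "x \<in> {a<..b}"
      then have x: "x > 0" using ab by simp
      \<comment> \<open>Up to the factor \<open>1/2\<close> the pointwise inequality is this square.
        It vanishes for \<open>g = U / (2 x)\<close>, that is for multiples of the square root, the
        borderline profile behind the constant \<open>4\<close>.\<close>
      have "0 \<le> (U x / x - 2 * g x)\<^sup>2" by simp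
      also have "\<dots> = (U x)\<^sup>2 / x\<^sup>2 - 4 * (U x * g x / x) + 4 * (g x)\<^sup>2"
        using x by (simp add: power2_eq_square field_simps)
      finally have nn: "0 \<le> (U x)\<^sup>2 / x\<^sup>2 - 4 * (U x * g x / x) + 4 * (g x)\<^sup>2" .
      show "(1 / 2) * ((U x)\<^sup>2 / x\<^sup>2) \<le> 2 * (g x)\<^sup>2 - ((U x * U x) * (- 1 / x\<^sup>2) + (1 / x) * (U x * g x + U x * g x))"
      proof -
        have "(U x * U x) * (- 1 / x\<^sup>2) = - ((U x)\<^sup>2 / x\<^sup>2)" by (simp add: power2_eq_square)
        moreover have "(1 / x) * (U x * g x + U x * g x) = 2 * (U x * g x / x)" by (simp add: add_divide_distrib)
        ultimately show ?thesis using nn by linarith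
      qed
    qed (use q in \<open>intro set_integrable_mult_right\<close>)
    also have "\<dots> = 2 * (LINT x:{a<..b}|half_line. (g x)\<^sup>2) - (U b * U b * (1 / b) - U a * U a * (1 / a))"
      unfolding pr(2) using pr(1) g2i[OF a0]
      by (subst set_integral_diff) (auto intro!: set_integrable_mult_right)
    finally have 1: "(LINT x:{a<..b}|half_line. (U x)\<^sup>2 / x\<^sup>2)
        \<le> 4 * (LINT x:{a<..b}|half_line. (g x)\<^sup>2) - 2 * (U b * U b * (1 / b)) + 2 * (U a * U a * (1 / a))"
      unfolding set_integral_mult_right by linarith
    have "0 \<le> U b * U b * (1 / b)" using ab by simp
    moreover have "U a * U a * (1 / a) \<le> (LINT x:{0<..a}|half_line. (g x)\<^sup>2)"
      using L2_primitive_sq_le[OF Ug a0] ab by (simp add: field_simps power2_eq_square)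
    moreover have "(LINT x:{a<..b}|half_line. (g x)\<^sup>2) \<le> K"
      unfolding K_def by (rule set_integral_mono_half_line[OF g2 _ Ioc_in_half_line[OF a0]]) simp
    ultimately show ?thesis using 1 q by linarith
  qed
  define f where "f n x = indicat_real {1 / real (Suc n)<..real (Suc n)} x * ((U x)\<^sup>2 / x\<^sup>2)" for n x
  have le1: "1 / real (Suc n) \<le> real (Suc n)" for n by (simp add: field_simps)
  have fi: "integrable half_line (f n)" for n
    using loc[OF _ le1[of n]] unfolding f_def set_integrable_def by simp
  have fl: "(LINT x|half_line. f n x) \<le> 4 * K + 2 * (LINT x:{0<..1 / real (Suc n)}|half_line. (g x)\<^sup>2)" for n
    using loc[OF _ le1[of n]] unfolding f_def set_lebesgue_integral_def by simp
  have lim: "AE x in half_line. (\<lambda>n. f n x) \<longlonglongrightarrow> (U x)\<^sup>2 / x\<^sup>2"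
    using half_line_pos_AE
  proof eventually_elim
    case (elim x)
    have "(\<lambda>n. 1 / real (Suc n)) \<longlonglongrightarrow> 0" by (rule LIMSEQ_Suc[OF lim_1_over_n])
    then have "\<forall>\<^sub>F n in sequentially. 1 / real (Suc n) < x" using elim by (rule order_tendstoD)
    moreover have "\<forall>\<^sub>F n in sequentially. x \<le> real (Suc n)"
      using filterlim_at_top[THEN iffD1, OF filterlim_compose[OF filterlim_real_sequentially filterlim_Suc]] by blast
    ultimately have "\<forall>\<^sub>F n in sequentially. f n x = (U x)\<^sup>2 / x\<^sup>2"
      by eventually_elim (simp add: f_def)
    then show ?case by (rule tendsto_eventually)
  qed
  have ev: "\<forall>\<^sub>F n in sequentially. (LINT x|half_line. f n x) \<le> 4 * K + d" if "d > 0" for d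
  proof -
    have "\<forall>\<^sub>F n in sequentially. (LINT x:{0<..1 / real (Suc n)}|half_line. (g x)\<^sup>2) < d / 2"
      by (rule order_tendstoD(2)[OF set_integral_Ioc_0_tendsto[OF g2]]) (use that in simp)
    then show ?thesis
    proof eventually_elim
      case (elim n) then show ?case using fl[of n] by linarith
    qed
  qed
  have f0: "0 \<le> f n x" for n x by (simp add: f_def)
  have m: "(\<lambda>x. (U x)\<^sup>2 / x\<^sup>2) \<in> borel_measurable half_line" by measurable
  show "integrable half_line (\<lambda>x. (U x)\<^sup>2 / x\<^sup>2)"
    by (rule Fatou_real(1)[OF fi f0 m lim ev[of 1]]) simp
  show "(LINT x|half_line. (U x)\<^sup>2 / x\<^sup>2) \<le> 4 * (LINT x|half_line. (g x)\<^sup>2)"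
    unfolding K_def[symmetric]
    by (rule field_le_epsilon) (rule Fatou_real(2)[OF fi f0 m lim ev])
qed

section \<open>Combining, stopping and restarting primitives\<close>

lemma L2_primitive_cong:
  assumes "L2_primitive u v" "\<And>x. 0 \<le> x \<Longrightarrow> u x = u' x" "\<And>x. 0 < x \<Longrightarrow> v x = v' x"
  shows "L2_primitive u' v'"
proof -
  have "v' \<in> borel_measurable half_line"
    using L2_primitiveD(1)[OF assms(1)] measurable_cong[of half_line v v'] assms(3) by (simp add: space_half_line)
  moreover have "integrable half_line (\<lambda>x. (norm (v' x))\<^sup>2)"
    using L2_primitiveD(2)[OF assms(1)] assms(3)
      Bochner_Integration.integrable_cong[OF refl, of half_line "\<lambda>x. (norm (v x))\<^sup>2" "\<lambda>x. (norm (v' x))\<^sup>2"]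
    by (simp add: space_half_line)
  moreover have "u' x = (LINT t:{0<..x}|half_line. v' t)" if "0 \<le> x" for x
  proof -
    have "u' x = (LINT t:{0<..x}|half_line. v t)" using L2_primitiveD(3)[OF assms(1) that] assms(2)[OF that] by simp
    also have "\<dots> = (LINT t:{0<..x}|half_line. v' t)"
      unfolding set_lebesgue_integral_def
      by (rule Bochner_Integration.integral_cong) (auto simp: assms(3) indicator_def)
    finally show ?thesis .
  qed
  ultimately show ?thesis by (simp add: L2_primitive_def)
qed

lemma L2_primitive_lincomb:
  fixes u v u' v' :: "real \<Rightarrow> real"
  assumes "L2_primitive u v" "L2_primitive u' v'"
  shows "L2_primitive (\<lambda>x. a * u x + b * u' x) (\<lambda>x. a * v x + b * v' x)"
  unfolding L2_primitive_def
proof (intro conjI allI impI)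
  note D = L2_primitiveD[OF assms(1)] L2_primitiveD[OF assms(2)]
  show "(\<lambda>x. a * v x + b * v' x) \<in> borel_measurable half_line" using D by auto
  show "integrable half_line (\<lambda>x. (norm (a * v x + b * v' x))\<^sup>2)"
    using L2_lincomb_integrable[of v half_line v' a b] D by simp
  fix x :: real assume x: "0 \<le> x"
  have "set_integrable half_line {0<..x} v" "set_integrable half_line {0<..x} v'"
    using L2_primitive_set_integrable assms by auto
  then show "a * u x + b * u' x = (LINT t:{0<..x}|half_line. a * v t + b * v' t)"
    by (subst set_integral_add) (auto simp: D(3)[OF x] D(6)[OF x] intro!: set_integrable_mult_right)
qed

text \<open>Stopping at \<open>y\<close> only truncates the derivative. Together with the restart
  and the ramp below, this assembles piecewise functions by linear combination, without checking
  absolute continuity anew at the joints.\<close>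

lemma L2_primitive_stop:
  fixes u v :: "real \<Rightarrow> real"
  assumes uv: "L2_primitive u v" and y: "0 \<le> y"
  shows "L2_primitive (\<lambda>x. u (min x y)) (\<lambda>x. indicat_real {0<..y} x * v x)"
  unfolding L2_primitive_def
proof (intro conjI allI impI)
  note D = L2_primitiveD[OF uv]
  show "(\<lambda>x. indicat_real {0<..y} x * v x) \<in> borel_measurable half_line"
    by (intro borel_measurable_times borel_measurable_indicator Ioc_in_half_line D) simp
  have "(norm (indicat_real {0<..y} x * v x))\<^sup>2 = indicat_real {0<..y} x *\<^sub>R (norm (v x))\<^sup>2" for x
    by (simp add: indicator_def)
  then show "integrable half_line (\<lambda>x. (norm (indicat_real {0<..y} x * v x))\<^sup>2)"
    using integrable_mult_indicator[OF Ioc_in_half_line D(2)] by simp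
  fix x :: real assume x: "0 \<le> x"
  have "indicat_real {0<..x} t *\<^sub>R (indicat_real {0<..y} t * v t) = indicat_real {0<..min x y} t *\<^sub>R v t" for t
    by (simp add: indicator_def)
  then show "u (min x y) = (LINT t:{0<..x}|half_line. indicat_real {0<..y} t * v t)"
    unfolding set_lebesgue_integral_def by (simp only:)
      (use D(3)[of "min x y"] x y in \<open>simp add: set_lebesgue_integral_def\<close>)
qed

lemma L2_primitive_start:
  fixes u v :: "real \<Rightarrow> real"
  assumes uv: "L2_primitive u v" and y: "0 \<le> y"
  shows "L2_primitive (\<lambda>x. u (max x y) - u y) (\<lambda>x. indicat_real {y<..} x * v x)"
  by (rule L2_primitive_cong[OF L2_primitive_lincomb[OF uv L2_primitive_stop[OF uv y], of 1 "-1"]])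
    (auto simp: indicator_def min_def max_def)

lemma L2_primitive_ramp:
  assumes "0 \<le> b" shows "L2_primitive (\<lambda>x. min x b) (indicat_real {0<..b})"
  unfolding L2_primitive_def
proof (intro conjI allI impI)
  show "indicat_real {0<..b} \<in> borel_measurable half_line"
    by (intro borel_measurable_indicator Ioc_in_half_line) simp
  have "(norm (indicat_real {0<..b} x))\<^sup>2 = indicat_real {0<..b} x" for x by (simp add: indicator_def)
  then show "integrable half_line (\<lambda>x. (norm (indicat_real {0<..b} x))\<^sup>2)"
    using integrable_indicator_Ioc[of 0 b] by simp
  fix x :: real assume x: "0 \<le> x"
  have "indicat_real {0<..x} t *\<^sub>R indicat_real {0<..b} t = indicat_real {0<..min x b} t" for t
    by (simp add: indicator_def)
  then show "min x b = (LINT t:{0<..x}|half_line. indicat_real {0<..b} t)"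
    unfolding set_lebesgue_integral_def by (simp only:)
      (use integral_indicator_Ioc[of 0 "min x b"] x assms in simp)
qed

definition H1_primitive :: "(real \<Rightarrow> real) \<Rightarrow> (real \<Rightarrow> real) \<Rightarrow> bool" where
  "H1_primitive U g \<longleftrightarrow> L2_primitive U g \<and> integrable half_line (\<lambda>x. (U x)\<^sup>2)"

lemma H1_primitiveD:
  assumes "H1_primitive U g"
  shows "L2_primitive U g" "integrable half_line (\<lambda>x. (U x)\<^sup>2)" "integrable half_line (\<lambda>x. (g x)\<^sup>2)"
    "integrable half_line (\<lambda>x. (U x)\<^sup>2 / x\<^sup>2)"
    "U \<in> borel_measurable half_line" "g \<in> borel_measurable half_line"
  using assms L2_primitiveD[of U g] Hardy(1)[of U g] L2_primitive_measurable[of U g]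
  by (auto simp: H1_primitive_def)

lemma H1_primitive_lincomb:
  assumes "H1_primitive u v" "H1_primitive u' v'"
  shows "H1_primitive (\<lambda>x. a * u x + b * u' x) (\<lambda>x. a * v x + b * v' x)"
  unfolding H1_primitive_def
  using L2_primitive_lincomb[OF H1_primitiveD(1) H1_primitiveD(1)] L2_lincomb_integrable[of u half_line u']
    H1_primitiveD assms by auto

text \<open>On the unit interval to the right of \<open>x\<close> the function changes by at most
  the norm of its derivative. A larger value at \<open>x\<close> would leave \<open>U\<close> above
  its own \<open>L2\<close> norm throughout that interval.\<close>

lemma H1_primitive_bound:
  assumes H: "H1_primitive U g" and x: "0 \<le> x"
  shows "\<bar>U x\<bar> \<le> sqrt (LINT x|half_line. (U x)\<^sup>2) + sqrt (LINT x|half_line. (g x)\<^sup>2)"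
proof (rule ccontr)
  define A G where "A = (LINT x|half_line. (U x)\<^sup>2)" and "G = sqrt (LINT x|half_line. (g x)\<^sup>2)"
  assume "\<not> ?thesis"
  then have gt: "\<bar>U x\<bar> - G > sqrt A" by (simp add: A_def G_def)
  have A0: "A \<ge> 0" "G \<ge> 0" by (simp_all add: A_def G_def)
  have le: "(\<bar>U x\<bar> - G)\<^sup>2 \<le> (U y)\<^sup>2" if "y \<in> {x<..x + 1}" for y
  proof -
    have "\<bar>U y - U x\<bar> \<le> sqrt \<bar>y - x\<bar> * G"
      using L2_primitive_Holder'[OF H1_primitiveD(1)[OF H], of x y] that x by (simp add: G_def)
    also have "\<dots> \<le> 1 * G" using that A0 by (intro mult_right_mono) auto
    finally have "\<bar>U x\<bar> - G \<le> \<bar>U y\<bar>" by linarith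
    moreover have "0 \<le> \<bar>U x\<bar> - G" using gt A0 real_sqrt_ge_zero[of A] by linarith
    ultimately show ?thesis using power_mono[of "\<bar>U x\<bar> - G" "\<bar>U y\<bar>" 2] by simp
  qed
  have "(\<bar>U x\<bar> - G)\<^sup>2 = (LINT y|half_line. (\<bar>U x\<bar> - G)\<^sup>2 * indicat_real {x<..x + 1} y)"
    using integral_indicator_Ioc[of x "x + 1"] x by simp
  also have "\<dots> \<le> A" unfolding A_def
    by (rule integral_mono[OF integrable_mult_right[OF integrable_indicator_Ioc[OF x]] H1_primitiveD(2)[OF H]])
      (use le in \<open>auto simp: indicator_def\<close>)
  finally have "\<bar>U x\<bar> - G \<le> sqrt A" by (rule real_le_rsqrt)
  with gt show False by simp
qed

text \<open>A function that stays above \<open>d\<close> in modulus on an interval of length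
  \<open>(A + 1) / d\<^sup>2\<close> has squared norm at least \<open>A + 1\<close>. This stands in
  for decay at infinity when a point to cut at or to return to is wanted.\<close>

lemma H1_small_values:
  assumes H: "H1_primitive V v" and x: "0 \<le> x" and d: "0 < d"
  shows "\<exists>y\<ge>x. \<bar>V y\<bar> < d"
proof (rule ccontr)
  assume "\<not> ?thesis"
  then have ge: "d \<le> \<bar>V y\<bar>" if "x \<le> y" for y using that by (meson not_le)
  define A where "A = (LINT y|half_line. (V y)\<^sup>2)"
  define n where "n = (A + 1) / d\<^sup>2"
  have A: "0 \<le> A" by (simp add: A_def)
  have n: "0 \<le> n" using A by (simp add: n_def)
  have "A + 1 = (LINT y|half_line. d\<^sup>2 * indicat_real {x<..x + n} y)"
    using integral_indicator_Ioc[OF x, of "x + n"] n d by (simp add: n_def)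
  also have "\<dots> \<le> A" unfolding A_def
  proof (rule integral_mono[OF integrable_mult_right[OF integrable_indicator_Ioc[OF x]] H1_primitiveD(2)[OF H]])
    fix y
    show "d\<^sup>2 * indicat_real {x<..x + n} y \<le> (V y)\<^sup>2"
    proof (cases "y \<in> {x<..x + n}")
      case True
      then have "d\<^sup>2 \<le> \<bar>V y\<bar>\<^sup>2" using ge[of y] d by (intro power_mono) auto
      then show ?thesis using True by simp
    qed simp
  qed
  finally show False by simp
qed

section \<open>The constrained minimisation problem\<close>

text \<open>Either one base is at least \<open>1\<close>, or both lie between \<open>0\<close> and
  \<open>1\<close>, where \<open>x \<le> x powr r\<close>. For \<open>r = \<theta>\<close> this is
  why splitting the mass costs energy.\<close>

lemma powr_sum_ge_1:
  fixes a b r :: real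
  assumes "0 \<le> a" "0 \<le> b" "1 \<le> a + b" "0 < r" "r \<le> 1"
  shows "1 \<le> a powr r + b powr r"
proof -
  have le: "x \<le> x powr r" if "0 \<le> x" "x \<le> 1" for x
    using powr_mono'[of r 1 x] that assms by simp
  have ge: "1 \<le> x powr r" if "1 \<le> x" for x
    using that assms by (simp add: ge_one_powr_ge_zero)
  consider "a \<ge> 1" | "b \<ge> 1" | "a \<le> 1" "b \<le> 1" by linarith
  then show ?thesis
  proof cases
    case 1 then show ?thesis using ge[of a] powr_ge_zero[of b r] by linarith
  next
    case 2 then show ?thesis using ge[of b] powr_ge_zero[of a r] by linarith
  next
    case 3 then show ?thesis using le[of a] le[of b] assms by linarith
  qed
qed

section \<open>Energy and mass of nonnegative primitives, and their scaling\<close>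

locale nls_params =
  fixes c p \<omega> :: real
  assumes c: "0 < c" "c < 1 / 4" and p: "1 < p" and w: "0 < \<omega>"
begin

definition dens :: "(real \<Rightarrow> real) \<Rightarrow> (real \<Rightarrow> real) \<Rightarrow> real \<Rightarrow> real" where
  "dens U g x = (g x)\<^sup>2 - c * ((U x)\<^sup>2 / x\<^sup>2) + \<omega> * (U x)\<^sup>2"

definition energy :: "(real \<Rightarrow> real) \<Rightarrow> (real \<Rightarrow> real) \<Rightarrow> real" where
  "energy U g = (LINT x|half_line. dens U g x)"

definition mass :: "(real \<Rightarrow> real) \<Rightarrow> real" where
  "mass U = (LINT x|half_line. U x powr (p + 1))"

definition adm :: "(real \<Rightarrow> real) \<Rightarrow> (real \<Rightarrow> real) \<Rightarrow> bool" where
  "adm U g \<longleftrightarrow> H1_primitive U g \<and> (\<forall>x\<ge>0. 0 \<le> U x)"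

text \<open>Energy is homogeneous of degree \<open>2\<close> and mass of degree
  \<open>p + 1\<close>, so \<open>energy / mass powr \<theta>\<close> is constant along
  rays.\<close>

definition \<theta> :: real where "\<theta> = 2 / (p + 1)"

lemma \<theta>: "0 < \<theta>" "\<theta> < 1" "\<theta> * (p + 1) = 2"
  using p by (auto simp: \<theta>_def field_simps)

lemma dens_integrable: "H1_primitive U g \<Longrightarrow> integrable half_line (dens U g)"
  unfolding dens_def[abs_def]
  by (intro Bochner_Integration.integrable_add Bochner_Integration.integrable_diff integrable_mult_right H1_primitiveD)

lemma energy_eq:
  assumes "H1_primitive U g"
  shows "energy U g = (LINT x|half_line. (g x)\<^sup>2) - c * (LINT x|half_line. (U x)\<^sup>2 / x\<^sup>2)
     + \<omega> * (LINT x|half_line. (U x)\<^sup>2)"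
  unfolding energy_def dens_def using H1_primitiveD(2-4)[OF assms]
  by (simp del: times_divide_eq_right)

lemma energy_coercive:
  assumes "H1_primitive U g"
  shows "(1 - 4 * c) * (LINT x|half_line. (g x)\<^sup>2) + \<omega> * (LINT x|half_line. (U x)\<^sup>2) \<le> energy U g"
proof -
  have "c * (LINT x|half_line. (U x)\<^sup>2 / x\<^sup>2) \<le> c * (4 * (LINT x|half_line. (g x)\<^sup>2))"
    using Hardy(2)[OF H1_primitiveD(1)[OF assms]] c by (intro mult_left_mono) auto
  then show ?thesis unfolding energy_eq[OF assms] by (simp add: algebra_simps)
qed

lemma energy_le:
  assumes "H1_primitive U g"
  shows "energy U g \<le> (LINT x|half_line. (g x)\<^sup>2) + \<omega> * (LINT x|half_line. (U x)\<^sup>2)"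
  unfolding energy_eq[OF assms] using c by (simp add: Bochner_Integration.integral_nonneg)

lemma energy_nonneg:
  assumes "H1_primitive U g" shows "0 \<le> energy U g"
proof -
  have "0 \<le> (1 - 4 * c) * (LINT x|half_line. (g x)\<^sup>2) + \<omega> * (LINT x|half_line. (U x)\<^sup>2)"
    using c w by (intro add_nonneg_nonneg mult_nonneg_nonneg Bochner_Integration.integral_nonneg) auto
  then show ?thesis using energy_coercive[OF assms] by linarith
qed

text \<open>The polarised form, defined through the energy of the sum so that no mixed integrals
  have to be named. The factors \<open>1\<close> keep the terms in the shape produced by the rules
  for linear combinations.\<close>

definition polar :: "(real \<Rightarrow> real) \<Rightarrow> (real \<Rightarrow> real) \<Rightarrow> (real \<Rightarrow> real) \<Rightarrow> (real \<Rightarrow> real) \<Rightarrow> real" where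
  "polar U g W h = (energy (\<lambda>x. 1 * U x + 1 * W x) (\<lambda>x. 1 * g x + 1 * h x) - energy U g - energy W h) / 2"

lemma energy_lincomb:
  assumes "H1_primitive U g" "H1_primitive W h"
  shows "energy (\<lambda>x. a * U x + b * W x) (\<lambda>x. a * g x + b * h x)
     = a\<^sup>2 * energy U g + 2 * a * b * polar U g W h + b\<^sup>2 * energy W h"
proof -
  define P where "P x = dens (\<lambda>x. 1 * U x + 1 * W x) (\<lambda>x. 1 * g x + 1 * h x) x - dens U g x - dens W h x" for x
  have i: "integrable half_line (dens U g)" "integrable half_line (dens W h)"
    "integrable half_line (dens (\<lambda>x. 1 * U x + 1 * W x) (\<lambda>x. 1 * g x + 1 * h x))"
    using assms by (auto intro!: dens_integrable simp only: H1_primitive_lincomb)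
  then have iP: "integrable half_line P" unfolding P_def[abs_def] by auto
  have PB: "(LINT x|half_line. P x) = 2 * polar U g W h"
    using i unfolding P_def polar_def energy_def by simp
  have "dens (\<lambda>x. a * U x + b * W x) (\<lambda>x. a * g x + b * h x) x
     = a\<^sup>2 * dens U g x + a * b * P x + b\<^sup>2 * dens W h x" for x
    unfolding P_def dens_def by (simp add: power2_eq_square field_simps add_divide_distrib)
  then have "dens (\<lambda>x. a * U x + b * W x) (\<lambda>x. a * g x + b * h x)
     = (\<lambda>x. a\<^sup>2 * dens U g x + a * b * P x + b\<^sup>2 * dens W h x)" by (rule ext)
  then show ?thesis unfolding energy_def using i(1,2) iP PB by simp
qed

lemma polar_sq_le:
  assumes "H1_primitive U g" "H1_primitive W h"
  shows "(polar U g W h)\<^sup>2 \<le> energy U g * energy W h"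
  by (rule quadratic_form_Cauchy_Schwarz)
    (use energy_lincomb[OF assms] energy_nonneg[OF H1_primitive_lincomb[OF assms]] in auto)

lemma energy_scale: "energy (\<lambda>x. t * U x) (\<lambda>x. t * g x) = t\<^sup>2 * energy U g"
proof -
  have "dens (\<lambda>x. t * U x) (\<lambda>x. t * g x) x = t\<^sup>2 * dens U g x" for x
    unfolding dens_def by (simp add: power2_eq_square field_simps)
  then show ?thesis by (simp add: energy_def)
qed

lemma admD:
  assumes "adm U g"
  shows "H1_primitive U g" "0 \<le> x \<Longrightarrow> 0 \<le> U x"
  using assms by (auto simp: adm_def)

lemma H1_primitive_scale: "H1_primitive U g \<Longrightarrow> H1_primitive (\<lambda>x. t * U x) (\<lambda>x. t * g x)"
  using H1_primitive_lincomb[of U g U g t 0] by simp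

lemma adm_scale: "adm U g \<Longrightarrow> 0 \<le> t \<Longrightarrow> adm (\<lambda>x. t * U x) (\<lambda>x. t * g x)"
  using H1_primitive_scale by (auto simp: adm_def)

lemma mass_scale:
  assumes "adm U g" "0 \<le> t"
  shows "mass (\<lambda>x. t * U x) = t powr (p + 1) * mass U"
proof -
  have "mass (\<lambda>x. t * U x) = (LINT x|half_line. t powr (p + 1) * U x powr (p + 1))"
    unfolding mass_def by (rule Bochner_Integration.integral_cong)
      (use admD[OF assms(1)] assms(2) in \<open>auto simp: powr_mult space_half_line\<close>)
  then show ?thesis by (simp add: mass_def)
qed

text \<open>The excess of the exponent over \<open>2\<close> is absorbed by the upper bound
  \<open>K\<close>; for a bounded function the mass is thus dominated by the squared
  \<open>L2\<close> norm.\<close>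

lemma powr_bound:
  assumes "0 \<le> s" "s \<le> K" shows "s powr (p + 1) \<le> K powr (p - 1) * s\<^sup>2"
proof (cases "s = 0")
  case False
  then have "s powr (p + 1) = s powr (p - 1) * s\<^sup>2"
    using assms powr_add[of s "p - 1" 2] by (simp add: add.commute)
  also have "\<dots> \<le> K powr (p - 1) * s\<^sup>2"
    using assms p by (intro mult_right_mono powr_mono2) auto
  finally show ?thesis .
qed simp

lemma mass_integrable:
  assumes "adm U g" shows "integrable half_line (\<lambda>x. U x powr (p + 1))"
proof -
  note H = admD[OF assms]
  obtain K where K: "\<And>x. 0 \<le> x \<Longrightarrow> U x \<le> K" using H1_primitive_bound[OF H(1)] by (meson abs_le_D1)
  show ?thesis
  proof (rule Bochner_Integration.integrable_bound)
    show "integrable half_line (\<lambda>x. K powr (p - 1) * (U x)\<^sup>2)" using H1_primitiveD(2)[OF H(1)] by simp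
    show "(\<lambda>x. U x powr (p + 1)) \<in> borel_measurable half_line"
      using H1_primitiveD(5)[OF H(1)] by measurable
    show "AE x in half_line. norm (U x powr (p + 1)) \<le> norm (K powr (p - 1) * (U x)\<^sup>2)"
      using half_line_pos_AE by eventually_elim (use powr_bound H(2) K in auto)
  qed
qed

lemma mass_nonneg: "0 \<le> mass U"
  unfolding mass_def by (rule Bochner_Integration.integral_nonneg) simp

text \<open>Nonemptiness of this set comes later, from the soliton. Until then only lower bounds are
  drawn from it, through nonnegativity of the energy.\<close>

definition q :: real where
  "q = Inf {energy U g | U g. adm U g \<and> mass U = 1}"

lemma q_lower:
  assumes "adm U g" "mass U = 1" shows "q \<le> energy U g"
  unfolding q_def by (rule cInf_lower) (use assms energy_nonneg admD in \<open>auto intro!: bdd_belowI[of _ 0]\<close>)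

text \<open>Both sides have degree \<open>2\<close> along rays, so the mass may be normalised to
  \<open>1\<close>.\<close>

lemma q_mass_le:
  assumes "adm U g" shows "q * mass U powr \<theta> \<le> energy U g"
proof (cases "mass U = 0")
  case True
  then show ?thesis using energy_nonneg[OF admD(1)[OF assms]] by simp
next
  case False
  then have m: "mass U > 0" using mass_nonneg[of U] by simp
  define t where "t = mass U powr (- 1 / (p + 1))"
  have t: "t > 0" using m by (simp add: t_def)
  have "t powr (p + 1) = mass U powr (- 1)" using p by (simp add: t_def powr_powr)
  then have "mass (\<lambda>x. t * U x) = 1"
    using mass_scale[OF assms, of t] t m by (simp add: powr_minus)
  then have "q \<le> t\<^sup>2 * energy U g"
    using q_lower[OF adm_scale[OF assms, of t]] t by (simp add: energy_scale)
  moreover have "t\<^sup>2 = mass U powr (- \<theta>)"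
    using m p by (simp add: t_def power2_eq_square powr_add[symmetric] \<theta>_def)
  ultimately show ?thesis using m by (simp add: powr_minus field_simps)
qed

text \<open>
  Both pieces are continued to \<open>0\<close> by linear ramps of length \<open>1\<close>, each costing at most
  \<open>(1 + \<omega>) * (U y)\<^sup>2\<close>, because the potential term has a favourable sign.
\<close>

lemma cut:
  assumes U: "adm U g" and y: "1 \<le> y"
  obtains L l R r where "adm L l" "adm R r" "mass U \<le> mass L + mass R"
    "(LINT x:{y<..}|half_line. U x powr (p + 1)) \<le> mass R"
    "energy L l + energy R r \<le> energy U g + 2 * (1 + \<omega>) * (U y)\<^sup>2"
    "\<And>x. 0 \<le> x \<Longrightarrow> x \<le> y - 1 \<Longrightarrow> R x = 0"
proof -
  define d where "d = U y"
  note H = admD(1)[OF U]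
  note P = H1_primitiveD(1)[OF H]
  have y0: "0 \<le> y" "0 \<le> y - 1" "0 \<le> y + 1" using y by auto
  have d: "d \<ge> 0" using admD(2)[OF U y0(1)] by (simp add: d_def)
  \<comment> \<open>\<open>L\<close> follows \<open>U\<close> up to \<open>y\<close> and then
    descends; \<open>R\<close> ascends between \<open>y - 1\<close> and \<open>y\<close> and then
    follows \<open>U\<close>. The forms with \<open>min\<close> and \<open>max\<close> match stopped
    functions and ramps, so the derivatives come from the rules for those.\<close>
  define L where "L x = U (min x y) - d * (min x (y + 1) - min x y)" for x
  define l where "l x = indicat_real {0<..y} x * g x - d * (indicat_real {0<..y + 1} x - indicat_real {0<..y} x)" for x
  define R where "R x = U (max x y) - U y + d * (min x y - min x (y - 1))" for x
  define r where "r x = indicat_real {y<..} x * g x + d * (indicat_real {0<..y} x - indicat_real {0<..y - 1} x)" for x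
  have PL: "L2_primitive L l"
    by (rule L2_primitive_cong[OF L2_primitive_lincomb[OF L2_primitive_stop[OF P y0(1)]
          L2_primitive_lincomb[OF L2_primitive_ramp[OF y0(3)] L2_primitive_ramp[OF y0(1)], of 1 "-1"], of 1 "-d"]])
      (auto simp: L_def l_def algebra_simps)
  have PR: "L2_primitive R r"
    by (rule L2_primitive_cong[OF L2_primitive_lincomb[OF L2_primitive_start[OF P y0(1)]
          L2_primitive_lincomb[OF L2_primitive_ramp[OF y0(1)] L2_primitive_ramp[OF y0(2)], of 1 "-1"], of 1 d]])
      (auto simp: R_def r_def algebra_simps)
  have Lv: "L x = U x" "l x = g x" if "0 < x" "x \<le> y" for x using that y by (auto simp: L_def l_def)
  have Rv: "R x = U x" "r x = g x" if "y < x" for x using that y by (auto simp: R_def r_def d_def indicator_def)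
  have Lw: "0 \<le> L x \<and> L x \<le> d * indicat_real {y<..y + 1} x" "l x = - d * indicat_real {y<..y + 1} x" if "y < x" for x
  proof -
    have "L x = d * (1 - (min x (y + 1) - y))" using that by (simp add: L_def d_def algebra_simps min_def)
    moreover have "0 \<le> 1 - (min x (y + 1) - y)" "1 - (min x (y + 1) - y) \<le> indicat_real {y<..y + 1} x"
      using that by (auto simp: min_def indicator_def)
    ultimately show "0 \<le> L x \<and> L x \<le> d * indicat_real {y<..y + 1} x" using d by (auto intro: mult_left_mono)
    show "l x = - d * indicat_real {y<..y + 1} x" using that y by (auto simp: l_def indicator_def)
  qed
  have Rw: "0 \<le> R x \<and> R x \<le> d * indicat_real {y - 1<..y} x" "r x = d * indicat_real {y - 1<..y} x" if "0 < x" "x \<le> y" for x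
  proof -
    have "R x = d * (x - min x (y - 1))" using that by (simp add: R_def min_def max_def)
    moreover have "0 \<le> x - min x (y - 1)" "x - min x (y - 1) \<le> indicat_real {y - 1<..y} x"
      using that by (auto simp: min_def indicator_def)
    ultimately show "0 \<le> R x \<and> R x \<le> d * indicat_real {y - 1<..y} x" using d by (auto intro: mult_left_mono)
    show "r x = d * indicat_real {y - 1<..y} x" using that y by (auto simp: r_def indicator_def)
  qed
  have Lnn: "0 \<le> L x" and Rnn: "0 \<le> R x" if "0 < x" for x
    using Lv Rv Lw Rw admD(2)[OF U, of x] that by (cases "x \<le> y"; force)+
  have Lsq: "(L x)\<^sup>2 \<le> (U x)\<^sup>2 + d\<^sup>2 * indicat_real {y<..y + 1} x" if "0 < x" for x
  proof (cases "x \<le> y")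
    case True then show ?thesis using Lv that by simp
  next
    case False
    then have "(L x)\<^sup>2 \<le> (d * indicat_real {y<..y + 1} x)\<^sup>2" using Lw(1)[of x] by (intro power_mono) auto
    also have "\<dots> = d\<^sup>2 * indicat_real {y<..y + 1} x" by (simp add: indicator_def)
    finally show ?thesis by (smt (verit) zero_le_power2)
  qed
  have Rsq: "(R x)\<^sup>2 \<le> (U x)\<^sup>2 + d\<^sup>2 * indicat_real {y - 1<..y} x" if "0 < x" for x
  proof (cases "x \<le> y")
    case False then show ?thesis using Rv that by simp
  next
    case True
    then have "(R x)\<^sup>2 \<le> (d * indicat_real {y - 1<..y} x)\<^sup>2" using Rw(1)[of x] that by (intro power_mono) auto
    also have "\<dots> = d\<^sup>2 * indicat_real {y - 1<..y} x" by (simp add: indicator_def)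
    finally show ?thesis by (smt (verit) zero_le_power2)
  qed
  have sqi: "integrable half_line (\<lambda>x. (W x)\<^sup>2)"
    if W: "L2_primitive W k" and le: "\<And>x. 0 < x \<Longrightarrow> (W x)\<^sup>2 \<le> (U x)\<^sup>2 + d\<^sup>2 * indicat_real {a<..b} x" and a: "0 \<le> a"
    for W k a b
  proof (rule Bochner_Integration.integrable_bound)
    show "integrable half_line (\<lambda>x. (U x)\<^sup>2 + d\<^sup>2 * indicat_real {a<..b} x)"
      using H1_primitiveD(2)[OF H] integrable_indicator_Ioc[OF a] by simp
    show "(\<lambda>x. (W x)\<^sup>2) \<in> borel_measurable half_line" using L2_primitive_measurable[OF W] by simp
    show "AE x in half_line. norm ((W x)\<^sup>2) \<le> norm ((U x)\<^sup>2 + d\<^sup>2 * indicat_real {a<..b} x)"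
      using half_line_pos_AE by eventually_elim (use le in \<open>simp add: indicator_def\<close>)
  qed
  have HL: "H1_primitive L l" and HR: "H1_primitive R r"
    unfolding H1_primitive_def using PL PR sqi[OF PL Lsq y0(1)] sqi[OF PR Rsq y0(2)] by auto
  have L0: "L 0 = 0" "R 0 = 0" using L2_primitive_0[OF PL] L2_primitive_0[OF PR] .
  have aL: "adm L l" and aR: "adm R r"
    unfolding adm_def using HL HR Lnn Rnn L0 by (metis order_less_le order_refl)+
  note mi = mass_integrable[OF U] mass_integrable[OF aL] mass_integrable[OF aR]
  show ?thesis
  proof (rule that[OF aL aR])
    have "mass U \<le> (LINT x|half_line. L x powr (p + 1) + R x powr (p + 1))"
      unfolding mass_def
    proof (rule integral_mono_AE)
      show "AE x in half_line. U x powr (p + 1) \<le> L x powr (p + 1) + R x powr (p + 1)"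
        using half_line_pos_AE
      proof eventually_elim
        case (elim x)
        then show ?case using Lv(1)[of x] Rv(1)[of x] by (cases "x \<le> y") auto
      qed
    qed (use mi in auto)
    then show "mass U \<le> mass L + mass R" using mi by (simp add: mass_def)
    show "(LINT x:{y<..}|half_line. U x powr (p + 1)) \<le> mass R"
      unfolding mass_def set_lebesgue_integral_def
    proof (rule integral_mono_AE)
      have "{y<..} \<in> sets half_line" using y0 by (subst sets_restrict_space_iff) auto
      then show "integrable half_line (\<lambda>x. indicat_real {y<..} x *\<^sub>R U x powr (p + 1))"
        using mi(1) by (rule integrable_mult_indicator)
      show "AE x in half_line. indicat_real {y<..} x *\<^sub>R U x powr (p + 1) \<le> R x powr (p + 1)"
        by (rule AE_I2) (auto simp: indicator_def Rv(1))
    qed (rule mi)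
    have "energy L l + energy R r = (LINT x|half_line. dens L l x + dens R r x)"
      unfolding energy_def using dens_integrable HL HR by simp
    also have "\<dots> \<le> (LINT x|half_line. dens U g x + (1 + \<omega>) * d\<^sup>2 * indicat_real {y - 1<..y + 1} x)"
    proof (rule integral_mono_AE)
      show "AE x in half_line. dens L l x + dens R r x \<le> dens U g x + (1 + \<omega>) * d\<^sup>2 * indicat_real {y - 1<..y + 1} x"
        using half_line_pos_AE
      proof eventually_elim
        case (elim x)
        have bd: "dens W k x \<le> (1 + \<omega>) * d\<^sup>2 * indicat_real {y - 1<..y + 1} x"
          if "0 \<le> W x \<and> W x \<le> d * indicat_real {a<..b} x" "\<bar>k x\<bar> = d * indicat_real {a<..b} x"
            "y - 1 \<le> a" "b \<le> y + 1" for W k a b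
        proof -
          have I: "(d * indicat_real {a<..b} x)\<^sup>2 \<le> d\<^sup>2 * indicat_real {y - 1<..y + 1} x"
            using that(3,4) by (auto simp: indicator_def)
          have "(W x)\<^sup>2 \<le> (d * indicat_real {a<..b} x)\<^sup>2" using that by (intro power_mono) auto
          then have 1: "(W x)\<^sup>2 \<le> d\<^sup>2 * indicat_real {y - 1<..y + 1} x" using I by linarith
          have "(k x)\<^sup>2 = (d * indicat_real {a<..b} x)\<^sup>2" using that(2) by (metis power2_abs)
          then have 2: "(k x)\<^sup>2 \<le> d\<^sup>2 * indicat_real {y - 1<..y + 1} x" using I by linarith
          have "dens W k x \<le> (k x)\<^sup>2 + \<omega> * (W x)\<^sup>2" unfolding dens_def using c by simp
          also have "\<dots> \<le> d\<^sup>2 * indicat_real {y - 1<..y + 1} x + \<omega> * (d\<^sup>2 * indicat_real {y - 1<..y + 1} x)"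
            using 1 2 w by (intro add_mono mult_left_mono) auto
          finally show ?thesis by (simp add: algebra_simps)
        qed
        show ?case
        proof (cases "x \<le> y")
          case True
          have "dens L l x = dens U g x" using Lv[OF elim True] by (simp add: dens_def)
          moreover have "dens R r x \<le> (1 + \<omega>) * d\<^sup>2 * indicat_real {y - 1<..y + 1} x"
            by (rule bd[where a = "y - 1" and b = y]) (use Rw[OF elim True] d in auto)
          ultimately show ?thesis by linarith
        next
          case False
          have "dens R r x = dens U g x" using Rv[of x] False by (simp add: dens_def)
          moreover have "dens L l x \<le> (1 + \<omega>) * d\<^sup>2 * indicat_real {y - 1<..y + 1} x"
            by (rule bd[where a = y and b = "y + 1"]) (use Lw[of x] False d in auto)
          ultimately show ?thesis by linarith
        qed
      qed
    qed (use dens_integrable HL HR H integrable_indicator_Ioc[OF y0(2)] in auto)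
    also have "\<dots> = energy U g + (1 + \<omega>) * d\<^sup>2 * 2"
      unfolding energy_def using dens_integrable[OF H] integrable_indicator_Ioc[OF y0(2), of "y + 1"] integral_indicator_Ioc[OF y0(2), of "y + 1"]
      by simp
    finally show "energy L l + energy R r \<le> energy U g + 2 * (1 + \<omega>) * (U y)\<^sup>2" by (simp add: d_def algebra_simps)
    show "R x = 0" if "0 \<le> x" "x \<le> y - 1" for x using that by (simp add: R_def)
  qed
qed

end

section \<open>Compactness below the level of the line\<close>

context nls_params
begin

text \<open>Cut at \<open>y\<close> and add two bounds: \<open>q\<close> per
  \<open>mass powr \<theta>\<close> on the left, the larger \<open>q'\<close> on the right, where
  the potential is weak. As the powers of the two masses sum to at least \<open>1\<close>, the
  energies of the pieces amount to at least \<open>q\<close> plus a surplus from the right piece,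
  while they amount to at most the energy of \<open>U\<close> plus the cost of the cut.\<close>

lemma tail_bound:
  assumes U: "adm U g" "mass U = 1" and L: "2 \<le> L" "c / (\<omega> * (L - 1)\<^sup>2) \<le> 1"
    and lower: "\<And>W h. adm W h \<Longrightarrow>
      qi * mass W powr \<theta> \<le> (LINT x|half_line. (h x)\<^sup>2) + \<omega> * (LINT x|half_line. (W x)\<^sup>2)"
    and q': "q' \<le> (1 - c / (\<omega> * (L - 1)\<^sup>2)) * qi" "q \<le> q'" and q0: "0 \<le> q"
  shows "(q' - q) * (LINT x:{2 * L<..}|half_line. U x powr (p + 1)) powr \<theta>
      \<le> energy U g - q + 2 * (1 + \<omega>) * ((energy U g / \<omega> + 1) / L)"
proof -
  note H = admD(1)[OF U(1)]
  define A where "A = (LINT x|half_line. (U x)\<^sup>2)"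
  have "0 \<le> (1 - 4 * c) * (LINT x|half_line. (g x)\<^sup>2)"
    using c by (intro mult_nonneg_nonneg Bochner_Integration.integral_nonneg) auto
  then have "\<omega> * A \<le> energy U g" using energy_coercive[OF H] by (simp add: A_def)
  then have AE: "A \<le> energy U g / \<omega>" using w by (simp add: field_simps)
  \<comment> \<open>Pigeonhole on an interval of length \<open>L\<close>; the \<open>1\<close> added
    to \<open>A\<close> gives a strict contradiction.\<close>
  have "\<exists>y\<in>{L<..2 * L}. (U y)\<^sup>2 \<le> (A + 1) / L"
  proof (rule ccontr)
    assume "\<not> ?thesis"
    then have gt: "(A + 1) / L < (U y)\<^sup>2" if "y \<in> {L<..2 * L}" for y using that by (meson not_le)
    have L0: "0 \<le> L" "L \<le> 2 * L" using L by auto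
    have "A + 1 = (LINT y|half_line. (A + 1) / L * indicat_real {L<..2 * L} y)"
      using integral_indicator_Ioc[OF L0] L by simp
    also have "\<dots> \<le> A" unfolding A_def
      by (rule integral_mono[OF integrable_mult_right[OF integrable_indicator_Ioc[OF L0(1)]] H1_primitiveD(2)[OF H]])
       (use gt in \<open>auto simp: indicator_def A_def less_imp_le\<close>)
    finally show False by simp
  qed
  then obtain y where y: "L < y" "y \<le> 2 * L" "(U y)\<^sup>2 \<le> (A + 1) / L" by auto
  have y1: "1 \<le> y" using y L by simp
  obtain V v R r where cut: "adm V v" "adm R r" "mass U \<le> mass V + mass R"
    "(LINT x:{y<..}|half_line. U x powr (p + 1)) \<le> mass R"
    "energy V v + energy R r \<le> energy U g + 2 * (1 + \<omega>) * (U y)\<^sup>2"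
    "\<And>x. 0 \<le> x \<Longrightarrow> x \<le> y - 1 \<Longrightarrow> R x = 0"
    by (rule cut[OF U(1) y1]) blast
  \<comment> \<open>As \<open>R\<close> lives beyond \<open>y - 1 > L - 1\<close>, the potential
    uses up at most the fraction \<open>k\<close> of the term with \<open>\<omega>\<close>.\<close>
  define k where "k = c / (\<omega> * (L - 1)\<^sup>2)"
  note HR = admD(1)[OF cut(2)]
  have L1: "0 < (L - 1)\<^sup>2" using L by simp
  have "(LINT x|half_line. (R x)\<^sup>2 / x\<^sup>2) \<le> (LINT x|half_line. (1 / (L - 1)\<^sup>2) * (R x)\<^sup>2)"
  proof (rule integral_mono_AE[OF H1_primitiveD(4)[OF HR] integrable_mult_right[OF H1_primitiveD(2)[OF HR]]])
    show "AE x in half_line. (R x)\<^sup>2 / x\<^sup>2 \<le> 1 / (L - 1)\<^sup>2 * (R x)\<^sup>2"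
      using half_line_pos_AE
    proof eventually_elim
      case (elim x)
      show ?case
      proof (cases "x \<le> y - 1")
        case True then show ?thesis using cut(6)[of x] elim by simp
      next
        case False
        then have "(L - 1)\<^sup>2 \<le> x\<^sup>2" using y L by (intro power_mono) auto
        then have "(R x)\<^sup>2 / x\<^sup>2 \<le> (R x)\<^sup>2 / (L - 1)\<^sup>2" using L1 elim by (intro divide_left_mono) auto
        then show ?thesis by simp
      qed
    qed
  qed
  then have "c * (LINT x|half_line. (R x)\<^sup>2 / x\<^sup>2) \<le> c * ((1 / (L - 1)\<^sup>2) * (LINT x|half_line. (R x)\<^sup>2))"
    using c by (intro mult_left_mono) auto
  also have "\<dots> = k * (\<omega> * (LINT x|half_line. (R x)\<^sup>2))" using w by (simp add: k_def)
  finally have "c * (LINT x|half_line. (R x)\<^sup>2 / x\<^sup>2) \<le> k * (\<omega> * (LINT x|half_line. (R x)\<^sup>2))" .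
  moreover have "0 \<le> k * (LINT x|half_line. (r x)\<^sup>2)"
    using c w by (intro mult_nonneg_nonneg Bochner_Integration.integral_nonneg) (auto simp: k_def)
  ultimately have "(1 - k) * ((LINT x|half_line. (r x)\<^sup>2) + \<omega> * (LINT x|half_line. (R x)\<^sup>2)) \<le> energy R r"
    unfolding energy_eq[OF HR] by (simp add: algebra_simps)
  moreover have "(1 - k) * (qi * mass R powr \<theta>)
     \<le> (1 - k) * ((LINT x|half_line. (r x)\<^sup>2) + \<omega> * (LINT x|half_line. (R x)\<^sup>2))"
    using lower[OF cut(2)] L by (intro mult_left_mono) (auto simp: k_def)
  moreover have "q' * mass R powr \<theta> \<le> (1 - k) * qi * mass R powr \<theta>"
    using q' by (intro mult_right_mono) (auto simp: k_def)
  ultimately have R: "q' * mass R powr \<theta> \<le> energy R r" by (simp add: mult.assoc)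
  have "1 \<le> mass V powr \<theta> + mass R powr \<theta>"
    using cut(3) U(2) \<theta> mass_nonneg by (intro powr_sum_ge_1) auto
  then have "q * 1 \<le> q * (mass V powr \<theta> + mass R powr \<theta>)" using q0 by (intro mult_left_mono)
  then have "q + (q' - q) * mass R powr \<theta> \<le> energy V v + energy R r"
    using q_mass_le[OF cut(1)] R by (simp add: algebra_simps)
  also have "\<dots> \<le> energy U g + 2 * (1 + \<omega>) * (U y)\<^sup>2" by (rule cut)
  also have "\<dots> \<le> energy U g + 2 * (1 + \<omega>) * ((energy U g / \<omega> + 1) / L)"
  proof -
    have "(U y)\<^sup>2 \<le> (energy U g / \<omega> + 1) / L"
      using y(3) AE L by (smt (verit) divide_right_mono)
    then show ?thesis using w by (intro add_left_mono mult_left_mono) auto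
  qed
  finally have main: "(q' - q) * mass R powr \<theta> \<le> energy U g - q + 2 * (1 + \<omega>) * ((energy U g / \<omega> + 1) / L)"
    by linarith
  have sets: "{a<..} \<in> sets half_line" if "0 \<le> a" for a using that by (subst sets_restrict_space_iff) auto
  have nn: "0 \<le> (LINT x:{2 * L<..}|half_line. U x powr (p + 1))"
    unfolding set_lebesgue_integral_def by (rule Bochner_Integration.integral_nonneg) simp
  have "(LINT x:{2 * L<..}|half_line. U x powr (p + 1)) \<le> (LINT x:{y<..}|half_line. U x powr (p + 1))"
    unfolding set_lebesgue_integral_def
    by (rule integral_mono[OF integrable_mult_indicator[OF sets mass_integrable[OF U(1)]]
          integrable_mult_indicator[OF sets mass_integrable[OF U(1)]]])
      (use y L in \<open>auto simp: indicator_def\<close>)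
  also have "\<dots> \<le> mass R" by (rule cut)
  finally have "(LINT x:{2 * L<..}|half_line. U x powr (p + 1)) powr \<theta> \<le> mass R powr \<theta>"
    using nn \<theta> by (intro powr_mono2) auto
  then have "(q' - q) * (LINT x:{2 * L<..}|half_line. U x powr (p + 1)) powr \<theta> \<le> (q' - q) * mass R powr \<theta>"
    using q' by (intro mult_left_mono) auto
  with main show ?thesis by linarith
qed

text \<open>Dominated convergence with the constant \<open>K powr (p + 1)\<close>, integrable on
  bounded intervals only; on the rest of the half-line tightness has to take over.\<close>

lemma truncated_mass_tendsto:
  assumes m: "\<And>n. V n \<in> borel_measurable half_line" "W \<in> borel_measurable half_line"
    and bd: "\<And>n x. 0 < x \<Longrightarrow> 0 \<le> V n x" "\<And>n x. 0 < x \<Longrightarrow> V n x \<le> K"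
    and lim: "\<And>x. 0 < x \<Longrightarrow> (\<lambda>n. V n x) \<longlonglongrightarrow> W x"
  shows "(\<lambda>n. LINT x:{0<..b}|half_line. V n x powr (p + 1)) \<longlonglongrightarrow> (LINT x:{0<..b}|half_line. W x powr (p + 1))"
  unfolding set_lebesgue_integral_def
proof (rule integral_dominated_convergence)
  note [measurable] = m
  have [measurable]: "indicat_real {0<..b} \<in> borel_measurable half_line"
    by (intro borel_measurable_indicator Ioc_in_half_line) simp
  show "(\<lambda>x. indicat_real {0<..b} x *\<^sub>R W x powr (p + 1)) \<in> borel_measurable half_line"
    "(\<lambda>x. indicat_real {0<..b} x *\<^sub>R V n x powr (p + 1)) \<in> borel_measurable half_line" for n
    by measurable
  show "integrable half_line (\<lambda>x. K powr (p + 1) * indicat_real {0<..b} x)"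
    by (intro integrable_mult_right integrable_indicator_Ioc) simp
  show "AE x in half_line. (\<lambda>n. indicat_real {0<..b} x *\<^sub>R V n x powr (p + 1))
      \<longlonglongrightarrow> indicat_real {0<..b} x *\<^sub>R W x powr (p + 1)"
    using half_line_pos_AE
  proof eventually_elim
    case (elim x)
    have "(\<lambda>n. V n x powr (p + 1)) \<longlonglongrightarrow> W x powr (p + 1)"
      by (rule tendsto_powr2[OF lim[OF elim] tendsto_const]) (use bd elim p in auto)
    then show ?case by (intro tendsto_scaleR tendsto_const)
  qed
  show "AE x in half_line. norm (indicat_real {0<..b} x *\<^sub>R V n x powr (p + 1)) \<le> K powr (p + 1) * indicat_real {0<..b} x" for n
    using half_line_pos_AE
    by eventually_elim (use bd p in \<open>auto simp: indicator_def intro!: powr_mono2\<close>)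
qed

text \<open>\<open>qi\<close> may be any level that bounds the problem without potential from below.
  Mass far out is priced at nearly \<open>qi > q\<close>, so a minimising sequence cannot afford a
  tail. After that the limit is reached in norm, and the energy passes to it by Cauchy-Schwarz for
  \<open>polar\<close>.\<close>

theorem minimizer_exists:
  assumes ne: "\<exists>U g. adm U g \<and> mass U = 1"
    and lower: "\<And>W h. adm W h \<Longrightarrow>
      qi * mass W powr \<theta> \<le> (LINT x|half_line. (h x)\<^sup>2) + \<omega> * (LINT x|half_line. (W x)\<^sup>2)"
    and gap: "q < qi"
  obtains W h where "adm W h" "mass W = 1" "energy W h = q" "0 < q"
proof -
  let ?S = "{energy U g | U g. adm U g \<and> mass U = 1}"
  have Sne: "?S \<noteq> {}" using ne by auto
  have q0: "0 \<le> q" unfolding q_def by (rule cInf_greatest[OF Sne]) (use energy_nonneg admD in auto)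
  have "\<exists>U g. adm U g \<and> mass U = 1 \<and> energy U g < q + 1 / real (Suc n)" for n
  proof -
    have "Inf ?S < q + 1 / real (Suc n)" unfolding q_def[symmetric] by simp
    then show ?thesis using cInf_lessD[OF Sne] by blast
  qed
  then obtain U0 g0 where 0: "\<And>n. adm (U0 n) (g0 n)" "\<And>n. mass (U0 n) = 1"
    "\<And>n. energy (U0 n) (g0 n) < q + 1 / real (Suc n)" by metis
  have inv: "1 / real (Suc n) \<le> 1" for n by (simp add: field_simps)
  define G A K where "G = (q + 1) / (1 - 4 * c)" and "A = (q + 1) / \<omega>" and "K = sqrt A + sqrt G"
  have GA: "0 \<le> G" "0 \<le> A" using q0 c w by (auto simp: G_def A_def)
  have norms: "(LINT x|half_line. (g x)\<^sup>2) \<le> e / (1 - 4 * c)" "(LINT x|half_line. (U x)\<^sup>2) \<le> e / \<omega>"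
    if "H1_primitive U g" "energy U g \<le> e" for U g e
  proof -
    have "0 \<le> (1 - 4 * c) * (LINT x|half_line. (g x)\<^sup>2)" "0 \<le> \<omega> * (LINT x|half_line. (U x)\<^sup>2)"
      using c w by (auto intro!: mult_nonneg_nonneg Bochner_Integration.integral_nonneg)
    then have "(1 - 4 * c) * (LINT x|half_line. (g x)\<^sup>2) \<le> e" "\<omega> * (LINT x|half_line. (U x)\<^sup>2) \<le> e"
      using energy_coercive[OF that(1)] that(2) by linarith+
    then show "(LINT x|half_line. (g x)\<^sup>2) \<le> e / (1 - 4 * c)" "(LINT x|half_line. (U x)\<^sup>2) \<le> e / \<omega>"
      using c w by (simp_all add: field_simps)
  qed
  have e1: "energy (U0 n) (g0 n) \<le> q + 1" for n using 0(3)[of n] inv[of n] by linarith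
  have G0: "(LINT x|half_line. (g0 n x)\<^sup>2) \<le> G" "(LINT x|half_line. (U0 n x)\<^sup>2) \<le> A" for n
    using norms[OF admD(1)[OF 0(1)] e1] by (auto simp: G_def A_def)
  have K0: "\<bar>U0 n x\<bar> \<le> K" if "0 \<le> x" for n x
    using H1_primitive_bound[OF admD(1)[OF 0(1)[of n]] that] G0[of n] GA
    unfolding K_def by (smt (verit) real_sqrt_le_mono)
  \<comment> \<open>Convergence is extracted on a countable dense set; the common Hoelder bound
    extends it to every \<open>x \<ge> 0\<close>.\<close>
  have cnt: "countable (\<rat> \<inter> {0::real..})" by (intro countable_Int1 countable_rat)
  obtain r where r: "strict_mono r" "\<And>x. x \<in> \<rat> \<inter> {0..} \<Longrightarrow> \<exists>l. (\<lambda>n. U0 (r n) x) \<longlonglongrightarrow> l"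
    by (rule function_convergent_subsequence[OF cnt, of U0 K]) (use K0 in auto)
  define U g where "U n = U0 (r n)" and "g n = g0 (r n)" for n
  have adm: "adm (U n) (g n)" and mass: "mass (U n) = 1" for n using 0 by (auto simp: U_def g_def)
  note H = admD(1)[OF adm]
  note P = H1_primitiveD(1)[OF H]
  have En: "energy (U n) (g n) \<le> q + 1 / real (Suc n)" for n
  proof -
    have "n \<le> r n" using seq_suble[OF r(1)] .
    then have "1 / real (Suc (r n)) \<le> 1 / real (Suc n)" by (simp add: field_simps)
    then show ?thesis using 0(3)[of "r n"] by (simp add: U_def g_def)
  qed
  have Elim: "(\<lambda>n. q + 1 / real (Suc n)) \<longlonglongrightarrow> q"
    using tendsto_add[OF tendsto_const LIMSEQ_Suc[OF lim_1_over_n], of q] by simp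
  have Gn: "(LINT x|half_line. (g n x)\<^sup>2) \<le> G" "(LINT x|half_line. (U n x)\<^sup>2) \<le> A" for n
    using G0 by (auto simp: U_def g_def)
  have Kn: "0 \<le> U n x" "U n x \<le> K" if "0 \<le> x" for n x
    using K0[OF that, of "r n"] admD(2)[OF adm that] by (auto simp: U_def)
  have conv: "Cauchy (\<lambda>n. U n x)" if x: "0 \<le> x" for x
  proof (rule metric_CauchyI)
    fix e :: real assume e: "e > 0"
    \<comment> \<open>Points at distance below \<open>d\<close> have values within
      \<open>e / 3\<close> for all \<open>n\<close> at once; \<open>G + 1\<close> guards against
      division by zero.\<close>
    define d where "d = (e / 3)\<^sup>2 / (G + 1)"
    have d: "d > 0" using e GA by (simp add: d_def)
    obtain z where z: "z \<in> \<rat>" "x < z" "z < x + d" using Rats_dense_in_real[of x "x + d"] d by auto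
    have near: "\<bar>U n x - U n z\<bar> < e / 3" for n
    proof -
      have "\<bar>U n x - U n z\<bar> \<le> sqrt \<bar>x - z\<bar> * sqrt (LINT x|half_line. (norm (g n x))\<^sup>2)"
        using L2_primitive_Holder'[OF P, of z x n] z x by simp
      also have "\<dots> = sqrt (\<bar>x - z\<bar> * (LINT x|half_line. (g n x)\<^sup>2))" by (simp add: real_sqrt_mult)
      also have "\<dots> < sqrt ((e / 3)\<^sup>2)"
      proof (rule real_sqrt_less_mono)
        have "\<bar>x - z\<bar> * (LINT x|half_line. (g n x)\<^sup>2) \<le> \<bar>x - z\<bar> * (G + 1)"
          using Gn(1)[of n] by (intro mult_left_mono) auto
        also have "\<dots> < d * (G + 1)" using z GA by (intro mult_strict_right_mono) auto
        also have "\<dots> = (e / 3)\<^sup>2" using GA by (simp add: d_def)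
        finally show "\<bar>x - z\<bar> * (LINT x|half_line. (g n x)\<^sup>2) < (e / 3)\<^sup>2" .
      qed
      finally show ?thesis using e by simp
    qed
    have "convergent (\<lambda>n. U n z)" using r(2)[of z] z x by (auto simp: U_def convergent_def)
    then have "Cauchy (\<lambda>n. U n z)" by (rule convergent_Cauchy)
    then obtain M where M: "\<And>m n. m \<ge> M \<Longrightarrow> n \<ge> M \<Longrightarrow> dist (U m z) (U n z) < e / 3"
      using metric_CauchyD[of "\<lambda>n. U n z" "e / 3"] e by auto
    have "dist (U m x) (U n x) < e" if "m \<ge> M" "n \<ge> M" for m n
      using M[OF that] near[of m] near[of n] unfolding dist_real_def by linarith
    then show "\<exists>M. \<forall>m\<ge>M. \<forall>n\<ge>M. dist (U m x) (U n x) < e" by blast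
  qed
  define W where "W x = lim (\<lambda>n. U n x)" for x
  have W: "(\<lambda>n. U n x) \<longlonglongrightarrow> W x" if "0 \<le> x" for x
    using conv[OF that] by (simp add: W_def Cauchy_convergent_iff convergent_LIMSEQ_iff)
  note [measurable] = H1_primitiveD(5)[OF H] H1_primitiveD(6)[OF H]
  have [measurable]: "W \<in> borel_measurable half_line" unfolding W_def by measurable
  have W0: "0 \<le> W x" if "0 \<le> x" for x
    using W[OF that] by (rule LIMSEQ_le_const) (use Kn(1)[OF that] in auto)
  have sets: "{a<..} \<in> sets half_line" if "0 \<le> a" for a using that by (subst sets_restrict_space_iff) auto

  have tight: "\<exists>L. \<forall>\<^sub>F n in sequentially. 1 - \<eta> \<le> (LINT x:{0<..L}|half_line. U n x powr (p + 1))"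
    if \<eta>: "0 < \<eta>" for \<eta>
  proof -
    have qi: "0 < qi" using gap q0 by linarith
    define q' where "q' = (q + qi) / 2"
    have q': "q < q'" using gap by (simp add: q'_def)
    \<comment> \<open>Chosen so that giving up the fraction \<open>e\<close> of \<open>qi\<close>
      still leaves at least \<open>q'\<close>, the midpoint of \<open>q\<close> and
      \<open>qi\<close>.\<close>
    define e where "e = min 1 ((qi - q) / (2 * qi))"
    have e: "0 < e" "e \<le> 1" "e * qi \<le> (qi - q) / 2"
    proof -
      show "0 < e" using gap qi by (simp add: e_def)
      show "e \<le> 1" by (simp add: e_def)
      have "e * qi \<le> (qi - q) / (2 * qi) * qi" using qi by (intro mult_right_mono) (auto simp: e_def)
      also have "\<dots> = (qi - q) / 2" using qi by simp
      finally show "e * qi \<le> (qi - q) / 2" .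
    qed
    \<comment> \<open>Half of the surplus belonging to a tail of mass \<open>\<eta>\<close>. One
      half exceeds the excess energy of late members, the other covers the cost of the cut, which is
      at most \<open>B / L\<close>.\<close>
    define \<epsilon> where "\<epsilon> = (q' - q) * \<eta> powr \<theta> / 2"
    have \<epsilon>: "0 < \<epsilon>" using q' \<eta> by (simp add: \<epsilon>_def)
    define B where "B = 2 * (1 + \<omega>) * ((q + 1) / \<omega> + 1)"
    define L where "L = max 2 (max (1 + c / (\<omega> * e)) (B / \<epsilon>))"
    have L: "2 \<le> L" "1 + c / (\<omega> * e) \<le> L" "B / \<epsilon> \<le> L" by (auto simp: L_def)
    have k: "c / (\<omega> * (L - 1)\<^sup>2) \<le> e"
    proof -
      have "c / (\<omega> * e) \<le> L - 1" using L by simp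
      also have "\<dots> \<le> (L - 1)\<^sup>2" using L(1) by (simp add: power2_eq_square)
      finally show ?thesis using w e L by (simp add: field_simps)
    qed
    have kq: "q' \<le> (1 - c / (\<omega> * (L - 1)\<^sup>2)) * qi"
    proof -
      have "(1 - e) * qi \<le> (1 - c / (\<omega> * (L - 1)\<^sup>2)) * qi" using k qi by (intro mult_right_mono) auto
      moreover have "q' \<le> (1 - e) * qi" using e(3) by (simp add: q'_def field_simps)
      ultimately show ?thesis by linarith
    qed
    have "\<forall>\<^sub>F n in sequentially. q + 1 / real (Suc n) < q + \<epsilon>"
      by (rule order_tendstoD(2)[OF Elim]) (use \<epsilon> in simp)
    then have "\<forall>\<^sub>F n in sequentially. 1 - \<eta> \<le> (LINT x:{0<..2 * L}|half_line. U n x powr (p + 1))"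
    proof eventually_elim
      case (elim n)
      define T where "T = (LINT x:{2 * L<..}|half_line. U n x powr (p + 1))"
      have "(q' - q) * T powr \<theta>
        \<le> energy (U n) (g n) - q + 2 * (1 + \<omega>) * ((energy (U n) (g n) / \<omega> + 1) / L)"
        unfolding T_def
        by (rule tail_bound[OF adm mass L(1) _ lower kq _ q0]) (use k e q' in auto)
      also have "\<dots> < \<epsilon> + \<epsilon>"
      proof -
        have "energy (U n) (g n) \<le> q + 1" using En[of n] inv[of n] by linarith
        then have "2 * (1 + \<omega>) * ((energy (U n) (g n) / \<omega> + 1) / L) \<le> 2 * (1 + \<omega>) * (((q + 1) / \<omega> + 1) / L)"
          using w L(1) by (intro mult_left_mono divide_right_mono add_right_mono) auto
        also have "\<dots> = B / L" by (simp add: B_def)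
        also have "\<dots> \<le> \<epsilon>" using L \<epsilon> by (simp add: field_simps)
        finally show ?thesis using En[of n] elim by linarith
      qed
      also have "\<dots> = (q' - q) * \<eta> powr \<theta>" by (simp add: \<epsilon>_def)
      finally have "T powr \<theta> < \<eta> powr \<theta>" using q' by simp
      then have T: "T < \<eta>"
        using powr_mono2[of \<theta> \<eta> T] \<theta> \<eta> by (meson less_imp_le not_le)
      have mi: "integrable half_line (\<lambda>x. U n x powr (p + 1))" by (rule mass_integrable[OF adm])
      have L0: "0 \<le> 2 * L" using L by simp
      have "1 = (LINT x|half_line. U n x powr (p + 1))" using mass[of n] by (simp add: mass_def)
      also have "\<dots> = (LINT x|half_line. indicat_real {0<..2 * L} x *\<^sub>R U n x powr (p + 1) + indicat_real {2 * L<..} x *\<^sub>R U n x powr (p + 1))"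
        by (rule Bochner_Integration.integral_cong) (use L0 in \<open>auto simp: space_half_line indicator_def\<close>)
      also have "\<dots> = (LINT x:{0<..2 * L}|half_line. U n x powr (p + 1)) + T"
        unfolding T_def set_lebesgue_integral_def
        by (intro Bochner_Integration.integral_add integrable_mult_indicator mi Ioc_in_half_line sets L0) simp
      finally show ?case using T by linarith
    qed
    then show ?thesis by blast
  qed
  have adm_half: "adm (\<lambda>x. 1/2 * U m x + 1/2 * U n x) (\<lambda>x. 1/2 * g m x + 1/2 * g n x)" for m n
    unfolding adm_def by (intro conjI H1_primitive_lincomb[OF H H]) (use Kn(1) in auto)
  \<comment> \<open>Two index sequences are allowed because the negated Cauchy property below
    produces such pairs. Both tend to infinity, so the midpoints have the same pointwise limit
    \<open>W\<close>.\<close>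
  have pair: "\<forall>\<^sub>F k in sequentially. 1 - 2 * \<eta> \<le> mass (\<lambda>x. 1/2 * U (a k) x + 1/2 * U (b k) x)"
    and massW: "\<exists>L. 1 - \<eta> \<le> (LINT x:{0<..L}|half_line. W x powr (p + 1))"
    if \<eta>: "0 < \<eta>" and ab: "\<And>k. k \<le> a k" "\<And>k. k \<le> b k" for \<eta> and a b :: "nat \<Rightarrow> nat"
  proof -
    obtain L where L: "\<forall>\<^sub>F n in sequentially. 1 - \<eta> \<le> (LINT x:{0<..L}|half_line. U n x powr (p + 1))"
      using tight[OF \<eta>] by blast
    have "(\<lambda>n. LINT x:{0<..L}|half_line. U n x powr (p + 1)) \<longlonglongrightarrow> (LINT x:{0<..L}|half_line. W x powr (p + 1))"
      by (rule truncated_mass_tendsto[where K = K]) (use Kn W in auto)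
    then have WL: "1 - \<eta> \<le> (LINT x:{0<..L}|half_line. W x powr (p + 1))"
      using L by (rule tendsto_lowerbound) simp
    then show "\<exists>L. 1 - \<eta> \<le> (LINT x:{0<..L}|half_line. W x powr (p + 1))" by blast
    have fl: "filterlim a sequentially sequentially" "filterlim b sequentially sequentially"
      using ab by (auto intro!: filterlim_at_top_mono[OF filterlim_ident])
    have "(\<lambda>k. LINT x:{0<..L}|half_line. (1/2 * U (a k) x + 1/2 * U (b k) x) powr (p + 1))
        \<longlonglongrightarrow> (LINT x:{0<..L}|half_line. W x powr (p + 1))"
    proof (rule truncated_mass_tendsto[where K = K])
      fix x :: real assume x: "0 < x"
      have "(\<lambda>k. 1/2 * U (a k) x + 1/2 * U (b k) x) \<longlonglongrightarrow> 1/2 * W x + 1/2 * W x"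
        by (intro tendsto_intros filterlim_compose[OF W fl(1)] filterlim_compose[OF W fl(2)]) (use x in auto)
      then show "(\<lambda>k. 1/2 * U (a k) x + 1/2 * U (b k) x) \<longlonglongrightarrow> W x" by simp
      fix k
      show "0 \<le> 1/2 * U (a k) x + 1/2 * U (b k) x" "1/2 * U (a k) x + 1/2 * U (b k) x \<le> K"
        using Kn[of x "a k"] Kn[of x "b k"] x by linarith+
    qed measurable
    then have "\<forall>\<^sub>F k in sequentially. 1 - 2 * \<eta> < (LINT x:{0<..L}|half_line. (1/2 * U (a k) x + 1/2 * U (b k) x) powr (p + 1))"
      by (rule order_tendstoD) (use WL \<eta> in linarith)
    then show "\<forall>\<^sub>F k in sequentially. 1 - 2 * \<eta> \<le> mass (\<lambda>x. 1/2 * U (a k) x + 1/2 * U (b k) x)"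
    proof eventually_elim
      case (elim k)
      have "adm (\<lambda>x. 1/2 * U (a k) x + 1/2 * U (b k) x) (\<lambda>x. 1/2 * g (a k) x + 1/2 * g (b k) x)"
        by (rule adm_half)
      then have "(LINT x:{0<..L}|half_line. (1/2 * U (a k) x + 1/2 * U (b k) x) powr (p + 1))
         \<le> mass (\<lambda>x. 1/2 * U (a k) x + 1/2 * U (b k) x)"
        unfolding mass_def by (intro set_integral_mono_half_line mass_integrable Ioc_in_half_line) auto
      then show ?case using elim by linarith
    qed
  qed
  have ecauchy: "\<exists>N. \<forall>m\<ge>N. \<forall>n\<ge>N. energy (\<lambda>x. 1 * U m x + (-1) * U n x) (\<lambda>x. 1 * g m x + (-1) * g n x) < e"
    if e: "e > 0" for e
  proof (rule ccontr)
    assume "\<not> ?thesis"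
    then have "\<forall>k. \<exists>m n. m \<ge> k \<and> n \<ge> k \<and> e \<le> energy (\<lambda>x. 1 * U m x + (-1) * U n x) (\<lambda>x. 1 * g m x + (-1) * g n x)"
      by (meson not_le)
    then obtain a b where ab: "\<And>k. k \<le> a k" "\<And>k. k \<le> b k"
      "\<And>k. e \<le> energy (\<lambda>x. 1 * U (a k) x + (-1) * U (b k) x) (\<lambda>x. 1 * g (a k) x + (-1) * g (b k) x)" by metis
    \<comment> \<open>By the parallelogram identity the energy of a difference is twice the sum of
      the two energies minus four times that of the midpoint. Tolerance \<open>e / 16\<close> for
      the energies and this \<open>\<eta>\<close> bound it by
      \<open>4 * (e / 16) + 8 * (\<eta> * q)\<close>, hence by \<open>3 / 4 * e\<close>.\<close>
    define \<eta> where "\<eta> = min (1/4) (e / (16 * (q + 1)))"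
    have \<eta>: "0 < \<eta>" "\<eta> \<le> 1/4" "\<eta> * q \<le> e / 16"
    proof -
      show "0 < \<eta>" using e q0 by (simp add: \<eta>_def)
      show "\<eta> \<le> 1/4" unfolding \<eta>_def by (rule min.cobounded1)
      have "\<eta> * q \<le> e / (16 * (q + 1)) * (q + 1)" using q0 e by (intro mult_mono) (auto simp: \<eta>_def)
      also have "\<dots> = e / 16 / (q + 1) * (q + 1)" by simp
      also have "\<dots> = e / 16" by (rule nonzero_eq_divide_eq[THEN iffD1, OF _ refl]) (use q0 in simp)
      finally show "\<eta> * q \<le> e / 16" .
    qed
    have "\<forall>\<^sub>F k in sequentially. q + 1 / real (Suc k) < q + e / 16"
      by (rule order_tendstoD(2)[OF Elim]) (use e in simp)
    moreover note pair[OF \<eta>(1) ab(1,2)]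
    ultimately have "\<forall>\<^sub>F k in sequentially. False"
    proof eventually_elim
      case (elim k)
      let ?Ea = "energy (U (a k)) (g (a k))" and ?Eb = "energy (U (b k)) (g (b k))"
      have sm: "1 / real (Suc n) \<le> 1 / real (Suc k)" if "k \<le> n" for n using that by (simp add: field_simps)
      have Eab: "?Ea \<le> q + e / 16" "?Eb \<le> q + e / 16"
        using En[of "a k"] En[of "b k"] elim(1) sm[OF ab(1)] sm[OF ab(2)] by linarith+
      have adm2: "adm (\<lambda>x. 1/2 * U (a k) x + 1/2 * U (b k) x) (\<lambda>x. 1/2 * g (a k) x + 1/2 * g (b k) x)"
        by (rule adm_half)
      have "1 - 2 * \<eta> \<le> (1 - 2 * \<eta>) powr \<theta>" using powr_mono'[of \<theta> 1 "1 - 2 * \<eta>"] \<theta> \<eta> by simp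
      also have "\<dots> \<le> mass (\<lambda>x. 1/2 * U (a k) x + 1/2 * U (b k) x) powr \<theta>"
        using elim(2) \<eta> \<theta> by (intro powr_mono2) auto
      finally have "q * (1 - 2 * \<eta>) \<le> q * mass (\<lambda>x. 1/2 * U (a k) x + 1/2 * U (b k) x) powr \<theta>"
        using q0 by (intro mult_left_mono) auto
      also have "\<dots> \<le> energy (\<lambda>x. 1/2 * U (a k) x + 1/2 * U (b k) x) (\<lambda>x. 1/2 * g (a k) x + 1/2 * g (b k) x)"
        by (rule q_mass_le[OF adm2])
      finally have 1: "q * (1 - 2 * \<eta>) \<le> 1/4 * ?Ea + 1/2 * polar (U (a k)) (g (a k)) (U (b k)) (g (b k)) + 1/4 * ?Eb"
        unfolding energy_lincomb[OF H H] by (simp add: power2_eq_square)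
      have "e \<le> ?Ea - 2 * polar (U (a k)) (g (a k)) (U (b k)) (g (b k)) + ?Eb"
        using ab(3)[of k] unfolding energy_lincomb[OF H H] by simp
      moreover have "q * (1 - 2 * \<eta>) = q - 2 * (\<eta> * q)" by (simp add: algebra_simps)
      ultimately show False using 1 Eab \<eta>(3) e by linarith
    qed
    then show False by simp
  qed
  have gcauchy: "\<exists>N. \<forall>m\<ge>N. \<forall>n\<ge>N. (LINT x|half_line. (g m x - g n x)\<^sup>2) < e" if e: "e > 0" for e
  proof -
    obtain N where N: "\<forall>m\<ge>N. \<forall>n\<ge>N. energy (\<lambda>x. 1 * U m x + (-1) * U n x) (\<lambda>x. 1 * g m x + (-1) * g n x) < e / 2 * (1 - 4 * c)"
      using ecauchy[of "e / 2 * (1 - 4 * c)"] e c by auto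
    have "(LINT x|half_line. (g m x - g n x)\<^sup>2) < e" if "m \<ge> N" "n \<ge> N" for m n
    proof -
      have "(LINT x|half_line. (1 * g m x + (-1) * g n x)\<^sup>2) \<le> e / 2 * (1 - 4 * c) / (1 - 4 * c)"
        by (rule norms(1)[OF H1_primitive_lincomb[OF H H]]) (use N that in \<open>auto intro: less_imp_le\<close>)
      also have "\<dots> = e / 2" by (rule nonzero_mult_div_cancel_right) (use c in simp)
      finally show ?thesis using e by simp
    qed
    then show ?thesis by blast
  qed
  obtain h where h: "h \<in> borel_measurable half_line" "integrable half_line (\<lambda>x. (h x)\<^sup>2)"
    "(\<lambda>n. LINT x|half_line. (g n x - h x)\<^sup>2) \<longlonglongrightarrow> 0"
    by (rule L2_complete[of g half_line, OF H1_primitiveD(6)[OF H] H1_primitiveD(3)[OF H] gcauchy])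
  have gh: "integrable half_line (\<lambda>x. (g n x - h x)\<^sup>2)" for n
    using L2_lincomb_integrable[OF H1_primitiveD(6)[OF H] h(1) H1_primitiveD(3)[OF H] h(2), of 1 n "-1"] by simp
  \<comment> \<open>The derivatives converge in \<open>L2\<close>, hence their primitives converge
    pointwise, and that limit must be \<open>W\<close>.\<close>
  have PW: "L2_primitive W h"
    unfolding L2_primitive_def
  proof (intro conjI allI impI)
    fix x :: real assume x: "0 \<le> x"
    have "(\<lambda>n. U n x - (LINT t:{0<..x}|half_line. h t)) \<longlonglongrightarrow> 0"
    proof (rule Lim_null_comparison)
      have "(\<lambda>n. sqrt (x * (LINT x|half_line. (g n x - h x)\<^sup>2))) \<longlonglongrightarrow> sqrt (x * 0)"
        by (intro tendsto_intros h)
      then show "(\<lambda>n. sqrt (x * (LINT x|half_line. (g n x - h x)\<^sup>2))) \<longlonglongrightarrow> 0" by simp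
      show "\<forall>\<^sub>F n in sequentially. norm (U n x - (LINT t:{0<..x}|half_line. h t)) \<le> sqrt (x * (LINT x|half_line. (g n x - h x)\<^sup>2))"
      proof (rule always_eventually, rule allI)
        fix n
        have hi: "set_integrable half_line {0<..x} h" by (rule L2_set_integrable) (use h in auto)
        have "U n x - (LINT t:{0<..x}|half_line. h t) = (LINT t:{0<..x}|half_line. g n t - h t)"
          using L2_primitiveD(3)[OF P x, of n] set_integral_diff(2)[OF L2_primitive_set_integrable[OF P] hi, of n] by simp
        then have "(U n x - (LINT t:{0<..x}|half_line. h t))\<^sup>2 \<le> (x - 0) * (LINT t:{0<..x}|half_line. (norm (g n t - h t))\<^sup>2)"
          using L2_Holder[of "\<lambda>t. g n t - h t" 0 x] gh h(1) x by simp
        also have "\<dots> \<le> x * (LINT x|half_line. (g n x - h x)\<^sup>2)"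
          using set_integral_mono_half_line[OF gh, of n "{0<..x}"] x Ioc_in_half_line[of 0 x] by (simp add: mult_left_mono)
        finally show "norm (U n x - (LINT t:{0<..x}|half_line. h t)) \<le> sqrt (x * (LINT x|half_line. (g n x - h x)\<^sup>2))"
          by (simp add: real_le_rsqrt)
      qed
    qed
    then have "(\<lambda>n. U n x) \<longlonglongrightarrow> (LINT t:{0<..x}|half_line. h t)" by (simp add: LIM_zero_iff)
    then show "W x = (LINT t:{0<..x}|half_line. h t)" using W[OF x] LIMSEQ_unique by blast
  qed (use h in auto)
  have AEW: "AE x in half_line. (\<lambda>n. U n x) \<longlonglongrightarrow> W x"
    using half_line_pos_AE by eventually_elim (simp add: W)
  have W2: "integrable half_line (\<lambda>x. (W x)\<^sup>2)"
  proof (rule Fatou_real(1))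
    show "integrable half_line (\<lambda>x. (U n x)\<^sup>2)" for n by (rule H1_primitiveD(2)[OF H])
    show "AE x in half_line. (\<lambda>n. (U n x)\<^sup>2) \<longlonglongrightarrow> (W x)\<^sup>2"
      using AEW by eventually_elim (rule tendsto_power)
    show "\<forall>\<^sub>F n in sequentially. (LINT x|half_line. (U n x)\<^sup>2) \<le> A" using Gn(2) by simp
    show "(\<lambda>x. (W x)\<^sup>2) \<in> borel_measurable half_line" by measurable
  qed simp
  have HW: "H1_primitive W h" using PW W2 by (simp add: H1_primitive_def)
  have aW: "adm W h" using HW W0 by (simp add: adm_def)
  define Y y where "Y n x = 1 * W x + (-1) * U n x" and "y n x = 1 * h x + (-1) * g n x" for n x
  have HY: "H1_primitive (Y n) (y n)" for n
    unfolding Y_def[abs_def] y_def[abs_def] by (rule H1_primitive_lincomb[OF HW H])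
  have Ylim: "(\<lambda>n. energy (Y n) (y n)) \<longlonglongrightarrow> 0"
  proof (rule LIMSEQ_I)
    fix e :: real assume e: "e > 0"
    have "\<forall>\<^sub>F n in sequentially. (LINT x|half_line. (g n x - h x)\<^sup>2) < e / 2"
      by (rule order_tendstoD(2)[OF h(3)]) (use e in simp)
    then obtain N1 where N1: "\<And>n. n \<ge> N1 \<Longrightarrow> (LINT x|half_line. (g n x - h x)\<^sup>2) < e / 2"
      unfolding eventually_sequentially by blast
    obtain N2 where N2: "\<forall>m\<ge>N2. \<forall>n\<ge>N2. energy (\<lambda>x. 1 * U m x + (-1) * U n x) (\<lambda>x. 1 * g m x + (-1) * g n x) < e / 2"
      using ecauchy[of "e / 2"] e by auto
    have "norm (energy (Y n) (y n) - 0) < e" if n: "n \<ge> max N1 N2" for n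
    proof -
      have iU: "integrable half_line (\<lambda>x. (U m x - U n x)\<^sup>2)" for m
        using H1_primitiveD(2)[OF H1_primitive_lincomb[OF H H, of 1 m "-1" n]] by simp
      \<comment> \<open>Fatou in \<open>m\<close> for fixed \<open>n\<close>: the Cauchy bound on
        \<open>U m - U n\<close> passes to the pointwise limit.\<close>
      have "(LINT x|half_line. (W x - U n x)\<^sup>2) \<le> e / 2 / \<omega>"
      proof (rule Fatou_real(2)[OF iU])
        show "AE x in half_line. (\<lambda>m. (U m x - U n x)\<^sup>2) \<longlonglongrightarrow> (W x - U n x)\<^sup>2"
          using AEW by eventually_elim (intro tendsto_intros)
        show "\<forall>\<^sub>F m in sequentially. (LINT x|half_line. (U m x - U n x)\<^sup>2) \<le> e / 2 / \<omega>"
          using eventually_ge_at_top[of N2]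
        proof eventually_elim
          case (elim m)
          have "(LINT x|half_line. (1 * U m x + (-1) * U n x)\<^sup>2) \<le> e / 2 / \<omega>"
            by (rule norms(2)[OF H1_primitive_lincomb[OF H H]]) (use N2 elim n in \<open>auto intro: less_imp_le\<close>)
          then show ?case by simp
        qed
      qed auto
      then have "\<omega> * (LINT x|half_line. (Y n x)\<^sup>2) \<le> e / 2" using w by (simp add: Y_def field_simps)
      moreover have "(LINT x|half_line. (y n x)\<^sup>2) < e / 2"
        using N1[of n] n by (simp add: y_def power2_commute)
      ultimately have "energy (Y n) (y n) < e" using energy_le[OF HY, of n] by linarith
      then show ?thesis using energy_nonneg[OF HY, of n] by simp
    qed
    then show "\<exists>no. \<forall>n\<ge>no. norm (energy (Y n) (y n) - 0) < e" by blast
  qed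
  have Ew: "energy W h \<le> q"
  proof -
    have "energy W h \<le> (q + 1 / real (Suc n)) + 2 * sqrt ((q + 1) * energy (Y n) (y n)) + energy (Y n) (y n)" for n
    proof -
      have "(\<lambda>x. 1 * U n x + 1 * Y n x) = W" "(\<lambda>x. 1 * g n x + 1 * y n x) = h" by (auto simp: Y_def y_def)
      then have "energy W h = energy (U n) (g n) + 2 * polar (U n) (g n) (Y n) (y n) + energy (Y n) (y n)"
        using energy_lincomb[OF H HY, of 1 n 1 n] by simp
      moreover have "polar (U n) (g n) (Y n) (y n) \<le> sqrt ((q + 1) * energy (Y n) (y n))"
      proof (rule real_le_rsqrt)
        have "(polar (U n) (g n) (Y n) (y n))\<^sup>2 \<le> energy (U n) (g n) * energy (Y n) (y n)" by (rule polar_sq_le[OF H HY])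
        also have "\<dots> \<le> (q + 1) * energy (Y n) (y n)"
          by (rule mult_right_mono[OF order_trans[OF En[of n]] energy_nonneg[OF HY]]) (use inv[of n] in linarith)
        finally show "(polar (U n) (g n) (Y n) (y n))\<^sup>2 \<le> (q + 1) * energy (Y n) (y n)" .
      qed
      ultimately show ?thesis using En[of n] by linarith
    qed
    moreover have "(\<lambda>n. (q + 1 / real (Suc n)) + 2 * sqrt ((q + 1) * energy (Y n) (y n)) + energy (Y n) (y n))
        \<longlonglongrightarrow> q + 2 * sqrt ((q + 1) * 0) + 0"
      by (intro tendsto_intros Elim Ylim)
    ultimately show ?thesis using LIMSEQ_le_const[of _ "q" "energy W h"] by auto
  qed
  have m1: "1 \<le> mass W"
  proof (rule field_le_epsilon)
    fix e :: real assume e: "e > 0"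
    obtain L where "1 - e \<le> (LINT x:{0<..L}|half_line. W x powr (p + 1))"
      using massW[OF e, of "\<lambda>k. k" "\<lambda>k. k"] by auto
    also have "\<dots> \<le> mass W"
      unfolding mass_def by (intro set_integral_mono_half_line mass_integrable[OF aW] Ioc_in_half_line) auto
    finally show "1 \<le> mass W + e" by simp
  qed
  \<comment> \<open>\<open>W\<close> has mass at least \<open>1\<close>, so it is not zero and its
    energy is positive. This yields \<open>q > 0\<close>, which then cancels in
    \<open>q * mass W powr \<theta> \<le> q\<close> and bounds the mass from above.\<close>
  have Wpos: "0 < (LINT x|half_line. (W x)\<^sup>2)"
  proof (rule ccontr)
    assume "\<not> ?thesis"
    then have "(LINT x|half_line. (W x)\<^sup>2) = 0"
      using Bochner_Integration.integral_nonneg[of half_line "\<lambda>x. (W x)\<^sup>2"] by fastforce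
    then have "AE x in half_line. (W x)\<^sup>2 = 0"
      using integral_nonneg_eq_0_iff_AE[OF W2] by simp
    then have "mass W = (LINT x|half_line. 0)"
      unfolding mass_def by (intro integral_cong_AE) (auto elim!: eventually_mono)
    then show False using m1 by simp
  qed
  have "0 \<le> (1 - 4 * c) * (LINT x|half_line. (h x)\<^sup>2)"
    using c by (intro mult_nonneg_nonneg Bochner_Integration.integral_nonneg) auto
  moreover have "0 < \<omega> * (LINT x|half_line. (W x)\<^sup>2)" using w Wpos by simp
  ultimately have Epos: "0 < energy W h" using energy_coercive[OF HW] by linarith
  then have qpos: "0 < q" using Ew by linarith
  have qm: "q * mass W powr \<theta> \<le> q" using q_mass_le[OF aW] Ew by linarith
  then have le1: "mass W powr \<theta> \<le> 1" using qpos by simp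
  have "mass W \<le> 1"
  proof (rule ccontr)
    assume "\<not> mass W \<le> 1"
    then have "1 powr \<theta> < mass W powr \<theta>" using \<theta> by (intro powr_less_mono2) auto
    then show False using le1 by simp
  qed
  then have "mass W = 1" using m1 by simp
  moreover from this have "energy W h = q" using q_lower[OF aW] Ew by simp
  ultimately show ?thesis using that aW qpos by blast
qed

end

section \<open>The problem on the line\<close>

context nls_params
begin

text \<open>
  On the whole line the ground state energy is the length of the path from \<open>0\<close> to \<open>amp\<close> and back
  in the metric \<open>slope s * \<bar>ds\<bar>\<close>, where \<open>slope s ^ 2 / 2\<close> is the primitive of the nonlinearity
  \<open>\<omega> s - s ^ p\<close> and \<open>amp\<close> is its positive zero.
\<close>

definition \<kappa> :: real where "\<kappa> = 2 / (p + 1)"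

definition amp :: real where "amp = (\<omega> / \<kappa>) powr (1 / (p - 1))"

text \<open>\<open>max 0\<close> and the modulus extend the formula continuously to all real
  arguments; on the relevant range from \<open>0\<close> to \<open>amp\<close> the expression under
  the root is nonnegative by itself.\<close>

definition slope :: "real \<Rightarrow> real" where
  "slope s = s * sqrt (max 0 (\<omega> - \<kappa> * \<bar>s\<bar> powr (p - 1)))"

text \<open>Integration starts at \<open>-1\<close> so that the derivative at \<open>0\<close> is
  two-sided, as the chain rule on an open set demands; the subtraction normalises
  \<open>len 0 = 0\<close>.\<close>

definition len :: "real \<Rightarrow> real" where
  "len s = integral {-1..s} slope - integral {-1..0} slope"

lemma \<kappa>: "0 < \<kappa>" using p by (simp add: \<kappa>_def)

lemma amp_pos: "0 < amp"
  using w \<kappa> by (simp add: amp_def)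

lemma amp_powr: "amp powr (p - 1) = \<omega> / \<kappa>"
  using p w \<kappa> by (simp add: amp_def powr_powr)

lemma slope_continuous: "continuous_on S slope"
  unfolding slope_def[abs_def] using p by (intro continuous_intros continuous_on_powr') auto

lemma slope_sq:
  assumes "0 \<le> s" "s \<le> amp"
  shows "(slope s)\<^sup>2 = \<omega> * s\<^sup>2 - \<kappa> * s powr (p + 1)"
proof -
  have "s powr (p - 1) \<le> \<omega> / \<kappa>"
    using powr_mono2[of "p - 1" s amp] assms p amp_powr by simp
  then have "0 \<le> \<omega> - \<kappa> * s powr (p - 1)" using \<kappa> by (simp add: field_simps)
  then have "(slope s)\<^sup>2 = s\<^sup>2 * (\<omega> - \<kappa> * s powr (p - 1))"
    using assms by (simp add: slope_def power_mult_distrib)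
  also have "\<dots> = \<omega> * s\<^sup>2 - \<kappa> * (s\<^sup>2 * s powr (p - 1))" by (simp add: algebra_simps)
  also have "s\<^sup>2 * s powr (p - 1) = s powr (p + 1)"
  proof (cases "s = 0")
    case False
    then show ?thesis using assms powr_add[of s "p - 1" 2] by (simp add: add.commute)
  qed simp
  finally show ?thesis .
qed

lemma slope_nonneg: "0 \<le> s \<Longrightarrow> 0 \<le> slope s"
  by (simp add: slope_def)

lemma slope_pos:
  assumes "0 < s" "s < amp" shows "0 < slope s"
proof -
  have "s powr (p - 1) < amp powr (p - 1)" using assms p by (intro powr_less_mono2) auto
  then have "\<kappa> * s powr (p - 1) < \<omega>" using \<kappa> by (simp add: amp_powr field_simps)
  then show ?thesis using assms by (simp add: slope_def)
qed

lemma len_deriv: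
  assumes "-1 < s" shows "(len has_real_derivative slope s) (at s)"
proof -
  have "((\<lambda>x. integral {-1..x} slope) has_real_derivative slope s) (at s within {-1..s + 1})"
    by (rule integral_has_real_derivative[OF slope_continuous]) (use assms in auto)
  moreover have "at s within {-1..s + 1} = at s" by (rule at_within_Icc_at) (use assms in auto)
  ultimately have "((\<lambda>x. integral {-1..x} slope) has_real_derivative slope s) (at s)" by simp
  then show ?thesis unfolding len_def[abs_def] by (auto intro!: derivative_eq_intros)
qed

lemma len_0: "len 0 = 0" by (simp add: len_def)

lemma len_mono:
  assumes "0 \<le> s" "s \<le> t" shows "len s \<le> len t"
  by (rule DERIV_nonneg_imp_nondecreasing[OF assms(2)])
    (use assms len_deriv slope_nonneg in \<open>meson dual_order.trans less_le_trans neg_less_0_iff_less zero_less_one\<close>)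

lemma len_amp_pos: "0 < len amp"
proof -
  have "len 0 < len amp"
  proof (rule DERIV_pos_imp_increasing_open[OF amp_pos])
    fix x assume "0 < x" "x < amp"
    then show "\<exists>y. (len has_real_derivative y) (at x) \<and> 0 < y"
      using len_deriv[of x] slope_pos[of x] by auto
  next
    show "continuous_on {0..amp} len"
      by (rule DERIV_continuous_on[where D = slope])
        (use len_deriv in \<open>auto intro: has_field_derivative_at_within\<close>)
  qed
  then show ?thesis by (simp add: len_0)
qed

lemma len_isCont: "0 \<le> s \<Longrightarrow> isCont len s"
  using len_deriv[of s] DERIV_isCont by force

text \<open>Modica-Mortola argument. Below \<open>amp\<close> the action density is half of
  \<open>(v x)\<^sup>2 + (slope (V x))\<^sup>2\<close>, hence at least
  \<open>\<bar>slope (V x) * v x\<bar>\<close>, the speed of \<open>len (V x)\<close>. The curve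
  starts at \<open>0\<close>, comes close to \<open>amp\<close> and later returns close to
  \<open>0\<close>.\<close>

lemma action_lower_bound:
  assumes V: "adm V v" and le: "\<And>x. 0 \<le> x \<Longrightarrow> V x \<le> amp"
    and sup: "\<And>e. e > 0 \<Longrightarrow> \<exists>x\<ge>0. amp - e < V x"
  shows "2 * len amp \<le> (1 / 2) * ((LINT x|half_line. (v x)\<^sup>2) + \<omega> * (LINT x|half_line. (V x)\<^sup>2))
    - mass V / (p + 1)"
proof (rule field_le_epsilon)
  fix e :: real assume e: "e > 0"
  note H = admD(1)[OF V]
  note P = H1_primitiveD(1)[OF H]
  define D where "D x = (1 / 2) * ((v x)\<^sup>2 + (slope (V x))\<^sup>2)" for x
  have Deq: "D x = (1 / 2) * ((v x)\<^sup>2 + \<omega> * (V x)\<^sup>2) - V x powr (p + 1) / (p + 1)" if "0 < x" for x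
  proof -
    define z where "z = V x powr (p + 1) / (p + 1)"
    have "(slope (V x))\<^sup>2 = \<omega> * (V x)\<^sup>2 - 2 * z"
      using slope_sq[of "V x"] admD(2)[OF V, of x] le[of x] that by (simp add: \<kappa>_def z_def)
    then show ?thesis unfolding D_def z_def[symmetric] by simp
  qed
  have Di: "integrable half_line D \<longleftrightarrow> integrable half_line (\<lambda>x. (1 / 2) * ((v x)\<^sup>2 + \<omega> * (V x)\<^sup>2) - V x powr (p + 1) / (p + 1))"
    by (rule Bochner_Integration.integrable_cong) (auto simp: space_half_line Deq)
  have i2: "integrable half_line (\<lambda>x. (1 / 2) * ((v x)\<^sup>2 + \<omega> * (V x)\<^sup>2) - V x powr (p + 1) / (p + 1))"
    using H1_primitiveD[OF H] mass_integrable[OF V] by simp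
  have iD: "integrable half_line D" using Di i2 by blast
  have "(LINT x|half_line. D x) = (LINT x|half_line. (1 / 2) * ((v x)\<^sup>2 + \<omega> * (V x)\<^sup>2) - V x powr (p + 1) / (p + 1))"
    by (rule Bochner_Integration.integral_cong) (auto simp: space_half_line Deq)
  also have "\<dots> = (1 / 2) * ((LINT x|half_line. (v x)\<^sup>2) + \<omega> * (LINT x|half_line. (V x)\<^sup>2)) - mass V / (p + 1)"
    using H1_primitiveD(2,3)[OF H] mass_integrable[OF V] by (simp add: mass_def)
  finally have ID: "(LINT x|half_line. D x) = (1 / 2) * ((LINT x|half_line. (v x)\<^sup>2) + \<omega> * (LINT x|half_line. (V x)\<^sup>2)) - mass V / (p + 1)" .
  have D0: "0 \<le> D x" for x by (simp add: D_def)
  have chain: "len (V b) - len (V a) = (LINT x:{a<..b}|half_line. slope (V x) * v x)"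
    "set_integrable half_line {a<..b} (\<lambda>x. slope (V x) * v x)" if "0 \<le> a" "a \<le> b" for a b
  proof -
    have S: "open {-1<..<amp + 1}" by simp
    have in_S: "V x \<in> {-1<..<amp + 1}" if "x \<in> {a..b}" for x
      using le[of x] admD(2)[OF V, of x] that \<open>0 \<le> a\<close> by fastforce
    have fd: "(len has_derivative (\<bullet>) (slope y)) (at y)" if "y \<in> {-1<..<amp + 1}" for y
    proof -
      have "(\<bullet>) (slope y) = (*) (slope y)" by (auto simp: fun_eq_iff)
      then show ?thesis using len_deriv[of y] that by (simp add: has_field_derivative_def)
    qed
    show "len (V b) - len (V a) = (LINT x:{a<..b}|half_line. slope (V x) * v x)"
      using L2_primitive_chain_rule(2)[OF P that S in_S fd slope_continuous] by simp
    show "set_integrable half_line {a<..b} (\<lambda>x. slope (V x) * v x)"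
      using L2_primitive_chain_rule(1)[OF P that S in_S fd slope_continuous] by simp
  qed
  have iDs: "set_integrable half_line {a<..b} D" if "0 \<le> a" for a b
    by (rule set_integrable_from_integrable[OF iD Ioc_in_half_line[OF that]])
  have path: "\<bar>len (V b) - len (V a)\<bar> \<le> (LINT x:{a<..b}|half_line. D x)" if "0 \<le> a" "a \<le> b" for a b
  proof -
    have pt: "\<bar>slope (V x) * v x\<bar> \<le> D x" for x
      using sum_squares_bound[of "\<bar>slope (V x)\<bar>" "\<bar>v x\<bar>"] by (simp add: D_def abs_mult)
    have "\<bar>len (V b) - len (V a)\<bar> \<le> (LINT x:{a<..b}|half_line. norm (slope (V x) * v x))"
      using set_integral_norm_le[of half_line "{a<..b}" "\<lambda>x. slope (V x) * v x"]
      unfolding chain(1)[OF that] by (simp only: real_norm_def)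
    also have "\<dots> \<le> (LINT x:{a<..b}|half_line. D x)"
      by (rule set_integral_mono) (use chain(2)[OF that] iDs that pt in \<open>auto intro: set_integrable_abs\<close>)
    finally show ?thesis .
  qed
  \<comment> \<open>The error is spent in three equal parts: \<open>len amp\<close> is missed by
    \<open>e / 3\<close> at the top, which counts for ascent and descent, and another
    \<open>e / 3\<close> is lost at the return.\<close>
  have "\<forall>\<^sub>F y in nhds amp. dist (len y) (len amp) < e / 3"
    using len_isCont[of amp] amp_pos e by (intro tendstoD) (auto simp: isCont_def tendsto_at_iff_tendsto_nhds)
  then obtain d1 where d1: "d1 > 0" "\<And>y. dist y amp < d1 \<Longrightarrow> dist (len y) (len amp) < e / 3"
    unfolding eventually_nhds_metric by auto
  have "\<forall>\<^sub>F y in nhds 0. dist (len y) (len 0) < e / 3"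
    using len_isCont[of 0] e by (intro tendstoD) (auto simp: isCont_def tendsto_at_iff_tendsto_nhds)
  then obtain d2 where d2: "d2 > 0" "\<And>y. dist y 0 < d2 \<Longrightarrow> dist (len y) (len 0) < e / 3"
    unfolding eventually_nhds_metric by auto
  obtain a where a: "0 \<le> a" "amp - d1 < V a" using sup[OF d1(1)] by auto
  have la: "len amp - e / 3 < len (V a)"
  proof -
    have "dist (V a) amp < d1" using a le[OF a(1)] by (simp add: dist_real_def)
    then show ?thesis using d1(2)[of "V a"] unfolding dist_real_def by linarith
  qed
  obtain b where b: "a \<le> b" "\<bar>V b\<bar> < d2" using H1_small_values[OF H a(1) d2(1)] by auto
  have lb: "len (V b) < e / 3" using d2(2)[of "V b"] b by (auto simp: dist_real_def len_0)
  have "len (V a) - len (V 0) \<le> (LINT x:{0<..a}|half_line. D x)" using path[of 0 a] a by simp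
  moreover have "len (V a) - len (V b) \<le> (LINT x:{a<..b}|half_line. D x)" using path[of a b] a b by simp
  moreover have "(LINT x:{0<..b}|half_line. D x) = (LINT x:{0<..a}|half_line. D x) + (LINT x:{a<..b}|half_line. D x)"
    using set_integral_Ioc_split[of 0 0 a b b D] iDs[of 0 b] a b by simp
  moreover have "(LINT x:{0<..b}|half_line. D x) \<le> (LINT x|half_line. D x)"
    by (rule set_integral_mono_half_line[OF iD D0]) (simp add: Ioc_in_half_line)
  moreover have "len (V 0) = 0" using L2_primitive_0[OF P] len_0 by simp
  ultimately have "2 * len (V a) - len (V b) \<le> (LINT x|half_line. D x)" by linarith
  then show "2 * len amp \<le> (1 / 2) * ((LINT x|half_line. (v x)\<^sup>2) + \<omega> * (LINT x|half_line. (V x)\<^sup>2))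
    - mass V / (p + 1) + e"
    using la lb ID by linarith
qed

text \<open>With \<open>F = 1 / 2 - 1 / (p + 1)\<close>, a level \<open>s\<close> of the constrained
  problem corresponds to the action \<open>F * s powr (1 / (1 - \<theta>))\<close>;
  \<open>q_line\<close> is the level whose action is the path length
  \<open>2 * len amp\<close>.\<close>

definition q_line :: real where
  "q_line = (2 * len amp / (1 / 2 - 1 / (p + 1))) powr (1 - \<theta>)"

lemma gap_factor: "0 < 1 / 2 - 1 / (p + 1)" "1 / 2 - 1 / (p + 1) = (p - 1) / (2 * (p + 1))"
  using p by (auto simp: field_simps)

text \<open>Scale \<open>W\<close> so that its supremum is exactly \<open>amp\<close>, as the path
  bound requires; then estimate the action of the scaled function by the maximum of the action along
  its ray.\<close>

lemma q_line_lower: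
  assumes W: "adm W h"
  shows "q_line * mass W powr \<theta> \<le> (LINT x|half_line. (h x)\<^sup>2) + \<omega> * (LINT x|half_line. (W x)\<^sup>2)"
proof -
  define a m where "a = (LINT x|half_line. (h x)\<^sup>2) + \<omega> * (LINT x|half_line. (W x)\<^sup>2)" and "m = mass W"
  note H = admD(1)[OF W]
  have a0: "0 \<le> a" using w by (auto simp: a_def intro!: add_nonneg_nonneg mult_nonneg_nonneg Bochner_Integration.integral_nonneg)
  show ?thesis
  proof (cases "m = 0")
    case True
    then show ?thesis using a0 by (simp add: a_def m_def)
  next
    case False
    then have m: "0 < m" using mass_nonneg[of W] by (simp add: m_def)
    define \<sigma> where "\<sigma> = (SUP x\<in>{0..}. W x)"
    have bdd: "bdd_above (W ` {0..})"
      using H1_primitive_bound[OF H] by (intro bdd_aboveI2) (auto dest: abs_le_D1)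
    have W\<sigma>: "W x \<le> \<sigma>" if "0 \<le> x" for x
      unfolding \<sigma>_def by (rule cSUP_upper[OF _ bdd]) (use that in auto)
    have \<sigma>: "0 < \<sigma>"
    proof (rule ccontr)
      assume "\<not> 0 < \<sigma>"
      then have "W x = 0" if "0 \<le> x" for x using W\<sigma>[OF that] admD(2)[OF W that] by linarith
      then have "mass W = (LINT x|half_line. 0)"
        unfolding mass_def by (intro Bochner_Integration.integral_cong) (auto simp: space_half_line)
      then show False using m by (simp add: m_def)
    qed
    define t where "t = amp / \<sigma>"
    have t: "0 < t" using amp_pos \<sigma> by (simp add: t_def)
    have "2 * len amp \<le> (1 / 2) * ((LINT x|half_line. (t * h x)\<^sup>2) + \<omega> * (LINT x|half_line. (t * W x)\<^sup>2))
      - mass (\<lambda>x. t * W x) / (p + 1)"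
    proof (rule action_lower_bound)
      show "adm (\<lambda>x. t * W x) (\<lambda>x. t * h x)" by (rule adm_scale[OF W]) (use t in simp)
      show "t * W x \<le> amp" if "0 \<le> x" for x
      proof -
        have "t * W x \<le> t * \<sigma>" using W\<sigma>[OF that] t by simp
        then show ?thesis using \<sigma> by (simp add: t_def)
      qed
      fix e :: real assume e: "0 < e"
      have "\<sigma> - e / t < (SUP x\<in>{0..}. W x)" using e t by (simp flip: \<sigma>_def)
      then obtain x where x: "x \<in> {0..}" "\<sigma> - e / t < W x"
        using less_cSUP_iff[OF _ bdd] by auto
      have "t * (\<sigma> - e / t) < t * W x" using x t by simp
      moreover have "t * (\<sigma> - e / t) = amp - e" using t \<sigma> by (simp add: t_def field_simps)
      ultimately show "\<exists>x\<ge>0. amp - e < t * W x" using x by auto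
    qed
    also have "\<dots> = (1 / 2) * (t\<^sup>2 * a) - t powr (p + 1) * m / (p + 1)"
      using mass_scale[OF W, of t] t by (simp add: a_def m_def power_mult_distrib algebra_simps)
    finally have M: "2 * len amp \<le> (1 / 2) * (t\<^sup>2 * a) - t powr (p + 1) * m / (p + 1)" .
    \<comment> \<open>Young's inequality computes that maximum. With \<open>r = 1 / \<theta>\<close>
      the power of \<open>X\<close> reproduces the mass term and cancels it, and the conjugate
      exponent is \<open>r' = 1 / (1 - \<theta>)\<close>.\<close>
    define X Y where "X = t\<^sup>2 * m powr \<theta>" and "Y = a / m powr \<theta>"
    define r r' where "r = (p + 1) / 2" and "r' = (p + 1) / (p - 1)"
    have "X * Y \<le> X powr r / r + Y powr r' / r'"
    proof (rule Youngs_inequality)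
      show "1 < r" "1 < r'" using p by (auto simp: r_def r'_def)
      have "2 / (p + 1) + (p - 1) / (p + 1) = (2 + (p - 1)) / (p + 1)" by (rule add_divide_distrib[symmetric])
      then show "1 / r + 1 / r' = 1" using p by (simp add: r_def r'_def)
      show "0 \<le> X" "0 \<le> Y" using a0 by (auto simp: X_def Y_def)
    qed
    moreover have "X * Y = t\<^sup>2 * a" using m by (simp add: X_def Y_def)
    moreover have "X powr r = t powr (p + 1) * m"
    proof -
      have "X powr r = (t powr 2) powr r * (m powr \<theta>) powr r" using t by (simp add: X_def powr_mult)
      also have "\<dots> = t powr (2 * r) * m powr (\<theta> * r)" by (simp add: powr_powr)
      also have "2 * r = p + 1" by (simp add: r_def)
      also have "\<theta> * r = 1" using p by (simp add: r_def \<theta>_def)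
      finally show ?thesis using m by simp
    qed
    ultimately have "t\<^sup>2 * a \<le> t powr (p + 1) * m / r + Y powr r' / r'" by simp
    then have "2 * len amp \<le> (1 / 2) * (t powr (p + 1) * m / r + Y powr r' / r') - t powr (p + 1) * m / (p + 1)"
      by (intro order_trans[OF M] diff_right_mono mult_left_mono) auto
    also have "\<dots> = (1 / 2 - 1 / (p + 1)) * Y powr r'"
    proof -
      have 1: "T / r = 2 * (T / (p + 1))" for T by (simp add: r_def)
      have 2: "Z / r' = 2 * ((p - 1) / (2 * (p + 1)) * Z)" for Z using p by (simp add: r'_def divide_simps)
      have "(1 / 2) * (2 * x + 2 * y) - x = y" for x y :: real by (simp add: field_simps)
      then show ?thesis unfolding 1 2 gap_factor(2) by (simp only:)
    qed
    finally have "2 * len amp / (1 / 2 - 1 / (p + 1)) \<le> Y powr r'"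
      using gap_factor(1) by (simp only: pos_divide_le_eq mult.commute)
    then have "q_line \<le> (Y powr r') powr (1 - \<theta>)"
      unfolding q_line_def using len_amp_pos gap_factor(1) \<theta> by (intro powr_mono2) auto
    also have "\<dots> = Y"
    proof -
      have "1 - \<theta> = (p - 1) / (p + 1)" using p by (simp add: \<theta>_def field_simps)
      then have "r' * (1 - \<theta>) = 1" using p by (simp add: r'_def)
      moreover have "0 \<le> Y" using a0 by (simp add: Y_def)
      ultimately show ?thesis by (simp add: powr_powr)
    qed
    finally show ?thesis using m by (simp add: Y_def a_def m_def field_simps)
  qed
qed

end

section \<open>The soliton as a test function\<close>

text \<open>Mean value theorem, the derivative being largest at the right end \<open>s\<close>. The
  case \<open>s = e\<close> is separate because powers are differentiated at positive arguments
  only.\<close>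

lemma diff_powr_bound:
  fixes e s r :: real
  assumes "0 \<le> e" "e \<le> s" "1 < r"
  shows "s powr r - r * s powr (r - 1) * e \<le> (s - e) powr r"
proof (cases "e = 0 \<or> s = e")
  case True
  then show ?thesis
  proof
    assume "s = e"
    then have "s powr r = s powr (r - 1) * s" using assms powr_add[of s "r - 1" 1] by (cases "s = 0") auto
    moreover have "s powr (r - 1) * s \<le> r * (s powr (r - 1) * s)"
      using assms \<open>s = e\<close> mult_right_mono[of 1 r "s powr (r - 1) * s"] by simp
    ultimately show ?thesis using \<open>s = e\<close> by (simp add: mult.assoc)
  qed auto
next
  case False
  then have e: "0 < e" "e < s" using assms by auto
  have "\<exists>z>s - e. z < s \<and> s powr r - (s - e) powr r = (s - (s - e)) * (r * z powr (r - 1))"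
  proof (rule MVT2)
    show "s - e < s" using e by simp
    fix x assume "s - e \<le> x" "x \<le> s"
    then show "((\<lambda>x. x powr r) has_real_derivative r * x powr (r - 1)) (at x)"
      using e by (intro has_real_derivative_powr) auto
  qed
  then obtain z where z: "s - e < z" "z < s" "s powr r - (s - e) powr r = e * (r * z powr (r - 1))" by auto
  have "z powr (r - 1) \<le> s powr (r - 1)" using z e assms by (intro powr_mono2) auto
  then have "e * (r * z powr (r - 1)) \<le> e * (r * s powr (r - 1))" using e assms by (intro mult_left_mono) auto
  then show ?thesis using z(3) by (simp add: mult_ac)
qed

context nls_params
begin

definition rate :: real where "rate = sqrt \<omega> * (p - 1) / 2"

text \<open>This is \<open>amp * sech (rate * y) powr (2 / (p - 1))\<close>, the solution of \<open>\<phi>'' = \<omega> \<phi> - \<phi> powr p\<close>.\<close>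

definition soliton :: "real \<Rightarrow> real" where
  "soliton y = amp * exp (- (2 / (p - 1)) * ln (cosh (rate * y)))"

lemma rate_pos: "0 < rate" using w p by (simp add: rate_def)

lemma soliton_pos: "0 < soliton y" using amp_pos by (simp add: soliton_def)

lemma soliton_even: "soliton (- y) = soliton y" by (simp add: soliton_def)

lemma soliton_antimono:
  assumes "\<bar>y\<bar> \<le> z" shows "soliton z \<le> soliton y"
proof -
  have "cosh (rate * y) = cosh \<bar>rate * y\<bar>" by simp
  also have "\<dots> \<le> cosh (rate * z)"
    using assms rate_pos by (subst cosh_real_nonneg_le_iff) (auto simp: abs_mult)
  finally have "ln (cosh (rate * y)) \<le> ln (cosh (rate * z))" by simp
  then have "2 / (p - 1) * ln (cosh (rate * y)) \<le> 2 / (p - 1) * ln (cosh (rate * z))"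
    using p by (intro mult_left_mono) auto
  then show ?thesis using amp_pos by (simp add: soliton_def)
qed

lemma soliton_strict:
  assumes "0 \<le> y" "y < z" shows "soliton z < soliton y"
proof -
  have "cosh (rate * y) < cosh (rate * z)"
    using assms rate_pos by (subst cosh_real_nonneg_less_iff) auto
  then have "ln (cosh (rate * y)) < ln (cosh (rate * z))" by simp
  then have "2 / (p - 1) * ln (cosh (rate * y)) < 2 / (p - 1) * ln (cosh (rate * z))"
    using p by (intro mult_strict_left_mono) auto
  then show ?thesis using amp_pos by (simp add: soliton_def)
qed

lemma soliton_0: "soliton 0 = amp" by (simp add: soliton_def)

lemma soliton_le_amp: "soliton y \<le> amp"
  using soliton_antimono[of 0 "\<bar>y\<bar>"] soliton_even[of y] by (cases "0 \<le> y") (auto simp: soliton_0)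

definition soliton' :: "real \<Rightarrow> real" where
  "soliton' y = - sqrt \<omega> * tanh (rate * y) * soliton y"

lemma soliton_deriv: "(soliton has_real_derivative soliton' y) (at y)"
  unfolding soliton_def[abs_def] soliton'_def
  by (rule derivative_eq_intros refl | simp)+
    (use p in \<open>simp add: soliton_def rate_def tanh_def field_simps\<close>)

lemma soliton_powr: "soliton y powr (p - 1) = \<omega> / \<kappa> * (1 - (tanh (rate * y))\<^sup>2)"
proof -
  have "soliton y powr (p - 1) = amp powr (p - 1) * exp (- 2 * ln (cosh (rate * y)))"
    using amp_pos p by (simp add: soliton_def powr_mult exp_powr_real)
  also have "exp (- 2 * ln (cosh (rate * y))) = 1 / (cosh (rate * y))\<^sup>2"
  proof -
    have "2 * ln (cosh (rate * y)) = ln ((cosh (rate * y))\<^sup>2)" by (simp add: ln_realpow)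
    then have "exp (2 * ln (cosh (rate * y))) = (cosh (rate * y))\<^sup>2" by simp
    then show ?thesis by (simp add: exp_minus field_simps)
  qed
  also have "\<dots> = 1 - (tanh (rate * y))\<^sup>2"
  proof -
    have "(cosh (rate * y))\<^sup>2 \<noteq> 0" using cosh_real_pos[of "rate * y"] by simp
    moreover have "(tanh (rate * y))\<^sup>2 = ((cosh (rate * y))\<^sup>2 - 1) / (cosh (rate * y))\<^sup>2"
      using cosh_square_eq[of "rate * y"] by (simp add: tanh_def power_divide)
    ultimately show ?thesis by (simp add: diff_divide_distrib)
  qed
  finally show ?thesis by (simp add: amp_powr)
qed

lemma soliton_powr_p1: "soliton y powr (p + 1) = \<omega> / \<kappa> * (1 - (tanh (rate * y))\<^sup>2) * (soliton y)\<^sup>2"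
proof -
  have "soliton y powr (p + 1) = soliton y powr (p - 1) * (soliton y)\<^sup>2"
    using powr_add[of "soliton y" "p - 1" 2] soliton_pos[of y] by (simp add: add.commute)
  then show ?thesis by (simp add: soliton_powr)
qed

lemma soliton'_sq: "(soliton' y)\<^sup>2 = \<omega> * (soliton y)\<^sup>2 - \<kappa> * soliton y powr (p + 1)"
  unfolding soliton_powr_p1 soliton'_def using \<kappa> w by (simp add: power_mult_distrib algebra_simps)

lemma soliton'_deriv:
  "(soliton' has_real_derivative (\<omega> * soliton y - soliton y powr p)) (at y)"
proof -
  let ?T = "tanh (rate * y)"
  have c: "cosh (rate * y) \<noteq> 0" using cosh_real_pos[of "rate * y"] by simp
  have "(soliton' has_real_derivative - sqrt \<omega> * ((1 - ?T\<^sup>2) * rate * soliton y + ?T * soliton' y)) (at y)"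
    unfolding soliton'_def[abs_def]
    by (rule derivative_eq_intros soliton_deriv refl c | simp)+ (simp add: soliton'_def algebra_simps)
  moreover have "- sqrt \<omega> * ((1 - ?T\<^sup>2) * rate * soliton y + ?T * soliton' y) = \<omega> * soliton y - soliton y powr p"
  proof -
    have "soliton y powr p = soliton y powr (p - 1) * soliton y"
      using powr_add[of "soliton y" "p - 1" 1] soliton_pos[of y] by simp
    then have P: "soliton y powr p = (\<omega> * (p + 1) / 2) * (1 - ?T\<^sup>2) * soliton y"
      using p by (simp add: soliton_powr \<kappa>_def field_simps)
    have ww: "sqrt \<omega> * sqrt \<omega> = \<omega>" using w by simp
    have "- sqrt \<omega> * ((1 - ?T\<^sup>2) * rate * soliton y + ?T * soliton' y)
      = - (sqrt \<omega> * sqrt \<omega>) * ((p - 1) / 2) * (1 - ?T\<^sup>2) * soliton y + (sqrt \<omega> * sqrt \<omega>) * ?T\<^sup>2 * soliton y"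
    proof -
      have "- s * ((1 - T\<^sup>2) * r * S + T * (- s * T * S))
        = - (s * s) * ((p - 1) / 2) * (1 - T\<^sup>2) * S + (s * s) * T\<^sup>2 * S"
        if "r = s * (p - 1) / 2" for r s T S
        unfolding that by (simp add: power2_eq_square field_simps)
      from this[OF rate_def] show ?thesis unfolding soliton'_def .
    qed
    then show ?thesis unfolding ww P by (simp add: field_simps)
  qed
  ultimately show ?thesis by simp
qed

text \<open>First order form of the equation. It turns the inequality between the arithmetic and
  geometric mean in the path bound into an equality, so the soliton runs along the optimal
  path.\<close>

lemma soliton'_slope:
  assumes "0 \<le> y" shows "soliton' y = - slope (soliton y)" "soliton' (- y) = slope (soliton (- y))"
proof -
  have T: "0 \<le> tanh (rate * y)" using assms rate_pos by simp
  have "\<omega> - \<kappa> * soliton y powr (p - 1) = \<omega> * (tanh (rate * y))\<^sup>2"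
    using \<kappa> by (simp add: soliton_powr algebra_simps)
  then have "slope (soliton y) = soliton y * (sqrt \<omega> * tanh (rate * y))"
    using soliton_pos[of y] T w by (simp add: slope_def real_sqrt_mult)
  then show "soliton' y = - slope (soliton y)" "soliton' (- y) = slope (soliton (- y))"
    by (simp_all add: soliton'_def soliton_even)
qed

lemma soliton_cont: "continuous_on S soliton" "continuous_on S soliton'"
  by (rule DERIV_continuous_on, rule has_field_derivative_at_within, rule soliton_deriv)
    (rule DERIV_continuous_on, rule has_field_derivative_at_within, rule soliton'_deriv)

lemma soliton_decay: "soliton y \<le> amp * 2 powr (2 / (p - 1)) * exp (- sqrt \<omega> * y)"
proof -
  have "exp (rate * y) / 2 \<le> cosh (rate * y)" by (simp add: cosh_def)
  then have "ln (exp (rate * y) / 2) \<le> ln (cosh (rate * y))" by (intro ln_mono) auto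
  then have "rate * y - ln 2 \<le> ln (cosh (rate * y))" by (simp add: ln_div)
  then have "2 / (p - 1) * (rate * y - ln 2) \<le> 2 / (p - 1) * ln (cosh (rate * y))"
    using p by (intro mult_left_mono) auto
  moreover have "2 / (p - 1) * (rate * y - ln 2) = sqrt \<omega> * y - 2 / (p - 1) * ln 2"
    using p by (simp add: rate_def field_simps)
  ultimately have "- (2 / (p - 1)) * ln (cosh (rate * y)) \<le> 2 / (p - 1) * ln 2 + - sqrt \<omega> * y" by linarith
  then have "soliton y \<le> amp * exp (2 / (p - 1) * ln 2 + - sqrt \<omega> * y)"
    unfolding soliton_def using amp_pos by simp
  also have "\<dots> = amp * 2 powr (2 / (p - 1)) * exp (- sqrt \<omega> * y)"
    by (simp only: exp_add powr_def) simp
  finally show ?thesis .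
qed

text \<open>Between \<open>R - 1\<close> and \<open>R + 1\<close> the trial function is at least
  \<open>soliton 1 - soliton 2\<close> once \<open>R \<ge> 2\<close>, and there
  \<open>x \<le> 2 * R\<close>. Over this interval of length \<open>2\<close> the potential
  contributes at least \<open>2 * c * (soliton 1 - soliton 2)\<^sup>2 / (4 * R\<^sup>2)\<close>,
  which is \<open>gain / R\<^sup>2\<close>.\<close>

definition gain :: real where "gain = c * (soliton 1 - soliton 2)\<^sup>2 / 2"

lemma gain_pos: "0 < gain"
  using soliton_strict[of 1 2] c by (simp add: gain_def)

section \<open>The soliton centred at \<open>R\<close>, cut down to the half-line\<close>

context
  fixes R :: real
  assumes R: "2 \<le> R"
begin

text \<open>The soliton is lowered so that it vanishes at \<open>0\<close> and at
  \<open>2 * R\<close>, and is stopped there. Subtracting a constant leaves the derivative on the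
  window intact, so only the zero order terms have to be compared.\<close>

definition bump :: "real \<Rightarrow> real" where
  "bump x = soliton (min x (2 * R) - R) - soliton R"

definition bump' :: "real \<Rightarrow> real" where
  "bump' x = indicat_real {0<..2 * R} x * soliton' (x - R)"

abbreviation (input) ival :: "(real \<Rightarrow> real) \<Rightarrow> real" where
  "ival f \<equiv> (LINT x:{0<..2 * R}|half_line. f (x - R))"

lemma ival_integrable:
  fixes f :: "real \<Rightarrow> real"
  assumes "continuous_on UNIV f" shows "set_integrable half_line {0<..2 * R} (\<lambda>x. f (x - R))"
proof (rule continuous_set_integrable_Ioc)
  show "continuous_on {0..2 * R} (\<lambda>x. f (x - R))"
    by (rule continuous_on_compose2[OF assms]) (auto intro!: continuous_intros)
qed simp

lemma shifted_FTC:
  assumes "continuous_on UNIV f'" "\<And>y. (f has_real_derivative f' y) (at y)" "0 \<le> a" "a \<le> b"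
  shows "(LINT x:{a<..b}|half_line. f' (x - R)) = f (b - R) - f (a - R)"
proof (rule FTC_half_line[OF assms(3,4), symmetric])
  show "continuous_on {a..b} (\<lambda>x. f' (x - R))"
    by (intro continuous_on_compose2[OF assms(1)]) (auto intro!: continuous_intros)
  fix x
  have "((\<lambda>x. f (x - R)) has_real_derivative f' (x - R)) (at x)"
    using DERIV_shift[of f "f' (x - R)" x "- R"] assms(2)[of "x - R"] by simp
  then show "((\<lambda>x. f (x - R)) has_vector_derivative f' (x - R)) (at x within {a..b})"
    by (simp add: has_real_derivative_iff_has_vector_derivative has_vector_derivative_at_within)
qed

lemma bump_eq: "0 < x \<Longrightarrow> x \<le> 2 * R \<Longrightarrow> bump x = soliton (x - R) - soliton R"
  "2 * R \<le> x \<Longrightarrow> bump x = 0"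
  by (auto simp: bump_def)

lemma bump_bounds:
  assumes "0 \<le> x" shows "0 \<le> bump x"
  unfolding bump_def using soliton_antimono[of "min x (2 * R) - R" R] assms R by (auto simp: min_def abs_le_iff)

lemma bump_sq_eq: "0 < x \<Longrightarrow> (bump x)\<^sup>2 = indicat_real {0<..2 * R} x *\<^sub>R (soliton (x - R) - soliton R)\<^sup>2"
  using bump_eq[of x] by (auto simp: indicator_def)

lemma bump_primitive: "L2_primitive bump bump'"
  unfolding L2_primitive_def
proof (intro conjI allI impI)
  have "set_integrable half_line {0<..2 * R} (\<lambda>x. soliton' (x - R))"
    by (rule ival_integrable[OF soliton_cont(2)])
  then show "bump' \<in> borel_measurable half_line"
    unfolding set_integrable_def bump'_def[abs_def] using borel_measurable_integrable by fastforce
  have c: "continuous_on UNIV (\<lambda>y. (soliton' y)\<^sup>2)" by (intro continuous_intros soliton_cont)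
  have "(norm (bump' x))\<^sup>2 = indicat_real {0<..2 * R} x *\<^sub>R (soliton' (x - R))\<^sup>2" for x
    by (simp add: bump'_def indicator_def)
  then show "integrable half_line (\<lambda>x. (norm (bump' x))\<^sup>2)"
    using ival_integrable[OF c] by (simp only: set_integrable_def)
  fix x :: real assume x: "0 \<le> x"
  have "indicat_real {0<..x} t *\<^sub>R bump' t = indicat_real {0<..min x (2 * R)} t *\<^sub>R soliton' (t - R)" for t
    by (simp add: bump'_def indicator_def)
  then have "(LINT t:{0<..x}|half_line. bump' t) = (LINT t:{0<..min x (2 * R)}|half_line. soliton' (t - R))"
    by (simp only: set_lebesgue_integral_def)
  also have "\<dots> = soliton (min x (2 * R) - R) - soliton (0 - R)"
    by (rule shifted_FTC[OF soliton_cont(2) soliton_deriv]) (use x R in auto)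
  finally show "bump x = (LINT t:{0<..x}|half_line. bump' t)" by (simp add: bump_def soliton_even)
qed

lemma cont_sq: "continuous_on UNIV (\<lambda>y. (soliton y - soliton R)\<^sup>2)"
  by (intro continuous_intros soliton_cont)

lemma bump_sq: "integrable half_line (\<lambda>x. (bump x)\<^sup>2)"
  "(LINT x|half_line. (bump x)\<^sup>2) = ival (\<lambda>y. (soliton y - soliton R)\<^sup>2)"
proof -
  have "integrable half_line (\<lambda>x. (bump x)\<^sup>2) \<longleftrightarrow>
      integrable half_line (\<lambda>x. indicat_real {0<..2 * R} x *\<^sub>R (soliton (x - R) - soliton R)\<^sup>2)"
    by (rule Bochner_Integration.integrable_cong[OF refl]) (rule bump_sq_eq, simp add: space_half_line)
  then show "integrable half_line (\<lambda>x. (bump x)\<^sup>2)"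
    using ival_integrable[OF cont_sq] by (simp only: set_integrable_def)
  show "(LINT x|half_line. (bump x)\<^sup>2) = ival (\<lambda>y. (soliton y - soliton R)\<^sup>2)"
    unfolding set_lebesgue_integral_def
    by (rule Bochner_Integration.integral_cong[OF refl]) (rule bump_sq_eq, simp add: space_half_line)
qed

lemma bump_adm: "adm bump bump'"
  unfolding adm_def H1_primitive_def using bump_primitive bump_sq bump_bounds by auto

lemma bump_H1: "H1_primitive bump bump'"
  by (rule admD(1)[OF bump_adm])

lemma cont_sol:
  "continuous_on UNIV (\<lambda>y. (soliton' y)\<^sup>2)" "continuous_on UNIV (\<lambda>y. (soliton y)\<^sup>2)"
  "continuous_on UNIV (\<lambda>y. soliton y powr r)"
  using soliton_pos by (auto intro!: continuous_on_power continuous_on_powr soliton_cont simp: less_imp_neq[symmetric])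

text \<open>Energy without potential, and mass, of the soliton on the window from \<open>-R\<close>
  to \<open>R\<close>. On the whole line the two would coincide.\<close>

definition a_sol :: real where "a_sol = ival (\<lambda>y. (soliton' y)\<^sup>2) + \<omega> * ival (\<lambda>y. (soliton y)\<^sup>2)"
definition d_sol :: real where "d_sol = ival (\<lambda>y. soliton y powr (p + 1))"

lemma ival_add: "continuous_on UNIV f \<Longrightarrow> continuous_on UNIV g \<Longrightarrow> ival (\<lambda>y. f y + g y) = ival f + ival g"
  by (rule set_integral_add(2)[OF ival_integrable ival_integrable])

lemma ival_lin: "continuous_on UNIV f \<Longrightarrow> continuous_on UNIV g \<Longrightarrow> ival (\<lambda>y. r * f y - s * g y) = r * ival f - s * ival g"
  by (subst set_integral_diff(2)[OF set_integrable_mult_right[OF ival_integrable] set_integrable_mult_right[OF ival_integrable]])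
    simp_all

text \<open>Multiplying the soliton equation by the soliton gives the derivative of
  \<open>soliton * soliton'\<close>; on a finite window only its boundary values remain.\<close>

lemma a_minus_d: "a_sol - d_sol = 2 * soliton R * soliton' R"
proof -
  have D: "((\<lambda>y. soliton y * soliton' y) has_real_derivative
      ((soliton' y)\<^sup>2 + (\<omega> * (soliton y)\<^sup>2 - 1 * soliton y powr (p + 1)))) (at y)" for y
  proof -
    have "soliton y powr (p + 1) = soliton y powr p * soliton y"
      using powr_add[of "soliton y" p 1] soliton_pos[of y] by simp
    then show ?thesis
      by (auto intro!: derivative_eq_intros soliton_deriv soliton'_deriv simp: power2_eq_square algebra_simps)
  qed
  have "ival (\<lambda>y. (soliton' y)\<^sup>2 + (\<omega> * (soliton y)\<^sup>2 - 1 * soliton y powr (p + 1)))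
     = soliton (2 * R - R) * soliton' (2 * R - R) - soliton (0 - R) * soliton' (0 - R)"
    by (rule shifted_FTC[OF _ D]) (use R in \<open>auto intro!: continuous_on_add continuous_on_diff continuous_on_mult continuous_on_const cont_sol\<close>)
  also have "\<dots> = 2 * soliton R * soliton' R" by (simp add: soliton_even soliton'_def)
  finally have *: "ival (\<lambda>y. (soliton' y)\<^sup>2 + (\<omega> * (soliton y)\<^sup>2 - 1 * soliton y powr (p + 1))) = 2 * soliton R * soliton' R" .
  have "continuous_on UNIV (\<lambda>y. \<omega> * (soliton y)\<^sup>2 - 1 * soliton y powr (p + 1))"
    by (intro continuous_on_diff continuous_on_mult continuous_on_const cont_sol)
  from ival_add[OF cont_sol(1) this]
  show ?thesis
    unfolding * ival_lin[OF cont_sol(2,3)] a_sol_def d_sol_def by simp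
qed

lemma soliton'_R: "soliton' R \<le> 0" "- soliton' R \<le> sqrt \<omega> * soliton R"
proof -
  have "0 \<le> tanh (rate * R)" "tanh (rate * R) \<le> 1"
    using rate_pos R tanh_real_lt_1[of "rate * R"] by (auto simp: less_imp_le)
  then have "0 \<le> tanh (rate * R) * (sqrt \<omega> * soliton R)" "tanh (rate * R) * (sqrt \<omega> * soliton R) \<le> 1 * (sqrt \<omega> * soliton R)"
    using soliton_pos[of R] w by (auto intro!: mult_nonneg_nonneg mult_right_mono simp: less_imp_le)
  then show "soliton' R \<le> 0" "- soliton' R \<le> sqrt \<omega> * soliton R" by (simp_all add: soliton'_def mult_ac)
qed

lemma a_le_d: "a_sol \<le> d_sol" "d_sol - a_sol \<le> 2 * sqrt \<omega> * amp * soliton R"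
proof -
  have e: "0 < soliton R" "soliton R \<le> amp" using soliton_pos soliton_le_amp by auto
  have "soliton R * soliton' R \<le> 0" using e soliton'_R by (simp add: mult_nonneg_nonpos)
  then show "a_sol \<le> d_sol" using a_minus_d by linarith
  have "soliton R * (- soliton' R) \<le> soliton R * (sqrt \<omega> * soliton R)" using e soliton'_R by (intro mult_left_mono) auto
  also have "\<dots> \<le> amp * (sqrt \<omega> * soliton R)" using e w by (intro mult_right_mono) auto
  finally show "d_sol - a_sol \<le> 2 * sqrt \<omega> * amp * soliton R" using a_minus_d by (simp add: algebra_simps)
qed

text \<open>On either side of the centre \<open>(soliton' y)\<^sup>2\<close> is, up to sign, the
  derivative of \<open>len (soliton y)\<close>, so each half contributes
  \<open>len amp - len (soliton R)\<close>.\<close>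

lemma kinetic: "ival (\<lambda>y. (soliton' y)\<^sup>2) \<le> 2 * len amp"
proof -
  have D: "((\<lambda>y. len (soliton y)) has_real_derivative slope (soliton y) * soliton' y) (at y)" for y
    by (rule DERIV_chain2[OF len_deriv soliton_deriv]) (use soliton_pos[of y] in linarith)
  have c: "continuous_on UNIV (\<lambda>y. slope (soliton y) * soliton' y)"
    by (intro continuous_intros soliton_cont continuous_on_compose2[OF slope_continuous]) auto
  have R0: "0 \<le> R" "R \<le> 2 * R" using R by auto
  have l0: "0 \<le> len (soliton R)" using len_mono[of 0 "soliton R"] soliton_pos[of R] by (simp add: len_0 less_imp_le)
  have "(LINT x:{0<..R}|half_line. (soliton' (x - R))\<^sup>2) = (LINT x:{0<..R}|half_line. slope (soliton (x - R)) * soliton' (x - R))"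
  proof (rule set_lebesgue_integral_cong)
    show "{0<..R} \<in> sets half_line" by (rule Ioc_in_half_line) simp
    show "\<forall>x. x \<in> {0<..R} \<longrightarrow> (soliton' (x - R))\<^sup>2 = slope (soliton (x - R)) * soliton' (x - R)"
      using soliton'_slope(2)[of "R - x" for x] by (auto simp: power2_eq_square)
  qed
  also have "\<dots> = len (soliton (R - R)) - len (soliton (0 - R))" by (rule shifted_FTC[OF c D]) (use R0 in auto)
  finally have 1: "(LINT x:{0<..R}|half_line. (soliton' (x - R))\<^sup>2) \<le> len amp"
    using l0 by (simp add: soliton_0 soliton_even)
  have "(LINT x:{R<..2 * R}|half_line. (soliton' (x - R))\<^sup>2) = (LINT x:{R<..2 * R}|half_line. - (slope (soliton (x - R)) * soliton' (x - R)))"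
  proof (rule set_lebesgue_integral_cong)
    show "{R<..2 * R} \<in> sets half_line" by (rule Ioc_in_half_line) (use R in simp)
    show "\<forall>x. x \<in> {R<..2 * R} \<longrightarrow> (soliton' (x - R))\<^sup>2 = - (slope (soliton (x - R)) * soliton' (x - R))"
      using soliton'_slope(1)[of "x - R" for x] by (auto simp: power2_eq_square)
  qed
  also have "\<dots> = - len (soliton (2 * R - R)) - - len (soliton (R - R))"
    by (rule shifted_FTC[where f = "\<lambda>y. - len (soliton y)" and f' = "\<lambda>y. - (slope (soliton y) * soliton' y)"])
      (use R0 in \<open>auto intro!: continuous_intros c DERIV_minus D\<close>)
  finally have 2: "(LINT x:{R<..2 * R}|half_line. (soliton' (x - R))\<^sup>2) \<le> len amp"
    using l0 by (simp add: soliton_0)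
  have "ival (\<lambda>y. (soliton' y)\<^sup>2) = (LINT x:{0<..R}|half_line. (soliton' (x - R))\<^sup>2) + (LINT x:{R<..2 * R}|half_line. (soliton' (x - R))\<^sup>2)"
    by (rule set_integral_Ioc_split[OF order_refl _ _ _ _ ival_integrable[OF cont_sol(1)]]) (use R0 in auto)
  with 1 2 show ?thesis by linarith
qed

text \<open>Equipartition: by the integrated conservation law \<open>soliton'_sq\<close> the zero
  order part of the action equals the gradient part, each being half of the right side.\<close>

lemma a_half: "(1 / 2) * a_sol - d_sol / (p + 1) = ival (\<lambda>y. (soliton' y)\<^sup>2)"
proof -
  have "ival (\<lambda>y. (soliton' y)\<^sup>2) = ival (\<lambda>y. \<omega> * (soliton y)\<^sup>2 - \<kappa> * soliton y powr (p + 1))"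
    by (simp only: soliton'_sq)
  also have "\<dots> = \<omega> * ival (\<lambda>y. (soliton y)\<^sup>2) - \<kappa> * d_sol"
    unfolding d_sol_def by (rule ival_lin[OF cont_sol(2,3)])
  finally have "\<omega> * ival (\<lambda>y. (soliton y)\<^sup>2) = ival (\<lambda>y. (soliton' y)\<^sup>2) + 2 * (d_sol / (p + 1))"
    by (simp add: \<kappa>_def)
  moreover define z where "z = d_sol / (p + 1)"
  ultimately show ?thesis unfolding a_sol_def z_def[symmetric] by (simp add: field_simps)
qed

lemma gain_le: "gain / R\<^sup>2 \<le> c * (LINT x|half_line. (bump x)\<^sup>2 / x\<^sup>2)"
proof -
  have R1: "0 \<le> R - 1" "R - 1 \<le> R + 1" using R by auto
  define \<delta> where "\<delta> = soliton 1 - soliton 2"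
  have \<delta>: "0 \<le> \<delta>" using soliton_antimono[of 1 2] by (simp add: \<delta>_def)
  have "2 * (\<delta>\<^sup>2 / (4 * R\<^sup>2)) = (LINT x|half_line. (\<delta>\<^sup>2 / (4 * R\<^sup>2)) * indicat_real {R - 1<..R + 1} x)"
    using integral_indicator_Ioc[OF R1] by simp
  also have "\<dots> \<le> (LINT x|half_line. (bump x)\<^sup>2 / x\<^sup>2)"
  proof (rule integral_mono[OF integrable_mult_right[OF integrable_indicator_Ioc[OF R1(1)]] H1_primitiveD(4)[OF bump_H1]])
    fix x
    show "(\<delta>\<^sup>2 / (4 * R\<^sup>2)) * indicat_real {R - 1<..R + 1} x \<le> (bump x)\<^sup>2 / x\<^sup>2"
    proof (cases "x \<in> {R - 1<..R + 1}")
      case True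
      then have x: "0 < x" "x \<le> 2 * R" "\<bar>x - R\<bar> \<le> 1" using R by auto
      have "soliton 1 \<le> soliton (x - R)" "soliton R \<le> soliton 2"
        using soliton_antimono[of "x - R" 1] soliton_antimono[of 2 R] x R by auto
      then have "\<delta> \<le> bump x" using bump_eq(1)[OF x(1,2)] by (simp add: \<delta>_def)
      then have "\<delta>\<^sup>2 \<le> (bump x)\<^sup>2" using \<delta> by (intro power_mono) auto
      moreover have "x\<^sup>2 \<le> 4 * R\<^sup>2" using power_mono[of x "2 * R" 2] x by (simp add: power_mult_distrib)
      ultimately have "\<delta>\<^sup>2 / (4 * R\<^sup>2) \<le> (bump x)\<^sup>2 / x\<^sup>2" using x by (intro frac_le) auto
      then show ?thesis using True by simp
    qed simp
  qed
  finally have "c * (2 * (\<delta>\<^sup>2 / (4 * R\<^sup>2))) \<le> c * (LINT x|half_line. (bump x)\<^sup>2 / x\<^sup>2)"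
    using c by (intro mult_left_mono) auto
  then show ?thesis by (simp add: gain_def \<delta>_def)
qed

text \<open>The derivative is that of the soliton, lowering the soliton reduces its
  \<open>L2\<close> norm, and the potential takes away at least the gain.\<close>

lemma bump_energy: "energy bump bump' \<le> a_sol - gain / R\<^sup>2"
proof -
  have "(LINT x|half_line. (bump' x)\<^sup>2) = ival (\<lambda>y. (soliton' y)\<^sup>2)"
    unfolding set_lebesgue_integral_def
    by (rule Bochner_Integration.integral_cong) (auto simp: bump'_def indicator_def)
  moreover have "(LINT x|half_line. (bump x)\<^sup>2) \<le> ival (\<lambda>y. (soliton y)\<^sup>2)"
    unfolding bump_sq(2)
  proof (rule set_integral_mono[OF ival_integrable[OF cont_sq] ival_integrable[OF cont_sol(2)]])
    fix x assume x: "x \<in> {0<..2 * R}"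
    then have "soliton R \<le> soliton (x - R)" by (intro soliton_antimono) auto
    then show "(soliton (x - R) - soliton R)\<^sup>2 \<le> (soliton (x - R))\<^sup>2"
      using soliton_pos[of R] by (intro power_mono) auto
  qed
  moreover note gain_le
  moreover have "\<omega> * (LINT x|half_line. (bump x)\<^sup>2) \<le> \<omega> * ival (\<lambda>y. (soliton y)\<^sup>2)"
    using calculation(2) w by (intro mult_left_mono) auto
  ultimately show ?thesis unfolding energy_eq[OF bump_H1] a_sol_def by linarith
qed

text \<open>By convexity of the power, lowering by \<open>soliton R\<close> costs pointwise at most
  \<open>(p + 1) * amp powr p * soliton R\<close>, over a window of length
  \<open>2 * R\<close>.\<close>

lemma bump_mass: "d_sol - 2 * (p + 1) * amp powr p * R * soliton R \<le> mass bump"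
proof -
  have c1: "continuous_on UNIV (\<lambda>y. (p + 1) * soliton y powr p * soliton R)"
    by (intro continuous_intros cont_sol)
  have "ival (\<lambda>y. (p + 1) * soliton y powr p * soliton R) \<le> (LINT x:{0<..2 * R}|half_line. (p + 1) * amp powr p * soliton R)"
  proof (rule set_integral_mono[OF ival_integrable[OF c1]])
    show "set_integrable half_line {0<..2 * R} (\<lambda>x. (p + 1) * amp powr p * soliton R)"
      by (rule continuous_set_integrable_Ioc) auto
    fix x
    have "soliton (x - R) powr p \<le> amp powr p"
      using soliton_pos[of "x - R"] soliton_le_amp p by (intro powr_mono2) (auto simp: less_imp_le)
    then show "(p + 1) * soliton (x - R) powr p * soliton R \<le> (p + 1) * amp powr p * soliton R"
      using p soliton_pos[of R] by (intro mult_right_mono mult_left_mono) auto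
  qed
  also have "\<dots> = 2 * (p + 1) * amp powr p * R * soliton R"
    using integral_indicator_Ioc[of 0 "2 * R"] R by (simp add: set_lebesgue_integral_def)
  finally have 1: "ival (\<lambda>y. (p + 1) * soliton y powr p * soliton R) \<le> 2 * (p + 1) * amp powr p * R * soliton R" .
  have "d_sol - ival (\<lambda>y. (p + 1) * soliton y powr p * soliton R)
     = ival (\<lambda>y. soliton y powr (p + 1) - (p + 1) * soliton y powr p * soliton R)"
    unfolding d_sol_def using ival_integrable[OF c1] ival_integrable[OF cont_sol(3)] by simp
  also have "\<dots> \<le> (LINT x:{0<..2 * R}|half_line. bump x powr (p + 1))"
  proof (rule set_integral_mono)
    show "set_integrable half_line {0<..2 * R} (\<lambda>x. soliton (x - R) powr (p + 1) - (p + 1) * soliton (x - R) powr p * soliton R)"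
      by (intro set_integral_diff ival_integrable c1 cont_sol)
    show "set_integrable half_line {0<..2 * R} (\<lambda>x. bump x powr (p + 1))"
      by (rule set_integrable_from_integrable[OF mass_integrable[OF bump_adm]]) (simp add: Ioc_in_half_line)
    fix x assume x: "x \<in> {0<..2 * R}"
    have "soliton (x - R) powr (p + 1) - (p + 1) * soliton (x - R) powr ((p + 1) - 1) * soliton R
       \<le> (soliton (x - R) - soliton R) powr (p + 1)"
    proof (rule diff_powr_bound)
      show "soliton R \<le> soliton (x - R)" using x by (intro soliton_antimono) auto
    qed (use soliton_pos[of R] p in auto)
    then show "soliton (x - R) powr (p + 1) - (p + 1) * soliton (x - R) powr p * soliton R \<le> bump x powr (p + 1)"
      using bump_eq(1)[of x] x by simp
  qed
  also have "\<dots> \<le> mass bump"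
    unfolding mass_def
    by (rule set_integral_mono_half_line[OF mass_integrable[OF bump_adm]]) (auto simp: Ioc_in_half_line)
  finally show ?thesis using 1 by linarith
qed

text \<open>The first condition puts the energy \<open>a'\<close> of the bump below its mass, whence
  \<open>q \<le> a' powr (1 - \<theta>)\<close>. The second pushes
  \<open>(1 / 2 - 1 / (p + 1)) * a'\<close> below \<open>2 * len amp\<close>, and that means
  \<open>a' powr (1 - \<theta>) < q_line\<close>.\<close>

lemma gap_if_small:
  assumes 1: "2 * (p + 1) * amp powr p * R * soliton R \<le> gain / R\<^sup>2"
    and 2: "2 * sqrt \<omega> * amp * soliton R / (p + 1) < (1 / 2 - 1 / (p + 1)) * (gain / R\<^sup>2)"
  shows "q < q_line" "0 < mass bump"
proof -
  define a' where "a' = energy bump bump'"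
  have ad: "a' \<le> mass bump" using bump_energy bump_mass a_le_d(1) 1 unfolding a'_def by linarith
  \<comment> \<open>Positivity comes from the gain itself: by Hardy's inequality it is a lower bound
    for a multiple of the gradient term.\<close>
  have a'pos: "0 < a'"
  proof -
    have "0 < gain / R\<^sup>2" using gain_pos R by simp
    also have "\<dots> \<le> c * (LINT x|half_line. (bump x)\<^sup>2 / x\<^sup>2)" by (rule gain_le)
    also have "\<dots> \<le> c * (4 * (LINT x|half_line. (bump' x)\<^sup>2))"
      using Hardy(2)[OF bump_primitive] c by (intro mult_left_mono) auto
    finally have "0 < (LINT x|half_line. (bump' x)\<^sup>2)" using c by (simp add: zero_less_mult_iff)
    then have "0 < (1 - 4 * c) * (LINT x|half_line. (bump' x)\<^sup>2)" using c by simp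
    moreover have "0 \<le> \<omega> * (LINT x|half_line. (bump x)\<^sup>2)" using w by simp
    ultimately show ?thesis using energy_coercive[OF bump_H1] by (simp add: a'_def)
  qed
  show m: "0 < mass bump" using ad a'pos by linarith
  have "(1 / 2 - 1 / (p + 1)) * a_sol = ((1 / 2) * a_sol - d_sol / (p + 1)) + (d_sol - a_sol) / (p + 1)"
    by (simp add: diff_divide_distrib left_diff_distrib)
  also have "\<dots> \<le> 2 * len amp + 2 * sqrt \<omega> * amp * soliton R / (p + 1)"
    unfolding a_half using kinetic a_le_d(2) p by (intro add_mono divide_right_mono) auto
  also have "\<dots> < 2 * len amp + (1 / 2 - 1 / (p + 1)) * (gain / R\<^sup>2)" using 2 by simp
  finally have "(1 / 2 - 1 / (p + 1)) * (a_sol - gain / R\<^sup>2) < 2 * len amp" by (simp add: right_diff_distrib)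
  moreover have "(1 / 2 - 1 / (p + 1)) * a' \<le> (1 / 2 - 1 / (p + 1)) * (a_sol - gain / R\<^sup>2)"
    unfolding a'_def using bump_energy gap_factor(1) by (intro mult_left_mono) auto
  ultimately have "a' < 2 * len amp / (1 / 2 - 1 / (p + 1))"
    using gap_factor(1) by (simp only: pos_less_divide_eq mult.commute)
  then have lt: "a' powr (1 - \<theta>) < q_line"
    unfolding q_line_def using a'pos \<theta> by (intro powr_less_mono2) auto
  have "q * mass bump powr \<theta> \<le> a'" unfolding a'_def by (rule q_mass_le[OF bump_adm])
  also have "\<dots> = a' powr (1 - \<theta>) * a' powr \<theta>" using a'pos by (simp flip: powr_add)
  also have "\<dots> \<le> a' powr (1 - \<theta>) * mass bump powr \<theta>"
    using ad a'pos \<theta> by (intro mult_left_mono powr_mono2) auto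
  finally have "q \<le> a' powr (1 - \<theta>)" using m by simp
  with lt show "q < q_line" by linarith
qed

end

text \<open>After multiplication by \<open>R\<^sup>2\<close> both conditions ask that a power of
  \<open>R\<close> times \<open>exp (- sqrt \<omega> * R)\<close> be below a fixed positive number.
  The same bump, rescaled, supplies the element of mass \<open>1\<close> that the definition of
  \<open>q\<close> was waiting for.\<close>

lemma q_less_q_line: "q < q_line" and adm_mass_1: "\<exists>U g. adm U g \<and> mass U = 1"
proof -
  define C where "C = amp * 2 powr (2 / (p - 1))"
  define k1 where "k1 = 2 * (p + 1) * amp powr p"
  define k2 where "k2 = 2 * sqrt \<omega> * amp / (p + 1)"
  define k3 where "k3 = (1 / 2 - 1 / (p + 1)) * gain"
  have k: "0 \<le> k1" "0 \<le> k2" "0 < k3" "0 \<le> C"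
    using p w amp_pos gap_factor(1) gain_pos by (auto simp: k1_def k2_def k3_def C_def less_imp_le)
  define s where "s = sqrt \<omega>"
  have s: "0 < s" using w by (simp add: s_def)
  have "((\<lambda>R. k1 * C * (R ^ 3 * exp (- s * R))) \<longlongrightarrow> k1 * C * 0) at_top"
    using s by (intro tendsto_mult tendsto_const) real_asymp
  then have 1: "\<forall>\<^sub>F R in at_top. k1 * C * (R ^ 3 * exp (- s * R)) < gain"
    by (rule order_tendstoD) (use gain_pos in simp)
  have "((\<lambda>R. k2 * C * (R ^ 2 * exp (- s * R))) \<longlongrightarrow> k2 * C * 0) at_top"
    using s by (intro tendsto_mult tendsto_const) real_asymp
  then have 2: "\<forall>\<^sub>F R in at_top. k2 * C * (R ^ 2 * exp (- s * R)) < k3"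
    by (rule order_tendstoD) (use k in simp)
  have "\<forall>\<^sub>F R in at_top. 2 \<le> R \<and> k1 * C * (R ^ 3 * exp (- s * R)) < gain \<and> k2 * C * (R ^ 2 * exp (- s * R)) < k3"
    using eventually_ge_at_top[of "2::real"] 1 2 by eventually_elim simp
  then obtain R where R: "2 \<le> R" "k1 * C * (R ^ 3 * exp (- s * R)) < gain" "k2 * C * (R ^ 2 * exp (- s * R)) < k3"
    using eventually_happens'[OF trivial_limit_at_top_linorder] by blast
  have e: "soliton R \<le> C * exp (- s * R)" unfolding C_def s_def by (rule soliton_decay)
  have R2: "0 < R\<^sup>2" using R by simp
  have "k1 * R * soliton R * R\<^sup>2 \<le> k1 * R * (C * exp (- s * R)) * R\<^sup>2"
    using e k R by (intro mult_right_mono mult_left_mono) auto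
  also have "\<dots> < gain" using R(2) by (simp add: power3_eq_cube power2_eq_square mult_ac)
  finally have A: "2 * (p + 1) * amp powr p * R * soliton R \<le> gain / R\<^sup>2"
    using R2 by (simp add: pos_le_divide_eq k1_def)
  have "k2 * soliton R * R\<^sup>2 \<le> k2 * (C * exp (- s * R)) * R\<^sup>2"
    using e k R by (intro mult_right_mono mult_left_mono) auto
  also have "\<dots> < k3" using R(3) by (simp add: mult_ac)
  finally have "k2 * soliton R < k3 / R\<^sup>2" using R2 by (simp add: pos_less_divide_eq)
  then have B: "2 * sqrt \<omega> * amp * soliton R / (p + 1) < (1 / 2 - 1 / (p + 1)) * (gain / R\<^sup>2)"
    by (simp add: k2_def k3_def)
  show "q < q_line" by (rule gap_if_small[OF R(1) A B])
  have m: "0 < mass (bump R)" by (rule gap_if_small[OF R(1) A B])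
  define t where "t = mass (bump R) powr (- 1 / (p + 1))"
  have t: "t > 0" using m by (simp add: t_def)
  have "t powr (p + 1) = mass (bump R) powr (- 1)" using p by (simp add: t_def powr_powr)
  then have "mass (\<lambda>x. t * bump R x) = 1"
    using mass_scale[OF bump_adm[OF R(1)], of t] t m by (simp add: powr_minus)
  then show "\<exists>U g. adm U g \<and> mass U = 1"
    using adm_scale[OF bump_adm[OF R(1)], of t] t by (metis less_imp_le)
qed

end

section \<open>Smooth functions of compact support\<close>

definition smooth_real :: "(real \<Rightarrow> real) \<Rightarrow> bool" where
  "smooth_real f \<longleftrightarrow> (\<exists>D. D 0 = f \<and> (\<forall>n x. (D n has_real_derivative D (Suc n) x) (at x)))"

text \<open>Coinduction: in a class that contains a derivative of each member, derivatives can be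
  chosen again and again without leaving it. No formula for an \<open>n\<close>-th derivative is
  then ever required.\<close>

lemma smooth_real_coinduct:
  assumes "C f" and step: "\<And>g. C g \<Longrightarrow> \<exists>g'. C g' \<and> (\<forall>x. (g has_real_derivative g' x) (at x))"
  shows "smooth_real f"
proof -
  obtain d where d: "\<And>g. C g \<Longrightarrow> C (d g) \<and> (\<forall>x. (g has_real_derivative d g x) (at x))"
    using step by metis
  define D where "D n = (d ^^ n) f" for n
  have "C (D n)" for n by (induction n) (use assms(1) d in \<open>auto simp: D_def\<close>)
  then have "\<forall>n x. (D n has_real_derivative D (Suc n) x) (at x)" using d by (simp add: D_def)
  moreover have "D 0 = f" by (simp add: D_def)
  ultimately show ?thesis unfolding smooth_real_def by blast
qed

lemma smooth_realE:
  assumes "smooth_real f"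
  obtains f' where "smooth_real f'" "\<And>x. (f has_real_derivative f' x) (at x)"
proof -
  obtain D where D: "D 0 = f" "\<And>n x. (D n has_real_derivative D (Suc n) x) (at x)"
    using assms by (auto simp: smooth_real_def)
  have "smooth_real (D 1)" unfolding smooth_real_def
    by (intro exI[of _ "\<lambda>n. D (Suc n)"]) (use D in auto)
  moreover have "(f has_real_derivative D 1 x) (at x)" for x using D(2)[of 0 x] D(1) by simp
  ultimately show ?thesis using that by blast
qed

lemma smooth_real_antiderivative:
  assumes "smooth_real f'" "\<And>x. (f has_real_derivative f' x) (at x)"
  shows "smooth_real f"
proof -
  have "f = f \<or> smooth_real f" by simp
  then show ?thesis
  proof (rule smooth_real_coinduct[where C = "\<lambda>g. g = f \<or> smooth_real g"])
    fix g assume "g = f \<or> smooth_real g"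
    then show "\<exists>g'. (g' = f \<or> smooth_real g') \<and> (\<forall>x. (g has_real_derivative g' x) (at x))"
      using assms by (metis smooth_realE)
  qed
qed

lemma smooth_real_continuous: "smooth_real f \<Longrightarrow> continuous_on S f"
  by (metis DERIV_continuous_on has_field_derivative_at_within smooth_realE)

text \<open>By the Leibniz rule the derivative of a product is a sum of two such products, so
  closing under sums gives a class to which the coinduction applies.\<close>

inductive prod_sum :: "(real \<Rightarrow> real) \<Rightarrow> bool" where
  prod: "smooth_real f \<Longrightarrow> smooth_real g \<Longrightarrow> prod_sum (\<lambda>x. f x * g x)"
| sum: "prod_sum f \<Longrightarrow> prod_sum g \<Longrightarrow> prod_sum (\<lambda>x. f x + g x)"

lemma prod_sum_smooth: "prod_sum f \<Longrightarrow> smooth_real f"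
proof (rule smooth_real_coinduct[where C = prod_sum])
  fix g assume "prod_sum g"
  then show "\<exists>g'. prod_sum g' \<and> (\<forall>x. (g has_real_derivative g' x) (at x))"
  proof induction
    case (prod f g)
    obtain f' where f': "smooth_real f'" "\<And>x. (f has_real_derivative f' x) (at x)" by (rule smooth_realE[OF prod(1)]) blast
    obtain g' where g': "smooth_real g'" "\<And>x. (g has_real_derivative g' x) (at x)" by (rule smooth_realE[OF prod(2)]) blast
    have "prod_sum (\<lambda>x. f' x * g x + f x * g' x)"
      by (intro prod_sum.intros f' g' prod)
    moreover have "((\<lambda>x. f x * g x) has_real_derivative f' x * g x + f x * g' x) (at x)" for x
      using DERIV_mult[OF f'(2) g'(2), of x] by (simp add: mult.commute add.commute)
    ultimately show ?case by blast
  next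
    case (sum f g)
    then obtain f' g' where "prod_sum f'" "\<And>x. (f has_real_derivative f' x) (at x)"
      "prod_sum g'" "\<And>x. (g has_real_derivative g' x) (at x)" by blast
    then show ?case by (intro exI[of _ "\<lambda>x. f' x + g' x"]) (auto intro: prod_sum.sum DERIV_add)
  qed
qed

lemma smooth_real_mult: "smooth_real f \<Longrightarrow> smooth_real g \<Longrightarrow> smooth_real (\<lambda>x. f x * g x)"
  by (rule prod_sum_smooth[OF prod_sum.prod])

lemma smooth_real_polynomial:
  assumes "real_polynomial_function f" shows "smooth_real f"
proof (rule smooth_real_coinduct[where C = real_polynomial_function, OF assms])
  fix g :: "real \<Rightarrow> real" assume "real_polynomial_function g"
  then show "\<exists>g'. real_polynomial_function g' \<and> (\<forall>x. (g has_real_derivative g' x) (at x))"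
    using has_vector_derivative_polynomial_function[of g]
    by (metis real_polynomial_function_eq has_real_derivative_iff_has_vector_derivative)
qed

lemma smooth_real_const: "smooth_real (\<lambda>_. k)"
  by (intro smooth_real_polynomial real_polynomial_function.intros(2))

lemma smooth_real_diff_scale:
  assumes "smooth_real f" "smooth_real g" shows "smooth_real (\<lambda>x. f x - m * g x)"
proof -
  have "prod_sum (\<lambda>x. 1 * f x + (-m) * g x)"
    by (intro prod_sum.intros smooth_real_const assms)
  then show ?thesis using prod_sum_smooth by force
qed

text \<open>The class for the coinduction carries a factor \<open>r\<close>, which collects the
  powers of \<open>k\<close> that differentiation brings out.\<close>

lemma smooth_real_affine:
  assumes "smooth_real f" shows "smooth_real (\<lambda>x. f (k * x + m))"
proof (rule smooth_real_coinduct[where C = "\<lambda>g. \<exists>r f. smooth_real f \<and> g = (\<lambda>x. r * f (k * x + m))"])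
  show "\<exists>r h. smooth_real h \<and> (\<lambda>x. f (k * x + m)) = (\<lambda>x. r * h (k * x + m))"
    using assms by (intro exI[of _ 1] exI[of _ f]) auto
  fix g assume "\<exists>r f. smooth_real f \<and> g = (\<lambda>x. r * f (k * x + m))"
  then obtain r f where f: "smooth_real f" "g = (\<lambda>x. r * f (k * x + m))" by blast
  obtain f' where f': "smooth_real f'" "\<And>x. (f has_real_derivative f' x) (at x)" by (rule smooth_realE[OF f(1)]) blast
  have "(g has_real_derivative (r * k) * f' (k * x + m)) (at x)" for x
    unfolding f(2) by (rule derivative_eq_intros DERIV_chain2[OF f'(2)] refl | simp)+
  then show "\<exists>g'. (\<exists>r f. smooth_real f \<and> g' = (\<lambda>x. r * f (k * x + m))) \<and> (\<forall>x. (g has_real_derivative g' x) (at x))"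
    using f'(1) by (intro exI[of _ "\<lambda>x. (r * k) * f' (k * x + m)"]) blast
qed

text \<open>These functions, with \<open>q\<close> a polynomial, form a class closed under differentiation.\<close>

definition flat :: "(real \<Rightarrow> real) \<Rightarrow> real \<Rightarrow> real" where
  "flat q x = (if 0 < x then q (1 / x) * exp (- (1 / x)) else 0)"

lemma flat_derivative:
  assumes q: "real_polynomial_function q" and q': "\<And>x. (q has_real_derivative q' x) (at x)"
  shows "(flat q has_real_derivative flat (\<lambda>s. s\<^sup>2 * (q s - q' s)) x) (at x)"
proof -
  consider "x < 0" | "x = 0" | "0 < x" by linarith
  then show ?thesis
  proof cases
    case 1
    have "\<forall>\<^sub>F y in nhds x. flat q y = 0"
      using eventually_nhds_in_open[of "{..<0}" x] 1 by (auto elim!: eventually_mono simp: flat_def)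
    then have "(flat q has_real_derivative 0) (at x) \<longleftrightarrow> ((\<lambda>_. 0) has_real_derivative 0) (at x)"
      by (intro DERIV_cong_ev) auto
    then show ?thesis using 1 by (simp add: flat_def)
  next
    case 3
    have "\<forall>\<^sub>F y in nhds x. flat q y = q (1 / y) * exp (- (1 / y))"
      using eventually_nhds_in_open[of "{0<..}" x] 3 by (auto elim!: eventually_mono simp: flat_def)
    then have "(flat q has_real_derivative flat (\<lambda>s. s\<^sup>2 * (q s - q' s)) x) (at x) \<longleftrightarrow>
      ((\<lambda>y. q (1 / y) * exp (- (1 / y))) has_real_derivative flat (\<lambda>s. s\<^sup>2 * (q s - q' s)) x) (at x)"
      by (intro DERIV_cong_ev) auto
    moreover have "((\<lambda>y. q (1 / y) * exp (- (1 / y))) has_real_derivative flat (\<lambda>s. s\<^sup>2 * (q s - q' s)) x) (at x)"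
      using 3 by (auto intro!: derivative_eq_intros DERIV_chain2[OF q'] simp: flat_def power2_eq_square field_simps)
    ultimately show ?thesis by blast
  next
    case 2
    obtain a n where a: "q = (\<lambda>x. \<Sum>i\<le>n. a i * x ^ i)" using q by (auto simp: real_polynomial_function_iff_sum)
    \<comment> \<open>At the origin the right difference quotient is
      \<open>s * q s * exp (- s)\<close> with \<open>s = 1 / h\<close>, and exponential decay sends
      it to \<open>0\<close>.\<close>
    have "((\<lambda>s. \<Sum>i\<le>n. a i * (s ^ Suc i / exp s)) \<longlongrightarrow> (\<Sum>i\<le>n. a i * 0)) at_top"
      by (intro tendsto_sum tendsto_mult tendsto_const tendsto_power_div_exp_0)
    moreover have "(\<Sum>i\<le>n. a i * (s ^ Suc i / exp s)) = s * q s * exp (- s)" for s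
      by (simp add: a sum_distrib_left sum_distrib_right exp_minus field_simps)
    ultimately have L: "((\<lambda>s. s * q s * exp (- s)) \<longlongrightarrow> 0) at_top" by simp
    have "((\<lambda>h. inverse h * q (inverse h) * exp (- inverse h)) \<longlongrightarrow> 0) (at_right 0)"
      by (rule filterlim_compose[OF L filterlim_inverse_at_top_right])
    moreover have "\<forall>\<^sub>F h in at_right 0. inverse h * q (inverse h) * exp (- inverse h) = (flat q (0 + h) - flat q 0) / h"
      using eventually_at_right_less[of "0::real"] by eventually_elim (simp add: flat_def field_simps)
    ultimately have R: "((\<lambda>h. (flat q (0 + h) - flat q 0) / h) \<longlongrightarrow> 0) (at_right 0)"
      by (rule Lim_transform_eventually)
    have "\<forall>\<^sub>F h in at_left 0. (flat q (0 + h) - flat q 0) / h = 0"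
      by (auto simp: eventually_at_filter flat_def)
    then have Lf: "((\<lambda>h. (flat q (0 + h) - flat q 0) / h) \<longlongrightarrow> 0) (at_left 0)" by (rule tendsto_eventually)
    have "((\<lambda>h. (flat q (0 + h) - flat q 0) / h) \<longlongrightarrow> 0) (at 0)"
      using R Lf by (simp add: filterlim_at_split)
    then have "(flat q has_real_derivative 0) (at 0)" by (simp add: DERIV_def)
    then show ?thesis using 2 by (simp add: flat_def)
  qed
qed

lemma flat_smooth:
  assumes "real_polynomial_function q" shows "smooth_real (flat q)"
proof (rule smooth_real_coinduct[where C = "\<lambda>f. \<exists>q. real_polynomial_function q \<and> f = flat q"])
  show "\<exists>r. real_polynomial_function r \<and> flat q = flat r" using assms by blast
  fix g assume "\<exists>q. real_polynomial_function q \<and> g = flat q"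
  then obtain q where q: "real_polynomial_function q" "g = flat q" by blast
  obtain q' where q': "real_polynomial_function q'" "\<And>x. (q has_real_derivative q' x) (at x)"
    using has_vector_derivative_polynomial_function[of q] q(1)
    by (metis real_polynomial_function_eq has_real_derivative_iff_has_vector_derivative)
  have id: "real_polynomial_function (\<lambda>s::real. s)" by (rule real_polynomial_function.intros(1)) (rule bounded_linear_ident)
  have "real_polynomial_function (\<lambda>s. s\<^sup>2 * (q s - q' s))"
    by (intro real_polynomial_function.intros(4) real_polynomial_function_power real_polynomial_function_diff id q q')
  then show "\<exists>g'. (\<exists>q. real_polynomial_function q \<and> g' = flat q) \<and> (\<forall>x. (g has_real_derivative g' x) (at x))"
    using flat_derivative[OF q(1) q'(2)] q(2) by blast
qed

text \<open>Smooth and, for \<open>a < b\<close>, positive exactly on the open interval; the factor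
  \<open>Suc n\<close> sharpens the flanks so that the values inside tend to \<open>1\<close>. The
  member \<open>n = 0\<close> serves later as a bump with positive integral.\<close>

definition cutoff :: "real \<Rightarrow> real \<Rightarrow> nat \<Rightarrow> real \<Rightarrow> real" where
  "cutoff a b n x = flat (\<lambda>_. 1) (real (Suc n) * x + - (real (Suc n) * a)) * flat (\<lambda>_. 1) (- real (Suc n) * x + real (Suc n) * b)"

lemma cutoff_smooth: "smooth_real (cutoff a b n)"
proof -
  have F: "smooth_real (flat (\<lambda>_. 1))" by (rule flat_smooth[OF real_polynomial_function.intros(2)])
  show ?thesis unfolding cutoff_def[abs_def]
    by (rule smooth_real_mult[OF smooth_real_affine[OF F] smooth_real_affine[OF F]])
qed

lemma flat_1_bounds: "0 \<le> flat (\<lambda>_. 1) x" "flat (\<lambda>_. 1) x \<le> 1"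
  by (auto simp: flat_def)

lemma cutoff_bounds: "0 \<le> cutoff a b n x" "cutoff a b n x \<le> 1"
  using flat_1_bounds by (auto simp: cutoff_def intro!: mult_nonneg_nonneg mult_le_one)

lemma cutoff_eq:
  "cutoff a b n x = (if a < x \<and> x < b then exp (- (1 / (real (Suc n) * (x - a)))) * exp (- (1 / (real (Suc n) * (b - x)))) else 0)"
proof -
  have 1: "real (Suc n) * x + - (real (Suc n) * a) = real (Suc n) * (x - a)"
    "- real (Suc n) * x + real (Suc n) * b = real (Suc n) * (b - x)" by (simp_all add: algebra_simps)
  show ?thesis unfolding cutoff_def 1 flat_def by (auto simp: zero_less_mult_iff simp del: of_nat_Suc)
qed

lemma cutoff_limit:
  assumes "a < x" "x < b" shows "(\<lambda>n. cutoff a b n x) \<longlonglongrightarrow> 1"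
proof -
  have "(\<lambda>n. exp (- (1 / (real (Suc n) * y)))) \<longlonglongrightarrow> 1" if "0 < y" for y :: real
  proof -
    have "(\<lambda>n. exp (- (1 / real (Suc n) * (1 / y)))) \<longlonglongrightarrow> exp (- (0 * (1 / y)))"
      by (intro tendsto_intros LIMSEQ_Suc[OF lim_1_over_n])
    then show ?thesis by (simp add: divide_simps)
  qed
  from tendsto_mult[OF this[of "x - a"] this[of "b - x"]] show ?thesis
    using assms by (simp add: cutoff_eq)
qed

section \<open>Density in \<open>L2\<close> of smooth functions supported in an interval\<close>

definition approximable :: "real \<Rightarrow> real \<Rightarrow> (real \<Rightarrow> real) \<Rightarrow> bool" where
  "approximable a b v \<longleftrightarrow> (\<forall>e>0. \<exists>f. smooth_real f \<and> (\<forall>x. x \<notin> {a<..<b} \<longrightarrow> f x = 0) \<and>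
     (LINT x|lebesgue_on {a<..b}. (v x - f x)\<^sup>2) < e)"

lemma AE_lebesgue_Ioc:
  assumes "AE x in lebesgue. P x" shows "AE x in lebesgue_on {a<..b::real}. P x"
  by (subst AE_restrict_space_iff, simp) (rule eventually_mono[OF assms], simp)

lemma finite_measure_Ioc: "finite_measure (lebesgue_on {a<..b::real})"
  by (rule finite_measure_lebesgue_on, rule bounded_set_imp_lmeasurable, rule bounded_subset[of "{a..b}"]) auto

lemma bounded_L2:
  fixes f :: "real \<Rightarrow> real"
  assumes f: "f \<in> borel_measurable (lebesgue_on {a<..b})" and K: "\<And>x. x \<in> {a<..b} \<Longrightarrow> \<bar>f x\<bar> \<le> K"
  shows "integrable (lebesgue_on {a<..b}) (\<lambda>x. (f x)\<^sup>2)"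
proof (rule finite_measure.integrable_const_bound[OF finite_measure_Ioc])
  show "AE x in lebesgue_on {a<..b}. norm ((f x)\<^sup>2) \<le> K\<^sup>2"
  proof (rule AE_I2)
    fix x assume "x \<in> space (lebesgue_on {a<..b})"
    then have "\<bar>f x\<bar>\<^sup>2 \<le> K\<^sup>2" using K[of x] by (intro power_mono) (auto simp: space_restrict_space)
    then show "norm ((f x)\<^sup>2) \<le> K\<^sup>2" by simp
  qed
qed (use f in measurable)

lemma continuous_Ioc_measurable:
  fixes f :: "real \<Rightarrow> real"
  assumes "continuous_on UNIV f" shows "f \<in> borel_measurable (lebesgue_on {a<..b})"
  by (rule measurable_restrict_space1, rule measurable_completion)
    (simp add: borel_measurable_continuous_onI[OF assms])

lemma continuous_Ioc_L2:
  fixes f :: "real \<Rightarrow> real"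
  assumes "continuous_on UNIV f" shows "integrable (lebesgue_on {a<..b}) (\<lambda>x. (f x)\<^sup>2)"
proof -
  have "continuous_on {a..b} f" using assms continuous_on_subset by blast
  then have "bounded (f ` {a..b})" by (intro compact_imp_bounded compact_continuous_image) auto
  then obtain K where "\<And>x. x \<in> {a..b} \<Longrightarrow> \<bar>f x\<bar> \<le> K" by (force simp: bounded_iff)
  then show ?thesis by (intro bounded_L2[where K = K] continuous_Ioc_measurable assms) auto
qed

text \<open>A dominated limit converges in \<open>L2\<close>, so approximability passes to it.
  Density climbs in this way from polynomials times cutoffs to polynomials, continuous functions,
  bounded functions and finally all square integrable ones.\<close>

lemma approximable_limit:
  assumes meas: "v \<in> borel_measurable (lebesgue_on {a<..b})" "\<And>n. vn n \<in> borel_measurable (lebesgue_on {a<..b})"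
    and L2: "integrable (lebesgue_on {a<..b}) (\<lambda>x. (v x)\<^sup>2)" "\<And>n. integrable (lebesgue_on {a<..b}) (\<lambda>x. (vn n x)\<^sup>2)"
    and lim: "AE x in lebesgue_on {a<..b}. (\<lambda>n. vn n x) \<longlonglongrightarrow> v x"
    and dom: "integrable (lebesgue_on {a<..b}) B" "\<And>n x. x \<in> {a<..b} \<Longrightarrow> (v x - vn n x)\<^sup>2 \<le> B x"
    and appr: "\<And>n. approximable a b (vn n)"
  shows "approximable a b v"
  unfolding approximable_def
proof (intro allI impI)
  let ?M = "lebesgue_on {a<..b}"
  fix e :: real assume e: "0 < e"
  note [measurable] = meas
  have "(\<lambda>n. LINT x|?M. (v x - vn n x)\<^sup>2) \<longlonglongrightarrow> (LINT x|?M. 0)"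
  proof (rule integral_dominated_convergence[OF _ _ dom(1)])
    show "AE x in ?M. (\<lambda>n. (v x - vn n x)\<^sup>2) \<longlonglongrightarrow> 0"
      using lim
    proof eventually_elim
      case (elim x)
      have "(\<lambda>n. (v x - vn n x)\<^sup>2) \<longlonglongrightarrow> (v x - v x)\<^sup>2" by (intro tendsto_intros elim)
      then show ?case by simp
    qed
    show "AE x in ?M. norm ((v x - vn n x)\<^sup>2) \<le> B x" for n
      by (rule AE_I2) (use dom(2) in \<open>auto simp: space_restrict_space\<close>)
  qed measurable
  then have "\<forall>\<^sub>F n in sequentially. (LINT x|?M. (v x - vn n x)\<^sup>2) < e / 4"
    by (rule order_tendstoD) (use e in simp)
  then obtain n where n: "(LINT x|?M. (v x - vn n x)\<^sup>2) < e / 4" by (auto simp: eventually_sequentially)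
  obtain f where f: "smooth_real f" "\<And>x. x \<notin> {a<..<b} \<Longrightarrow> f x = 0" "(LINT x|?M. (vn n x - f x)\<^sup>2) < e / 4"
    using appr[of n] e unfolding approximable_def by (metis divide_pos_pos zero_less_numeral)
  have fc: "continuous_on UNIV f" by (rule smooth_real_continuous[OF f(1)])
  note fm[measurable] = continuous_Ioc_measurable[OF fc, of a b]
  have "(LINT x|?M. (v x - f x)\<^sup>2) \<le> 2 * (LINT x|?M. (v x - vn n x)\<^sup>2) + 2 * (LINT x|?M. (vn n x - f x)\<^sup>2)"
    by (rule L2_triangle[OF meas(1) meas(2) fm L2(1) L2(2) continuous_Ioc_L2[OF fc]])
  also have "\<dots> < e" using n f(3) e by simp
  finally show "\<exists>f. smooth_real f \<and> (\<forall>x. x \<notin> {a<..<b} \<longrightarrow> f x = 0) \<and> (LINT x|?M. (v x - f x)\<^sup>2) < e"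
    using f by blast
qed

lemma approximable_polynomial:
  assumes q: "real_polynomial_function q" shows "approximable a b q"
proof -
  let ?M = "lebesgue_on {a<..b}"
  have qs: "smooth_real q" by (rule smooth_real_polynomial[OF q])
  have ss: "smooth_real (\<lambda>x. q x * cutoff a b n x)" for n by (intro smooth_real_mult qs cutoff_smooth)
  have qc: "continuous_on UNIV q" "\<And>n. continuous_on UNIV (\<lambda>x. q x * cutoff a b n x)"
    using smooth_real_continuous qs ss by auto
  show ?thesis
  proof (rule approximable_limit[where vn = "\<lambda>n x. q x * cutoff a b n x" and B = "\<lambda>x. (q x)\<^sup>2"])
    \<comment> \<open>The cutoffs tend to \<open>1\<close> in the open interval only; the end point
      \<open>b\<close> is a null set.\<close>
    have "AE x in lebesgue. x \<notin> {b}" by (rule AE_not_in) simp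
    then have "AE x in ?M. x \<notin> {b}" by (rule AE_lebesgue_Ioc)
    then show "AE x in ?M. (\<lambda>n. q x * cutoff a b n x) \<longlonglongrightarrow> q x"
      using AE_space
    proof eventually_elim
      case (elim x)
      then have "(\<lambda>n. q x * cutoff a b n x) \<longlonglongrightarrow> q x * 1"
        by (intro tendsto_intros cutoff_limit) (auto simp: space_restrict_space)
      then show ?case by simp
    qed
    show "(q x - q x * cutoff a b n x)\<^sup>2 \<le> (q x)\<^sup>2" for n x
    proof -
      have "(1 - cutoff a b n x)\<^sup>2 \<le> 1" using cutoff_bounds[of a b n x] by (intro power_le_one) auto
      then have "(q x)\<^sup>2 * (1 - cutoff a b n x)\<^sup>2 \<le> (q x)\<^sup>2 * 1" by (intro mult_left_mono) auto
      moreover have "(q x - q x * cutoff a b n x)\<^sup>2 = (q x)\<^sup>2 * (1 - cutoff a b n x)\<^sup>2"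
        by (simp add: power2_eq_square algebra_simps)
      ultimately show ?thesis by simp
    qed
    show "approximable a b (\<lambda>x. q x * cutoff a b n x)" for n
      unfolding approximable_def
      by (intro allI impI exI[of _ "\<lambda>x. q x * cutoff a b n x"] conjI ss) (auto simp: cutoff_eq)
  qed (intro continuous_Ioc_measurable continuous_Ioc_L2 qc)+
qed

lemma approximable_continuous:
  fixes g :: "real \<Rightarrow> real"
  assumes g: "continuous_on UNIV g" shows "approximable a b g"
proof -
  have "\<exists>q. real_polynomial_function q \<and> (\<forall>x\<in>{a..b}. \<bar>g x - q x\<bar> < 1 / real (Suc n))" for n
  proof -
    have "continuous_on {a..b} g" using g continuous_on_subset by blast
    then show ?thesis
      using Stone_Weierstrass_real_polynomial_function[of "{a..b}" g "1 / real (Suc n)"] by (metis compact_Icc of_nat_0_less_iff zero_less_Suc zero_less_divide_1_iff)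
  qed
  then obtain q where q: "\<And>n. real_polynomial_function (q n)" "\<And>n x. x \<in> {a..b} \<Longrightarrow> \<bar>g x - q n x\<bar> < 1 / real (Suc n)"
    by metis
  have qc: "continuous_on UNIV (q n)" for n using smooth_real_continuous[OF smooth_real_polynomial[OF q(1)]] .
  show ?thesis
  proof (rule approximable_limit[where vn = q and B = "\<lambda>_. 1"])
    show "AE x in lebesgue_on {a<..b}. (\<lambda>n. q n x) \<longlonglongrightarrow> g x"
    proof (rule AE_I2)
      fix x assume "x \<in> space (lebesgue_on {a<..b})"
      then have x: "x \<in> {a..b}" by (auto simp: space_restrict_space)
      have "(\<lambda>n. q n x - g x) \<longlonglongrightarrow> 0"
      proof (rule Lim_null_comparison[OF _ LIMSEQ_Suc[OF lim_1_over_n]])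
        show "\<forall>\<^sub>F n in sequentially. norm (q n x - g x) \<le> 1 / real (Suc n)"
          using q(2)[OF x] by (auto simp: abs_minus_commute less_imp_le intro!: always_eventually)
      qed
      then show "(\<lambda>n. q n x) \<longlonglongrightarrow> g x" by (simp add: LIM_zero_iff)
    qed
    show "integrable (lebesgue_on {a<..b}) (\<lambda>_. 1::real)"
      using finite_measure.integrable_const[OF finite_measure_Ioc] by blast
    show "(g x - q n x)\<^sup>2 \<le> 1" if "x \<in> {a<..b}" for n x
    proof -
      have "\<bar>g x - q n x\<bar> < 1 / real (Suc n)" using q(2)[of x n] that by auto
      moreover have "1 / real (Suc n) \<le> 1" by (simp add: field_simps)
      ultimately have "\<bar>g x - q n x\<bar> \<le> 1" by linarith
      then show ?thesis by (simp add: abs_square_le_1)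
    qed
    show "approximable a b (q n)" for n by (rule approximable_polynomial[OF q(1)])
  qed (intro continuous_Ioc_measurable continuous_Ioc_L2 g qc)+
qed

definition clamp :: "real \<Rightarrow> real \<Rightarrow> real" where "clamp K x = max (- K) (min K x)"

text \<open>Measurability supplies continuous functions that converge almost everywhere, but without
  a common bound. Clamping them together with \<open>v\<close> creates the domination; letting the
  level of the clamp grow then removes the boundedness of the limit.\<close>

lemma approximable_L2:
  fixes v :: "real \<Rightarrow> real"
  assumes v: "v \<in> borel_measurable (lebesgue_on {a<..b})" "integrable (lebesgue_on {a<..b}) (\<lambda>x. (v x)\<^sup>2)"
  shows "approximable a b v"
proof -
  let ?M = "lebesgue_on {a<..b}"
  note [measurable] = v(1)
  have "v measurable_on {a<..b}" by (rule measurable_on_iff_borel_measurable[THEN iffD2, OF _ v(1)]) simp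
  then obtain N g where N: "negligible N" and g: "\<And>n. continuous_on UNIV (g n)"
    and lim: "\<And>x. x \<notin> N \<Longrightarrow> (\<lambda>n. g n x) \<longlonglongrightarrow> (if x \<in> {a<..b} then v x else 0)"
    unfolding measurable_on_def by blast
  have "AE x in lebesgue. x \<notin> N" using N by (simp add: negligible_iff_null_sets AE_not_in)
  then have "AE x in ?M. x \<notin> N" by (rule AE_lebesgue_Ioc)
  then have aelim: "AE x in ?M. (\<lambda>n. g n x) \<longlonglongrightarrow> v x"
    using AE_space
  proof eventually_elim
    case (elim x)
    then show ?case using lim[of x] by (simp add: space_restrict_space)
  qed
  have cb: "\<bar>clamp K y\<bar> \<le> K" if "0 \<le> K" for K y using that by (auto simp: clamp_def)
  have bounded: "approximable a b (\<lambda>x. clamp K (v x))" if K: "0 \<le> K" for K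
  proof (rule approximable_limit[where vn = "\<lambda>n x. clamp K (g n x)" and B = "\<lambda>_. (2 * K)\<^sup>2"])
    have cc: "continuous_on UNIV (\<lambda>x. clamp K (g n x))" for n
      unfolding clamp_def by (intro continuous_intros g)
    show "(\<lambda>x. clamp K (v x)) \<in> borel_measurable ?M" unfolding clamp_def by measurable
    then show "integrable ?M (\<lambda>x. (clamp K (v x))\<^sup>2)" by (rule bounded_L2) (rule cb[OF K])
    show "(\<lambda>x. clamp K (g n x)) \<in> borel_measurable ?M" "integrable ?M (\<lambda>x. (clamp K (g n x))\<^sup>2)"
      "approximable a b (\<lambda>x. clamp K (g n x))" for n
      by (intro continuous_Ioc_measurable continuous_Ioc_L2 approximable_continuous cc)+
    show "AE x in ?M. (\<lambda>n. clamp K (g n x)) \<longlonglongrightarrow> clamp K (v x)"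
      using aelim by eventually_elim (auto simp: clamp_def intro!: tendsto_intros)
    show "integrable ?M (\<lambda>_. (2 * K)\<^sup>2)" using finite_measure.integrable_const[OF finite_measure_Ioc] by blast
    show "(clamp K (v x) - clamp K (g n x))\<^sup>2 \<le> (2 * K)\<^sup>2" for n x
    proof -
      have "\<bar>clamp K (v x) - clamp K (g n x)\<bar> \<le> 2 * K" using cb[OF K, of "v x"] cb[OF K, of "g n x"] by linarith
      then have "\<bar>clamp K (v x) - clamp K (g n x)\<bar>\<^sup>2 \<le> (2 * K)\<^sup>2" by (intro power_mono) auto
      then show ?thesis by simp
    qed
  qed
  show ?thesis
  proof (rule approximable_limit[where vn = "\<lambda>n x. clamp (real n) (v x)" and B = "\<lambda>x. (v x)\<^sup>2"])
    show "(\<lambda>x. clamp (real n) (v x)) \<in> borel_measurable ?M" for n unfolding clamp_def by measurable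
    then show "integrable ?M (\<lambda>x. (clamp (real n) (v x))\<^sup>2)" for n
      by (rule bounded_L2) (rule cb, simp)
    show "AE x in ?M. (\<lambda>n. clamp (real n) (v x)) \<longlonglongrightarrow> v x"
    proof (rule AE_I2)
      fix x
      obtain n0 where n0: "\<bar>v x\<bar> \<le> real n0" using real_arch_simple by blast
      have "\<forall>\<^sub>F n in sequentially. clamp (real n) (v x) = v x"
        using eventually_ge_at_top[of n0]
      proof eventually_elim
        case (elim n)
        then have "real n0 \<le> real n" by simp
        then have "\<bar>v x\<bar> \<le> real n" using n0 by linarith
        then show ?case by (auto simp: clamp_def)
      qed
      then show "(\<lambda>n. clamp (real n) (v x)) \<longlonglongrightarrow> v x" by (rule tendsto_eventually)
    qed
    show "(v x - clamp (real n) (v x))\<^sup>2 \<le> (v x)\<^sup>2" for n x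
    proof -
      have "\<bar>v x - clamp (real n) (v x)\<bar> \<le> \<bar>v x\<bar>" by (auto simp: clamp_def)
      then have "\<bar>v x - clamp (real n) (v x)\<bar>\<^sup>2 \<le> \<bar>v x\<bar>\<^sup>2" by (intro power_mono) auto
      then show ?thesis by simp
    qed
  qed (use v bounded in auto)
qed

section \<open>Weak derivatives\<close>

lemma compact_support_integrable:
  fixes g :: "real \<Rightarrow> 'a::euclidean_space"
  assumes "continuous_on {0..b} g" "\<And>x. b < x \<Longrightarrow> g x = 0"
  shows "integrable half_line g"
proof -
  have "set_integrable half_line {0<..b} g" by (rule continuous_set_integrable_Ioc[OF order_refl assms(1)])
  moreover have "integrable half_line (\<lambda>x. indicat_real {0<..b} x *\<^sub>R g x) \<longleftrightarrow> integrable half_line g"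
    by (rule Bochner_Integration.integrable_cong[OF refl]) (use assms(2) in \<open>auto simp: space_half_line indicator_def\<close>)
  ultimately show ?thesis by (simp add: set_integrable_def)
qed

lemma set_integral_support:
  fixes g :: "real \<Rightarrow> 'a::euclidean_space"
  assumes "\<And>x. b < x \<Longrightarrow> g x = 0"
  shows "(LINT x:{0<..b}|half_line. g x) = (LINT x|half_line. g x)"
  unfolding set_lebesgue_integral_def
  by (rule Bochner_Integration.integral_cong[OF refl]) (use assms in \<open>auto simp: space_half_line indicator_def\<close>)

lemma L2_primitive_compact_support:
  fixes f f' :: "real \<Rightarrow> 'a::euclidean_space"
  assumes d: "\<And>x. (f has_vector_derivative f' x) (at x)" and c: "continuous_on UNIV f'"
    and s: "\<And>x. b < x \<Longrightarrow> f' x = 0" and 0: "f 0 = 0"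
  shows "L2_primitive f f'"
  unfolding L2_primitive_def
proof (intro conjI allI impI)
  have c': "continuous_on S f'" for S using c continuous_on_subset by blast
  show "f' \<in> borel_measurable half_line"
    by (rule borel_measurable_half_line[OF borel_measurable_continuous_onI[OF c]])
  show "integrable half_line (\<lambda>x. (norm (f' x))\<^sup>2)"
    by (rule compact_support_integrable[of b]) (auto intro!: continuous_intros c' simp: s)
  show "f x = (LINT t:{0<..x}|half_line. f' t)" if "0 \<le> x" for x
    using FTC_half_line[OF order_refl that c' has_vector_derivative_at_within[OF d]] 0 by simp
qed

lemma integral_lebesgue_on_Ioc:
  fixes f :: "real \<Rightarrow> real"
  assumes "0 \<le> a"
  shows "(LINT x|lebesgue_on {a<..b}. f x) = (LINT x:{a<..b}|half_line. f x)"
proof -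
  have "{a<..b} \<subseteq> {0<..}" using assms by auto
  moreover have "(LINT x|lebesgue_on {a<..b}. f x) = (LINT x:{a<..b}|lebesgue. f x)"
    unfolding set_lebesgue_integral_def by (rule integral_restrict_space) simp
  ultimately show ?thesis by (simp add: set_integral_half_line)
qed

lemma integrable_lebesgue_on_Ioc:
  fixes f :: "real \<Rightarrow> real"
  assumes "0 \<le> a" "integrable half_line f"
  shows "integrable (lebesgue_on {a<..b}) f"
proof -
  have "{a<..b} \<subseteq> {0<..}" using assms by auto
  moreover have "set_integrable half_line {a<..b} f"
    by (rule set_integrable_from_integrable[OF assms(2) Ioc_in_half_line[OF assms(1)]])
  ultimately have "set_integrable lebesgue {a<..b} f" by (simp add: set_integrable_half_line)
  then show ?thesis unfolding set_integrable_def by (subst integrable_restrict_space) auto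
qed

lemma measurable_lebesgue_on_Ioc:
  "0 \<le> a \<Longrightarrow> f \<in> borel_measurable half_line \<Longrightarrow> f \<in> borel_measurable (lebesgue_on {a<..b})"
  by (rule measurable_restrict_mono) auto

text \<open>For \<open>f\<close> close to \<open>w\<close>, orthogonality reduces the integral of
  \<open>w\<^sup>2\<close> to that of \<open>(w - f) * w\<close>, which Cauchy-Schwarz makes small.
  The intervals keep away from \<open>0\<close>, where the test functions must vanish, and they
  exhaust the half-line.\<close>

lemma orthogonal_test_functions_zero:
  fixes w :: "real \<Rightarrow> real"
  assumes w: "w \<in> borel_measurable half_line" "integrable half_line (\<lambda>x. (w x)\<^sup>2)"
    and orth: "\<And>f a b. smooth_real f \<Longrightarrow> 0 < a \<Longrightarrow> (\<And>x. x \<notin> {a<..<b} \<Longrightarrow> f x = 0) \<Longrightarrow>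
      (LINT x|half_line. w x * f x) = 0"
  shows "AE x in half_line. w x = 0"
proof -
  have loc: "AE x in lebesgue_on {a<..b}. w x = 0" if a: "0 < a" for a b
  proof -
    let ?M = "lebesgue_on {a<..b}"
    have a0: "0 \<le> a" using a by simp
    have wm[measurable]: "w \<in> borel_measurable ?M" by (rule measurable_lebesgue_on_Ioc[OF a0 w(1)])
    have wi: "integrable ?M (\<lambda>x. (w x)\<^sup>2)" by (rule integrable_lebesgue_on_Ioc[OF a0 w(2)])
    define A where "A = (LINT x|?M. (w x)\<^sup>2)"
    have A0: "0 \<le> A" by (simp add: A_def)
    have "A \<le> 0"
    proof (rule field_le_epsilon)
      fix e :: real assume e: "0 < e"
      obtain f where f: "smooth_real f" "\<And>x. x \<notin> {a<..<b} \<Longrightarrow> f x = 0" "(LINT x|?M. (w x - f x)\<^sup>2) < e"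
        using approximable_L2[OF wm wi] e unfolding approximable_def by blast
      have fc: "continuous_on UNIV f" by (rule smooth_real_continuous[OF f(1)])
      have fm[measurable]: "f \<in> borel_measurable ?M" by (rule continuous_Ioc_measurable[OF fc])
      have fi: "integrable ?M (\<lambda>x. (f x)\<^sup>2)" by (rule continuous_Ioc_L2[OF fc])
      have di: "integrable ?M (\<lambda>x. (w x - f x)\<^sup>2)"
        using L2_lincomb_integrable[OF wm fm wi fi, of 1 "-1"] by simp
      have wf: "integrable ?M (\<lambda>x. w x * f x)" by (rule L2_mult_integrable[OF wm fm wi fi])
      have "(LINT x|?M. w x * f x) = (LINT x|half_line. w x * f x)"
        unfolding integral_lebesgue_on_Ioc[OF a0] set_lebesgue_integral_def
      proof (rule Bochner_Integration.integral_cong[OF refl])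
        fix x
        show "indicat_real {a<..b} x *\<^sub>R (w x * f x) = w x * f x"
          using f(2)[of x] by (cases "x \<in> {a<..b}") auto
      qed
      then have z: "(LINT x|?M. w x * f x) = 0" using orth[OF f(1) a f(2)] by simp
      have "A = (LINT x|?M. (w x - f x) * w x + w x * f x)"
        unfolding A_def by (simp add: power2_eq_square algebra_simps)
      also have "\<dots> = (LINT x|?M. (w x - f x) * w x)"
        using wf z L2_mult_integrable[OF _ wm di wi] by simp
      finally have "A\<^sup>2 \<le> (LINT x|?M. (w x - f x)\<^sup>2) * A"
        using integral_Cauchy_Schwarz[OF _ wm di wi] by (simp add: A_def)
      also have "\<dots> \<le> e * A" using f(3) A0 by (intro mult_right_mono) auto
      finally show "A \<le> 0 + e" using A0 e by (cases "A = 0") (auto simp: power2_eq_square)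
    qed
    then have "A = 0" using A0 by simp
    then have "(LINT x|?M. (w x)\<^sup>2) = 0" by (simp only: A_def)
    then have "AE x in ?M. (w x)\<^sup>2 = 0" using integral_nonneg_eq_0_iff_AE[OF wi] by simp
    then show ?thesis by simp
  qed
  have "AE x in lebesgue. x \<in> {1 / real (Suc n)<..real n} \<longrightarrow> w x = 0" for n
  proof -
    have "AE x in lebesgue_on {1 / real (Suc n)<..real n}. w x = 0" by (rule loc) simp
    then show ?thesis by (subst (asm) AE_restrict_space_iff) auto
  qed
  then have "AE x in lebesgue. \<forall>n. x \<in> {1 / real (Suc n)<..real n} \<longrightarrow> w x = 0"
    unfolding AE_all_countable by (intro allI)
  then have "AE x in lebesgue. x \<in> {0<..} \<longrightarrow> w x = 0"
  proof eventually_elim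
    case (elim x)
    show ?case
    proof
      assume x: "x \<in> {0<..}"
      have "(\<lambda>n. 1 / real (Suc n)) \<longlonglongrightarrow> 0" by (rule LIMSEQ_Suc[OF lim_1_over_n])
      then have "\<forall>\<^sub>F n in sequentially. 1 / real (Suc n) < x" using x by (intro order_tendstoD) auto
      moreover have "\<forall>\<^sub>F n in sequentially. x \<le> real n"
        using filterlim_at_top[THEN iffD1, OF filterlim_real_sequentially] by blast
      ultimately have "\<forall>\<^sub>F n in sequentially. 1 / real (Suc n) < x \<and> x \<le> real n" by (rule eventually_conj)
      then obtain n where "1 / real (Suc n) < x" "x \<le> real n" by (auto simp: eventually_sequentially)
      then show "w x = 0" using elim by auto
    qed
  qed
  then show ?thesis by (subst AE_restrict_space_iff) auto
qed

lemma smooth_test_function: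
  assumes f: "smooth_real f" "\<And>x. x \<notin> {a<..<b} \<Longrightarrow> f x = 0" and a: "0 < a"
  shows "(\<lambda>x. complex_of_real (f x)) \<in> test_functions"
proof -
  obtain D where D: "D 0 = f" "\<And>n x. (D n has_real_derivative D (Suc n) x) (at x)"
    using f(1) by (auto simp: smooth_real_def)
  have "((\<lambda>x. complex_of_real (D n x)) has_vector_derivative complex_of_real (D (Suc n) x)) (at x)" for n x
    by (intro has_vector_derivative_of_real) (use D(2) has_real_derivative_iff_has_vector_derivative in blast)
  then have "\<exists>E. E 0 = (\<lambda>x. complex_of_real (f x)) \<and> (\<forall>n x. (E n has_vector_derivative E (Suc n) x) (at x))"
    by (intro exI[of _ "\<lambda>n x. complex_of_real (D n x)"]) (simp add: D(1))
  moreover have cl: "closure {x. complex_of_real (f x) \<noteq> 0} \<subseteq> {a..b}"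
  proof (rule closure_minimal)
    show "{x. complex_of_real (f x) \<noteq> 0} \<subseteq> {a..b}"
    proof
      fix x assume "x \<in> {x. complex_of_real (f x) \<noteq> 0}"
      then show "x \<in> {a..b}" using f(2)[of x] by force
    qed
  qed simp
  moreover have "compact (closure {x. complex_of_real (f x) \<noteq> 0})"
    by (rule compact_Int_closed[of "{a..b}" "closure {x. complex_of_real (f x) \<noteq> 0}", simplified Int_absorb1[OF cl]]) auto
  ultimately show ?thesis using a unfolding test_functions_def by fastforce
qed

lemma has_vector_derivative_zero_outside:
  fixes f :: "real \<Rightarrow> 'a::real_normed_vector"
  assumes "closed K" "\<And>x. x \<notin> K \<Longrightarrow> f x = 0" "(f has_vector_derivative f') (at x)" "x \<notin> K"
  shows "f' = 0"
proof -
  have "(f has_vector_derivative 0) (at x)"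
  proof (rule has_vector_derivative_transform_within_open[of "\<lambda>_. 0"])
    show "((\<lambda>_. 0) has_vector_derivative 0) (at x)" by simp
    show "open (- K)" using assms(1) by (rule open_Compl)
  qed (use assms in auto)
  then show ?thesis using assms(3) vector_derivative_unique_at by blast
qed

lemma test_functionE:
  assumes "\<phi> \<in> test_functions"
  obtains \<phi>' b where "\<And>x. (\<phi> has_vector_derivative \<phi>' x) (at x)" "continuous_on UNIV \<phi>'"
    "\<And>x. b < x \<Longrightarrow> \<phi> x = 0" "\<And>x. b < x \<Longrightarrow> \<phi>' x = 0" "\<phi> 0 = 0"
proof -
  obtain D where D: "D 0 = \<phi>" "\<And>n x. (D n has_vector_derivative D (Suc n) x) (at x)"
    and K: "compact (closure {x. \<phi> x \<noteq> 0})" "closure {x. \<phi> x \<noteq> 0} \<subseteq> {0<..}"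
    using assms by (auto simp: test_functions_def)
  obtain b where b: "\<And>x. x \<in> closure {x. \<phi> x \<noteq> 0} \<Longrightarrow> norm x \<le> b"
    using compact_imp_bounded[OF K(1)] by (auto simp: bounded_iff)
  have z: "\<phi> x = 0" if "x \<notin> closure {x. \<phi> x \<noteq> 0}" for x
    using that closure_subset[of "{x. \<phi> x \<noteq> 0}"] by auto
  have d: "(\<phi> has_vector_derivative D 1 x) (at x)" for x using D(2)[of 0 x] D(1) by simp
  have nb: "x \<notin> closure {x. \<phi> x \<noteq> 0}" if "b < x" for x using b[of x] that by force
  show ?thesis
  proof (rule that[of "D 1" b])
    show "(\<phi> has_vector_derivative D 1 x) (at x)" for x by (rule d)
    show "continuous_on UNIV (D 1)"
      using D(2)[of 1] by (meson continuous_at_imp_continuous_on has_vector_derivative_continuous)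
    show "\<phi> x = 0" if "b < x" for x by (rule z[OF nb[OF that]])
    show "D 1 x = 0" if "b < x" for x
      by (rule has_vector_derivative_zero_outside[OF closed_closure z d nb[OF that]])
    show "\<phi> 0 = 0" by (rule z) (use K(2) in auto)
  qed
qed

lemma L2_mult_integrable_complex:
  fixes f g :: "'a \<Rightarrow> complex"
  assumes [measurable]: "f \<in> borel_measurable M" "g \<in> borel_measurable M"
    and f: "integrable M (\<lambda>x. (norm (f x))\<^sup>2)" and g: "integrable M (\<lambda>x. (norm (g x))\<^sup>2)"
  shows "integrable M (\<lambda>x. f x * g x)"
proof (rule Bochner_Integration.integrable_bound)
  show "integrable M (\<lambda>x. norm (f x) * norm (g x))"
    by (rule L2_mult_integrable[OF _ _ f g]) measurable
  show "(\<lambda>x. f x * g x) \<in> borel_measurable M" by measurable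
qed (simp add: norm_mult)

lemma L2_diff_integrable_complex:
  fixes f g :: "'a \<Rightarrow> complex"
  assumes [measurable]: "f \<in> borel_measurable M" "g \<in> borel_measurable M"
    and f: "integrable M (\<lambda>x. (norm (f x))\<^sup>2)" and g: "integrable M (\<lambda>x. (norm (g x))\<^sup>2)"
  shows "integrable M (\<lambda>x. (norm (f x - g x))\<^sup>2)"
proof (rule Bochner_Integration.integrable_bound)
  show "integrable M (\<lambda>x. (1 * norm (f x) + 1 * norm (g x))\<^sup>2)"
    by (rule L2_lincomb_integrable[OF _ _ f g]) measurable
  show "(\<lambda>x. (norm (f x - g x))\<^sup>2) \<in> borel_measurable M" by measurable
  show "AE x in M. norm ((norm (f x - g x))\<^sup>2) \<le> norm ((1 * norm (f x) + 1 * norm (g x))\<^sup>2)"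
    by (rule AE_I2) (auto intro!: power_mono norm_triangle_ineq4)
qed

lemma Re_Im_sq_le: "norm ((Re z)\<^sup>2) \<le> norm ((norm z)\<^sup>2)" "norm ((Im z)\<^sup>2) \<le> norm ((norm z)\<^sup>2)"
  by (simp_all add: cmod_power2)

lemma L2_primitive_Re_Im:
  fixes u v :: "real \<Rightarrow> complex"
  assumes uv: "L2_primitive u v"
  shows "L2_primitive (\<lambda>x. Re (u x)) (\<lambda>x. Re (v x))" "L2_primitive (\<lambda>x. Im (u x)) (\<lambda>x. Im (v x))"
proof -
  note D = L2_primitiveD[OF uv]
  have [measurable]: "v \<in> borel_measurable half_line" by (rule D)
  have i: "integrable half_line (\<lambda>t. indicat_real {0<..x} t *\<^sub>R v t)" for x
    using L2_primitive_set_integrable[OF uv, of 0 x] by (simp add: set_integrable_def)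
  show "L2_primitive (\<lambda>x. Re (u x)) (\<lambda>x. Re (v x))"
    unfolding L2_primitive_def
  proof (intro conjI allI impI)
    have "integrable half_line (\<lambda>x. (Re (v x))\<^sup>2)"
      by (rule Bochner_Integration.integrable_bound[OF D(2)], measurable) (intro AE_I2 Re_Im_sq_le)
    then show "integrable half_line (\<lambda>x. (norm (Re (v x)))\<^sup>2)" by simp
    show "Re (u x) = (LINT t:{0<..x}|half_line. Re (v t))" if "0 \<le> x" for x
      using integral_Re[OF i[of x]] D(3)[OF that] by (simp add: set_lebesgue_integral_def)
  qed measurable
  show "L2_primitive (\<lambda>x. Im (u x)) (\<lambda>x. Im (v x))"
    unfolding L2_primitive_def
  proof (intro conjI allI impI)
    have "integrable half_line (\<lambda>x. (Im (v x))\<^sup>2)"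
      by (rule Bochner_Integration.integrable_bound[OF D(2)], measurable) (intro AE_I2 Re_Im_sq_le)
    then show "integrable half_line (\<lambda>x. (norm (Im (v x)))\<^sup>2)" by simp
    show "Im (u x) = (LINT t:{0<..x}|half_line. Im (v t))" if "0 \<le> x" for x
      using integral_Im[OF i[of x]] D(3)[OF that] by (simp add: set_lebesgue_integral_def)
  qed measurable
qed

lemma integration_by_parts_half_line:
  fixes s s' r r' :: "real \<Rightarrow> real"
  assumes s: "L2_primitive s s'" and r: "L2_primitive r r'" and b: "0 \<le> b"
    and z: "\<And>x. b \<le> x \<Longrightarrow> r x = 0" "\<And>x. b < x \<Longrightarrow> r' x = 0"
  shows "integrable half_line (\<lambda>x. s x * r' x + r x * s' x)"
    and "(LINT x|half_line. s x * r' x + r x * s' x) = 0"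
proof -
  have eq: "indicat_real {0<..b} x *\<^sub>R (s x * r' x + r x * s' x) = s x * r' x + r x * s' x"
    if "x \<in> space half_line" for x
    using z[of x] that by (auto simp: indicator_def space_half_line)
  note P = product_rule_indefinite_integral[OF order_refl b L2_primitive_set_integrable[OF s order_refl] L2_primitive_set_integrable[OF r order_refl]
      L2_primitive_diff[OF s] L2_primitive_diff[OF r] L2_primitive_continuous_Icc[OF s order_refl] L2_primitive_continuous_Icc[OF r order_refl]]
  show "integrable half_line (\<lambda>x. s x * r' x + r x * s' x)"
    using P(1) unfolding set_integrable_def
    by (rule Bochner_Integration.integrable_cong[OF refl eq, THEN iffD1, rotated])
  have "(LINT x|half_line. s x * r' x + r x * s' x) = (LINT x:{0<..b}|half_line. s x * r' x + r x * s' x)"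
    unfolding set_lebesgue_integral_def by (rule Bochner_Integration.integral_cong[OF refl]) (rule eq[symmetric])
  also have "\<dots> = s b * r b - s 0 * r 0" by (rule P(2)[symmetric])
  finally show "(LINT x|half_line. s x * r' x + r x * s' x) = 0"
    using z(1)[of b] L2_primitive_0[OF s] by simp
qed

lemma L2_primitive_weak_derivative:
  fixes u v :: "real \<Rightarrow> complex"
  assumes uv: "L2_primitive u v"
  shows "is_weak_derivative u v"
  unfolding is_weak_derivative_def
proof
  fix \<phi> assume "\<phi> \<in> test_functions"
  then obtain \<phi>' b0 where \<phi>: "\<And>x. (\<phi> has_vector_derivative \<phi>' x) (at x)" "continuous_on UNIV \<phi>'"
    "\<And>x. b0 < x \<Longrightarrow> \<phi> x = 0" "\<And>x. b0 < x \<Longrightarrow> \<phi>' x = 0" "\<phi> 0 = 0" by (rule test_functionE) blast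
  define b where "b = max 0 b0 + 1"
  have b: "0 \<le> b" "b0 < b" by (auto simp: b_def)
  have z: "\<phi> x = 0" "\<phi>' x = 0" if "b \<le> x" for x using \<phi>(3,4)[of x] b that by auto
  have P: "L2_primitive \<phi> \<phi>'" by (rule L2_primitive_compact_support[OF \<phi>(1,2,4,5)])
  have \<phi>c: "continuous_on S \<phi>" for S
    using \<phi>(1) by (meson continuous_at_imp_continuous_on has_vector_derivative_continuous)
  note D = L2_primitiveD[OF uv]
  have i1: "integrable half_line (\<lambda>x. u x * \<phi>' x)"
    by (rule compact_support_integrable[of b])
      (use L2_primitive_continuous_Icc[OF uv, of 0 b] continuous_on_subset[OF \<phi>(2)] z in \<open>auto intro!: continuous_intros\<close>)
  have i2: "integrable half_line (\<lambda>x. v x * \<phi> x)"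
  proof (rule L2_mult_integrable_complex[OF D(1) _ D(2)])
    show "\<phi> \<in> borel_measurable half_line" by (rule L2_primitive_measurable[OF P])
    show "integrable half_line (\<lambda>x. (norm (\<phi> x))\<^sup>2)"
      by (rule compact_support_integrable[of b]) (use z in \<open>auto intro!: continuous_intros \<phi>c\<close>)
  qed
  \<comment> \<open>The real product rule is applied to the four combinations of real and imaginary
    parts, which recombine into the two parts of
    \<open>u x * \<phi>' x + v x * \<phi> x\<close>.\<close>
  note U = L2_primitive_Re_Im[OF uv] and F = L2_primitive_Re_Im[OF P]
  have IBP: "integrable half_line (\<lambda>x. s x * r' x + r x * s' x)" "(LINT x|half_line. s x * r' x + r x * s' x) = 0"
    if "L2_primitive s s'" "L2_primitive r r'" "\<And>x. b \<le> x \<Longrightarrow> r x = 0" "\<And>x. b \<le> x \<Longrightarrow> r' x = 0" for s s' r r' :: "real \<Rightarrow> real"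
    using integration_by_parts_half_line[OF that(1,2) b(1) that(3)] that(4) by auto
  note RR = IBP[OF U(1) F(1)] and RI = IBP[OF U(1) F(2)] and IR = IBP[OF U(2) F(1)] and II = IBP[OF U(2) F(2)]
  have ii: "integrable half_line (\<lambda>x. u x * \<phi>' x + v x * \<phi> x)" using i1 i2 by simp
  have "Re (LINT x|half_line. u x * \<phi>' x + v x * \<phi> x) = (LINT x|half_line. Re (u x * \<phi>' x + v x * \<phi> x))"
    by (rule integral_Re[OF ii, symmetric])
  also have "\<dots> = (LINT x|half_line. (Re (u x) * Re (\<phi>' x) + Re (\<phi> x) * Re (v x)) - (Im (u x) * Im (\<phi>' x) + Im (\<phi> x) * Im (v x)))"
    by (simp add: algebra_simps)
  also have "\<dots> = 0" using RR II z by simp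
  finally have 1: "Re (LINT x|half_line. u x * \<phi>' x + v x * \<phi> x) = 0" .
  have "Im (LINT x|half_line. u x * \<phi>' x + v x * \<phi> x) = (LINT x|half_line. Im (u x * \<phi>' x + v x * \<phi> x))"
    by (rule integral_Im[OF ii, symmetric])
  also have "\<dots> = (LINT x|half_line. (Re (u x) * Im (\<phi>' x) + Im (\<phi> x) * Re (v x)) + (Im (u x) * Re (\<phi>' x) + Re (\<phi> x) * Im (v x)))"
    by (simp add: algebra_simps)
  also have "\<dots> = 0" using RI IR z by simp
  finally have 2: "Im (LINT x|half_line. u x * \<phi>' x + v x * \<phi> x) = 0" .
  have "(LINT x|half_line. u x * \<phi>' x + v x * \<phi> x) = 0" using 1 2 by (simp add: complex_eq_iff)
  then have "(LINT x|half_line. u x * \<phi>' x) = - (LINT x|half_line. v x * \<phi> x)"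
    using i1 i2 by (simp add: add_eq_0_iff2)
  moreover have "vector_derivative \<phi> (at x) = \<phi>' x" for x by (rule vector_derivative_at[OF \<phi>(1)])
  ultimately show "(LINT x|half_line. u x * vector_derivative \<phi> (at x)) = - (LINT x|half_line. v x * \<phi> x)" by simp
qed

section \<open>The function spaces of the statement and the chosen weak derivative\<close>

lemma norm_powr_2: "norm z powr 2 = (norm z)\<^sup>2"
  by (cases "norm z = 0") simp_all

lemma Lp_space_2: "u \<in> Lp_space 2 \<longleftrightarrow> u \<in> borel_measurable half_line \<and> integrable half_line (\<lambda>x. (norm (u x))\<^sup>2)"
  by (simp add: Lp_space_def norm_powr_2)

lemma Lp_norm_powr: "q \<noteq> 0 \<Longrightarrow> Lp_norm q u powr q = (LINT x|half_line. norm (u x) powr q)"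
  by (simp add: Lp_norm_def powr_powr)

lemma Lp_norm_2_sq: "(Lp_norm 2 u)\<^sup>2 = (LINT x|half_line. (norm (u x))\<^sup>2)"
proof -
  have "0 \<le> (LINT x|half_line. (norm (u x))\<^sup>2)" by simp
  then show ?thesis unfolding Lp_norm_def norm_powr_2 by (simp add: powr_half_sqrt)
qed

lemma H1_norm_eq: "H1_norm u = sqrt ((LINT x|half_line. (norm (u x))\<^sup>2) + (LINT x|half_line. (norm (weak_deriv u x))\<^sup>2))"
  by (simp add: H1_norm_def Lp_norm_2_sq)

text \<open>Real and imaginary part of the difference are each orthogonal to all real smooth
  functions supported away from the origin, which reduces the claim to the real fundamental
  lemma.\<close>

lemma weak_derivative_unique:
  assumes v: "v1 \<in> Lp_space 2" "v2 \<in> Lp_space 2" "is_weak_derivative u v1" "is_weak_derivative u v2"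
  shows "AE x in half_line. v1 x = v2 x"
proof -
  have m[measurable]: "v1 \<in> borel_measurable half_line" "v2 \<in> borel_measurable half_line"
    and i: "integrable half_line (\<lambda>x. (norm (v1 x))\<^sup>2)" "integrable half_line (\<lambda>x. (norm (v2 x))\<^sup>2)"
    using v by (auto simp: Lp_space_2)
  have di: "integrable half_line (\<lambda>x. (norm (v1 x - v2 x))\<^sup>2)" by (rule L2_diff_integrable_complex[OF m i])
  have orth: "integrable half_line (\<lambda>x. (v1 x - v2 x) * of_real (f x))" "(LINT x|half_line. (v1 x - v2 x) * of_real (f x)) = 0"
    if f: "smooth_real f" "0 < a" "\<And>x. x \<notin> {a<..<b} \<Longrightarrow> f x = 0" for f a b
  proof -
    have t: "(\<lambda>x. complex_of_real (f x)) \<in> test_functions" by (rule smooth_test_function[OF f(1,3,2)])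
    have c: "continuous_on UNIV (\<lambda>x. complex_of_real (f x))" by (intro continuous_intros smooth_real_continuous f)
    have fm: "(\<lambda>x. complex_of_real (f x)) \<in> borel_measurable half_line"
      by (rule borel_measurable_half_line[OF borel_measurable_continuous_onI[OF c]])
    have fi: "integrable half_line (\<lambda>x. (norm (complex_of_real (f x)))\<^sup>2)"
      by (rule compact_support_integrable[of b]) (auto intro!: continuous_intros smooth_real_continuous[OF f(1)] simp: f(3))
    have p: "integrable half_line (\<lambda>x. v1 x * of_real (f x))" "integrable half_line (\<lambda>x. v2 x * of_real (f x))"
      by (rule L2_mult_integrable_complex[OF _ fm _ fi]; fact)+
    then show "integrable half_line (\<lambda>x. (v1 x - v2 x) * of_real (f x))" by (simp add: left_diff_distrib)
    have "(LINT x|half_line. v1 x * of_real (f x)) = (LINT x|half_line. v2 x * of_real (f x))"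
      using v(3,4) t unfolding is_weak_derivative_def by (metis neg_equal_iff_equal)
    then show "(LINT x|half_line. (v1 x - v2 x) * of_real (f x)) = 0" using p by (simp add: left_diff_distrib)
  qed
  have "AE x in half_line. Re (v1 x - v2 x) = 0"
  proof (rule orthogonal_test_functions_zero)
    show "integrable half_line (\<lambda>x. (Re (v1 x - v2 x))\<^sup>2)"
      by (rule Bochner_Integration.integrable_bound[OF di], measurable) (intro AE_I2 Re_Im_sq_le)
    fix f a b assume f: "smooth_real f" "0 < a" "\<And>x. x \<notin> {a<..<b} \<Longrightarrow> f x = 0"
    have "(LINT x|half_line. Re (v1 x - v2 x) * f x) = (LINT x|half_line. Re ((v1 x - v2 x) * of_real (f x)))" by simp
    also have "\<dots> = Re (LINT x|half_line. (v1 x - v2 x) * of_real (f x))"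
      by (rule integral_Re[OF orth(1)[OF f]])
    also have "\<dots> = 0" using orth(2)[OF f] by simp
    finally show "(LINT x|half_line. Re (v1 x - v2 x) * f x) = 0" .
  qed measurable
  moreover have "AE x in half_line. Im (v1 x - v2 x) = 0"
  proof (rule orthogonal_test_functions_zero)
    show "integrable half_line (\<lambda>x. (Im (v1 x - v2 x))\<^sup>2)"
      by (rule Bochner_Integration.integrable_bound[OF di], measurable) (intro AE_I2 Re_Im_sq_le)
    fix f a b assume f: "smooth_real f" "0 < a" "\<And>x. x \<notin> {a<..<b} \<Longrightarrow> f x = 0"
    have "(LINT x|half_line. Im (v1 x - v2 x) * f x) = (LINT x|half_line. Im ((v1 x - v2 x) * of_real (f x)))" by simp
    also have "\<dots> = Im (LINT x|half_line. (v1 x - v2 x) * of_real (f x))"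
      by (rule integral_Im[OF orth(1)[OF f]])
    also have "\<dots> = 0" using orth(2)[OF f] by simp
    finally show "(LINT x|half_line. Im (v1 x - v2 x) * f x) = 0" .
  qed measurable
  ultimately show ?thesis by eventually_elim (simp add: complex_eq_iff)
qed

lemma weak_deriv_spec:
  assumes "u \<in> H1" shows "weak_deriv u \<in> Lp_space 2" "is_weak_derivative u (weak_deriv u)"
proof -
  have "\<exists>v. v \<in> Lp_space 2 \<and> is_weak_derivative u v" using assms by (auto simp: H1_def)
  then have "weak_deriv u \<in> Lp_space 2 \<and> is_weak_derivative u (weak_deriv u)"
    unfolding weak_deriv_def by (rule someI_ex)
  then show "weak_deriv u \<in> Lp_space 2" "is_weak_derivative u (weak_deriv u)" by auto
qed

lemma weak_deriv_AE:
  assumes "v \<in> Lp_space 2" "is_weak_derivative u v"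
  shows "AE x in half_line. weak_deriv u x = v x"
proof -
  have "weak_deriv u \<in> Lp_space 2 \<and> is_weak_derivative u (weak_deriv u)"
    unfolding weak_deriv_def by (rule someI[of _ v]) (use assms in simp)
  then show ?thesis using weak_derivative_unique[OF _ assms(1) _ assms(2)] by blast
qed

lemma is_weak_derivative_diff:
  assumes u: "u \<in> Lp_space 2" "v \<in> Lp_space 2" "is_weak_derivative u v"
    and w: "w \<in> Lp_space 2" "z \<in> Lp_space 2" "is_weak_derivative w z"
  shows "is_weak_derivative (\<lambda>x. u x - w x) (\<lambda>x. v x - z x)"
  unfolding is_weak_derivative_def
proof
  fix \<phi> assume t: "\<phi> \<in> test_functions"
  then obtain \<phi>' b where \<phi>: "\<And>x. (\<phi> has_vector_derivative \<phi>' x) (at x)" "continuous_on UNIV \<phi>'"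
    "\<And>x. b < x \<Longrightarrow> \<phi> x = 0" "\<And>x. b < x \<Longrightarrow> \<phi>' x = 0" "\<phi> 0 = 0" by (rule test_functionE) blast
  have \<phi>c: "continuous_on S \<phi>" "continuous_on S \<phi>'" for S
    using \<phi>(1) continuous_on_subset[OF \<phi>(2)]
    by (meson continuous_at_imp_continuous_on has_vector_derivative_continuous subset_UNIV)+
  have vd: "vector_derivative \<phi> (at x) = \<phi>' x" for x by (rule vector_derivative_at[OF \<phi>(1)])
  have L2: "f \<in> borel_measurable half_line" "integrable half_line (\<lambda>x. (norm (f x))\<^sup>2)"
    if "f = \<phi> \<or> f = \<phi>'" for f
  proof -
    have fc: "continuous_on S f" "\<And>x. b < x \<Longrightarrow> f x = 0" for S using that \<phi>c \<phi>(3,4) by auto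
    show "f \<in> borel_measurable half_line"
      by (rule borel_measurable_half_line[OF borel_measurable_continuous_onI[OF fc(1)]])
    show "integrable half_line (\<lambda>x. (norm (f x))\<^sup>2)"
      by (rule compact_support_integrable[of b]) (auto intro!: continuous_intros fc(1) simp: fc(2))
  qed
  have i: "integrable half_line (\<lambda>x. h x * f x)" if "h \<in> Lp_space 2" "f = \<phi> \<or> f = \<phi>'" for h f
    using L2_mult_integrable_complex[OF _ L2(1)[OF that(2)] _ L2(2)[OF that(2)], of h] that(1) by (simp add: Lp_space_2)
  have "(LINT x|half_line. u x * \<phi>' x) = - (LINT x|half_line. v x * \<phi> x)"
    "(LINT x|half_line. w x * \<phi>' x) = - (LINT x|half_line. z x * \<phi> x)"
    using u(3) w(3) t unfolding is_weak_derivative_def vd[symmetric] by auto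
  then show "(LINT x|half_line. (u x - w x) * vector_derivative \<phi> (at x)) = - (LINT x|half_line. (v x - z x) * \<phi> x)"
    unfolding vd left_diff_distrib using i[OF u(1)] i[OF u(2)] i[OF w(1)] i[OF w(2)] by simp
qed

lemma test_function_L2:
  assumes "\<phi> \<in> test_functions"
  obtains \<phi>' where "L2_primitive \<phi> \<phi>'" "\<phi> \<in> Lp_space 2" "\<phi>' \<in> Lp_space 2"
proof -
  obtain \<phi>' b where \<phi>: "\<And>x. (\<phi> has_vector_derivative \<phi>' x) (at x)" "continuous_on UNIV \<phi>'"
    "\<And>x. b < x \<Longrightarrow> \<phi> x = 0" "\<And>x. b < x \<Longrightarrow> \<phi>' x = 0" "\<phi> 0 = 0" using assms by (rule test_functionE) blast
  have P: "L2_primitive \<phi> \<phi>'" by (rule L2_primitive_compact_support[OF \<phi>(1,2,4,5)])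
  have \<phi>c: "continuous_on S \<phi>" for S
    using \<phi>(1) by (meson continuous_at_imp_continuous_on has_vector_derivative_continuous)
  have "integrable half_line (\<lambda>x. (norm (\<phi> x))\<^sup>2)"
    by (rule compact_support_integrable[of b]) (auto intro!: continuous_intros \<phi>c simp: \<phi>(3))
  then show ?thesis
    using that[OF P] L2_primitive_measurable[OF P] L2_primitiveD(1,2)[OF P] by (simp add: Lp_space_2)
qed

text \<open>Test functions are primitives of their derivatives, and on a bounded interval a
  primitive is controlled by the norm of its derivative. Approximation in \<open>H1_norm\<close>
  therefore identifies \<open>u\<close> with the primitive of \<open>weak_deriv u\<close> there;
  being in the closure of the test functions is what fixes the value \<open>0\<close> at the
  origin.\<close>

lemma H10_primitive:
  assumes u: "u \<in> H10"
  obtains U where "L2_primitive U (weak_deriv u)" "AE x in half_line. u x = U x"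
proof -
  define v where "v = weak_deriv u"
  have uH: "u \<in> H1" and u2: "u \<in> Lp_space 2" using u by (auto simp: H10_def H1_def)
  have v2: "v \<in> Lp_space 2" and wd: "is_weak_derivative u v" using weak_deriv_spec[OF uH] by (auto simp: v_def)
  note [measurable] = u2[unfolded Lp_space_2, THEN conjunct1] v2[unfolded Lp_space_2, THEN conjunct1]
  define U where "U x = (LINT t:{0<..x}|half_line. v t)" for x
  have PU: "L2_primitive U v" using v2 by (simp add: L2_primitive_def U_def Lp_space_2)
  note [measurable] = L2_primitive_measurable[OF PU]
  have close: "\<exists>\<phi> \<phi>'. L2_primitive \<phi> \<phi>' \<and> \<phi> \<in> Lp_space 2 \<and>
     (LINT x|half_line. (norm (u x - \<phi> x))\<^sup>2) + (LINT x|half_line. (norm (v x - \<phi>' x))\<^sup>2) < e\<^sup>2"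
    if e: "0 < e" for e
  proof -
    obtain \<phi> where t: "\<phi> \<in> test_functions" "H1_norm (\<lambda>x. u x - \<phi> x) < e" using u e by (auto simp: H10_def)
    obtain \<phi>' where \<phi>: "L2_primitive \<phi> \<phi>'" "\<phi> \<in> Lp_space 2" "\<phi>' \<in> Lp_space 2" by (rule test_function_L2[OF t(1)])
    have d2: "(\<lambda>x. v x - \<phi>' x) \<in> Lp_space 2"
      using L2_diff_integrable_complex[of v half_line \<phi>'] v2 \<phi>(3) by (auto simp: Lp_space_2)
    \<comment> \<open>The derivative inside \<open>H1_norm\<close> is a separate choice for the
      difference; uniqueness identifies it with \<open>v - \<phi>'\<close> almost
      everywhere.\<close>
    have "is_weak_derivative (\<lambda>x. u x - \<phi> x) (\<lambda>x. v x - \<phi>' x)"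
      by (rule is_weak_derivative_diff[OF u2 v2 wd \<phi>(2,3) L2_primitive_weak_derivative[OF \<phi>(1)]])
    then have ae: "AE x in half_line. weak_deriv (\<lambda>x. u x - \<phi> x) x = v x - \<phi>' x"
      by (rule weak_deriv_AE[OF d2])
    have "weak_deriv (\<lambda>x. u x - \<phi> x) \<in> Lp_space 2"
      unfolding weak_deriv_def by (rule someI2[where a = "\<lambda>x. v x - \<phi>' x"]) (use d2 \<open>is_weak_derivative (\<lambda>x. u x - \<phi> x) (\<lambda>x. v x - \<phi>' x)\<close> in auto)
    then have [measurable]: "weak_deriv (\<lambda>x. u x - \<phi> x) \<in> borel_measurable half_line" "(\<lambda>x. v x - \<phi>' x) \<in> borel_measurable half_line"
      using d2 by (auto simp: Lp_space_2)
    have eq: "(LINT x|half_line. (norm (weak_deriv (\<lambda>x. u x - \<phi> x) x))\<^sup>2) = (LINT x|half_line. (norm (v x - \<phi>' x))\<^sup>2)"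
      by (rule integral_cong_AE) (use ae in \<open>measurable, auto elim: eventually_mono\<close>)
    define I where "I = (LINT x|half_line. (norm (u x - \<phi> x))\<^sup>2) + (LINT x|half_line. (norm (v x - \<phi>' x))\<^sup>2)"
    have "sqrt I < e" using t(2) unfolding H1_norm_eq eq I_def .
    then have "I < e\<^sup>2" by (metis abs_of_pos e real_sqrt_abs real_sqrt_less_iff)
    then show ?thesis using \<phi> unfolding I_def by blast
  qed
  have loc: "AE x in half_line. x \<le> b \<longrightarrow> u x = U x" if b: "0 \<le> b" for b
  proof -
    define f where "f x = indicat_real {0<..b} x * (norm (u x - U x))\<^sup>2" for x
    have I[measurable]: "indicat_real {0<..b} \<in> borel_measurable half_line"
      by (intro borel_measurable_indicator Ioc_in_half_line) simp
    \<comment> \<open>The right side holds for every \<open>e\<close> while \<open>f\<close> does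
      not depend on it, so the integral of \<open>f\<close> will be zero.\<close>
    have bound: "integrable half_line f \<and> (LINT x|half_line. f x) \<le> 2 * e\<^sup>2 + 2 * b\<^sup>2 * e\<^sup>2" if e: "0 < e" for e
    proof -
      obtain \<phi> \<phi>' where \<phi>: "L2_primitive \<phi> \<phi>'" "\<phi> \<in> Lp_space 2"
        "(LINT x|half_line. (norm (u x - \<phi> x))\<^sup>2) + (LINT x|half_line. (norm (v x - \<phi>' x))\<^sup>2) < e\<^sup>2"
        using close[OF e] by blast
      have D: "integrable half_line (\<lambda>x. (norm (u x - \<phi> x))\<^sup>2)" "integrable half_line (\<lambda>x. (norm (v x - \<phi>' x))\<^sup>2)"
        using L2_diff_integrable_complex[of u half_line \<phi>] L2_diff_integrable_complex[of v half_line \<phi>']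
          u2 v2 \<phi>(2) L2_primitiveD(1,2)[OF \<phi>(1)] by (auto simp: Lp_space_2)
      define E where "E = (LINT x|half_line. (norm (v x - \<phi>' x))\<^sup>2)"
      have E0: "0 \<le> E" "0 \<le> (LINT x|half_line. (norm (u x - \<phi> x))\<^sup>2)" by (simp_all add: E_def)
      have PD: "L2_primitive (\<lambda>x. U x - \<phi> x) (\<lambda>x. v x - \<phi>' x)"
        unfolding L2_primitive_def
      proof (intro conjI allI impI D(2))
        show "(\<lambda>x. v x - \<phi>' x) \<in> borel_measurable half_line" using L2_primitiveD(1)[OF \<phi>(1)] by measurable
        show "U x - \<phi> x = (LINT t:{0<..x}|half_line. v t - \<phi>' t)" if "0 \<le> x" for x
          using L2_primitiveD(3)[OF PU that] L2_primitiveD(3)[OF \<phi>(1) that]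
            set_integral_diff(2)[OF L2_primitive_set_integrable[OF PU order_refl] L2_primitive_set_integrable[OF \<phi>(1) order_refl], of x] by simp
      qed
      have pt: "(norm (U x - \<phi> x))\<^sup>2 \<le> b * E" if "0 < x" "x \<le> b" for x
      proof -
        have "norm (U x - \<phi> x - (U 0 - \<phi> 0)) \<le> sqrt \<bar>x - 0\<bar> * sqrt E"
          unfolding E_def by (rule L2_primitive_Holder'[OF PD]) (use that in auto)
        then have "norm (U x - \<phi> x) \<le> sqrt (x * E)"
          using L2_primitive_0[OF PD] that by (simp add: real_sqrt_mult)
        then have "(norm (U x - \<phi> x))\<^sup>2 \<le> (sqrt (x * E))\<^sup>2" by (intro power_mono) auto
        also have "\<dots> = x * E" using that E0 by simp
        also have "\<dots> \<le> b * E" using that E0 by (intro mult_right_mono) auto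
        finally show ?thesis .
      qed
      have fle: "f x \<le> 2 * (norm (u x - \<phi> x))\<^sup>2 + 2 * (b * E) * indicat_real {0<..b} x" for x
      proof (cases "x \<in> {0<..b}")
        case True
        have "norm (u x - U x) \<le> norm (u x - \<phi> x) + norm (U x - \<phi> x)"
          by (metis diff_diff_eq2 diff_add_cancel norm_triangle_ineq4 add_diff_eq diff_add_eq)
        then have "(norm (u x - U x))\<^sup>2 \<le> (norm (u x - \<phi> x) + norm (U x - \<phi> x))\<^sup>2" by (intro power_mono) auto
        also have "\<dots> \<le> 2 * (norm (u x - \<phi> x))\<^sup>2 + 2 * (norm (U x - \<phi> x))\<^sup>2"
          using sum_squares_bound[of "norm (u x - \<phi> x)" "norm (U x - \<phi> x)"] by (simp add: power2_sum)
        finally show ?thesis using pt[of x] True by (simp add: f_def)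
      qed (simp add: f_def)
      have gi: "integrable half_line (\<lambda>x. 2 * (norm (u x - \<phi> x))\<^sup>2 + 2 * (b * E) * indicat_real {0<..b} x)"
        using D(1) integrable_indicator_Ioc[of 0 b] by simp
      have fi: "integrable half_line f"
      proof (rule Bochner_Integration.integrable_bound[OF gi])
        show "f \<in> borel_measurable half_line" unfolding f_def by measurable
        show "AE x in half_line. norm (f x) \<le> norm (2 * (norm (u x - \<phi> x))\<^sup>2 + 2 * (b * E) * indicat_real {0<..b} x)"
          by (rule AE_I2) (use fle in \<open>simp add: f_def order_trans[OF _ abs_ge_self]\<close>)
      qed
      have "(LINT x|half_line. f x) \<le> (LINT x|half_line. 2 * (norm (u x - \<phi> x))\<^sup>2 + 2 * (b * E) * indicat_real {0<..b} x)"
        by (rule integral_mono[OF fi gi]) (rule fle)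
      also have "\<dots> = 2 * (LINT x|half_line. (norm (u x - \<phi> x))\<^sup>2) + 2 * (b * E) * b"
        using D(1) integrable_indicator_Ioc[of 0 b] integral_indicator_Ioc[OF order_refl b] by simp
      also have "\<dots> \<le> 2 * e\<^sup>2 + 2 * (b * e\<^sup>2) * b"
      proof -
        have "E \<le> e\<^sup>2" "(LINT x|half_line. (norm (u x - \<phi> x))\<^sup>2) \<le> e\<^sup>2"
          using \<phi>(3) E0 unfolding E_def[symmetric] by linarith+
        then show ?thesis using b by (intro add_mono mult_left_mono mult_right_mono) auto
      qed
      finally show ?thesis using fi by (simp add: power2_eq_square mult_ac)
    qed
    have fi: "integrable half_line f" using bound[of 1] by simp
    have f0: "0 \<le> f x" for x by (simp add: f_def)
    have "(LINT x|half_line. f x) \<le> 0"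
    proof (rule LIMSEQ_le_const)
      have "(\<lambda>n. 2 * (1 / real (Suc n))\<^sup>2 + 2 * b\<^sup>2 * (1 / real (Suc n))\<^sup>2) \<longlonglongrightarrow> 2 * 0\<^sup>2 + 2 * b\<^sup>2 * 0\<^sup>2"
        by (intro tendsto_intros LIMSEQ_Suc[OF lim_1_over_n])
      then show "(\<lambda>n. 2 * (1 / real (Suc n))\<^sup>2 + 2 * b\<^sup>2 * (1 / real (Suc n))\<^sup>2) \<longlonglongrightarrow> 0" by simp
      show "\<exists>N. \<forall>n\<ge>N. (LINT x|half_line. f x) \<le> 2 * (1 / real (Suc n))\<^sup>2 + 2 * b\<^sup>2 * (1 / real (Suc n))\<^sup>2"
        using bound[of "1 / real (Suc n)" for n] by auto
    qed
    then have "(LINT x|half_line. f x) = 0"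
      using Bochner_Integration.integral_nonneg[of half_line f] f0 by (simp add: order_antisym)
    then have "AE x in half_line. f x = 0"
      using integral_nonneg_eq_0_iff_AE[OF fi] f0 by simp
    then show ?thesis using half_line_pos_AE
      by eventually_elim (auto simp: f_def indicator_def)
  qed
  have "AE x in half_line. \<forall>n. x \<le> real n \<longrightarrow> u x = U x"
    unfolding AE_all_countable using loc by simp
  then have "AE x in half_line. u x = U x"
  proof eventually_elim
    case (elim x)
    obtain n where "x \<le> real n" using real_arch_simple by blast
    then show ?case using elim by blast
  qed
  then show ?thesis using that PU by (simp add: v_def)
qed

section \<open>Approximation by test functions\<close>

lemma set_integral_tail_tendsto:
  fixes f :: "real \<Rightarrow> real"
  assumes "integrable half_line f"
  shows "(\<lambda>n. LINT x:{real n<..}|half_line. f x) \<longlonglongrightarrow> 0"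
proof -
  have "(\<lambda>n. LINT x:{real n<..}|half_line. f x) \<longlonglongrightarrow> (LINT x|half_line. 0)"
    unfolding set_lebesgue_integral_def
  proof (rule integral_dominated_convergence)
    show "integrable half_line (\<lambda>x. norm (f x))" using assms by (rule integrable_norm)
    have "{real n<..} \<in> sets half_line" for n by (subst sets_restrict_space_iff) auto
    then show "(\<lambda>x. indicat_real {real n<..} x *\<^sub>R f x) \<in> borel_measurable half_line" for n
      using assms by (intro borel_measurable_scaleR borel_measurable_indicator) auto
    show "AE x in half_line. (\<lambda>n. indicat_real {real n<..} x *\<^sub>R f x) \<longlonglongrightarrow> 0"
    proof (rule AE_I2)
      fix x
      have "\<forall>\<^sub>F n in sequentially. x \<le> real n"
        using filterlim_at_top[THEN iffD1, OF filterlim_real_sequentially] by blast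
      then have "\<forall>\<^sub>F n in sequentially. indicat_real {real n<..} x *\<^sub>R f x = 0"
        by eventually_elim (simp add: indicator_def)
      then show "(\<lambda>n. indicat_real {real n<..} x *\<^sub>R f x) \<longlonglongrightarrow> 0" by (rule tendsto_eventually)
    qed
    show "AE x in half_line. norm (indicat_real {real n<..} x *\<^sub>R f x) \<le> norm (f x)" for n
      by (auto simp: indicator_def)
  qed simp
  then show ?thesis by simp
qed

lemma square_add_le: "(x + y)\<^sup>2 \<le> 2 * x\<^sup>2 + 2 * y\<^sup>2" for x y :: real
  using sum_squares_bound[of x y] by (simp add: power2_sum)

text \<open>\<open>W\<close> is \<open>0\<close> up to \<open>a\<close>, equals
  \<open>U - U a\<close> up to \<open>y\<close>, and then runs linearly to \<open>0\<close> at
  \<open>y + 1\<close>. The errors come from both ends of \<open>U\<close>, from the shift by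
  \<open>U a\<close> and from the ramp. \<open>y\<close> is fixed before \<open>a\<close>, because
  the shift is paid for on an interval of length up to \<open>y\<close>.\<close>

lemma H1_compact_approx:
  assumes H: "H1_primitive U g" and e: "0 < e"
  obtains a b W h where "0 < a" "a < b" "H1_primitive W h" "\<And>x. b \<le> x \<Longrightarrow> W x = 0"
    "\<And>x. 0 < x \<Longrightarrow> x \<notin> {a<..b} \<Longrightarrow> h x = 0"
    "(LINT x|half_line. (U x - W x)\<^sup>2) + (LINT x|half_line. (g x - h x)\<^sup>2) < e"
proof -
  note P = H1_primitiveD(1)[OF H]
  note i = H1_primitiveD(2,3)[OF H]
  define F where "F x = (U x)\<^sup>2 + (g x)\<^sup>2" for x
  have Fi: "integrable half_line F" unfolding F_def using i by simp
  have F0: "0 \<le> F x" for x by (simp add: F_def)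
  \<comment> \<open>The contributions below add up to less than \<open>5 * e1\<close>. The weights
    \<open>8\<close> stem from
    \<open>4 * k\<^sup>2 \<le> 8 * (U a)\<^sup>2 + 8 * (U y)\<^sup>2\<close>.\<close>
  define e1 where "e1 = e / 20"
  have e1: "0 < e1" using e by (simp add: e1_def)
  have sets: "{z<..} \<in> sets half_line" if "0 \<le> z" for z using that by (subst sets_restrict_space_iff) auto
  have "\<forall>\<^sub>F n in sequentially. (LINT x:{real n<..}|half_line. F x) < e1"
    by (rule order_tendstoD(2)[OF set_integral_tail_tendsto[OF Fi] e1])
  then obtain n where n: "(LINT x:{real n<..}|half_line. F x) < e1" by (auto simp: eventually_sequentially)
  obtain y where y: "max 1 (real n) \<le> y" "\<bar>U y\<bar> < sqrt (e1 / 8)"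
  proof -
    have "\<exists>y\<ge>max 1 (real n). \<bar>U y\<bar> < sqrt (e1 / 8)"
      by (rule H1_small_values[OF H]) (use e1 in auto)
    then show ?thesis using that by blast
  qed
  have y1: "1 \<le> y" "0 \<le> y" using y by auto
  have Uy: "8 * (U y)\<^sup>2 \<le> e1"
  proof -
    have "\<bar>U y\<bar>\<^sup>2 \<le> (sqrt (e1 / 8))\<^sup>2" using y(2) by (intro power_mono) auto
    then show ?thesis using e1 by simp
  qed
  define T where "T = (LINT x:{y<..}|half_line. F x)"
  have T: "T < e1"
  proof -
    have "T \<le> (LINT x:{real n<..}|half_line. F x)"
      unfolding T_def set_lebesgue_integral_def
      by (rule integral_mono[OF integrable_mult_indicator[OF sets Fi] integrable_mult_indicator[OF sets Fi]])
        (use y F0 in \<open>auto simp: indicator_def\<close>)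
    then show ?thesis using n by simp
  qed
  define G where "G = (LINT x|half_line. (g x)\<^sup>2)"
  have inv0: "(\<lambda>n. 1 / real (Suc n)) \<longlonglongrightarrow> 0" by (rule LIMSEQ_Suc[OF lim_1_over_n])
  have "\<forall>\<^sub>F n in sequentially. (LINT x:{0<..1 / real (Suc n)}|half_line. F x) < e1"
    by (rule order_tendstoD(2)[OF set_integral_Ioc_0_tendsto[OF Fi] e1])
  moreover have "\<forall>\<^sub>F n in sequentially. 1 / real (Suc n) * G * (y + 8) < e1"
  proof (rule order_tendstoD(2))
    show "(\<lambda>n. 1 / real (Suc n) * G * (y + 8)) \<longlonglongrightarrow> 0 * G * (y + 8)" by (intro tendsto_intros inv0)
  qed (use e1 in simp)
  moreover have "\<forall>\<^sub>F n in sequentially. 1 / real (Suc n) < 1"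
    by (rule order_tendstoD(2)[OF inv0]) simp
  ultimately have "\<forall>\<^sub>F n in sequentially. (LINT x:{0<..1 / real (Suc n)}|half_line. F x) < e1 \<and>
      1 / real (Suc n) * G * (y + 8) < e1 \<and> 1 / real (Suc n) < 1"
    by (intro eventually_conj)
  then obtain m where m: "(LINT x:{0<..1 / real (Suc m)}|half_line. F x) < e1"
    "1 / real (Suc m) * G * (y + 8) < e1" "1 / real (Suc m) < 1" by (auto simp: eventually_sequentially)
  define a where "a = 1 / real (Suc m)"
  have a: "0 < a" "a < 1" "(LINT x:{0<..a}|half_line. F x) < e1" "a * G * (y + 8) < e1" using m by (auto simp: a_def)
  have Ua: "(U a)\<^sup>2 * (y + 8) \<le> e1"
  proof -
    have "(U a)\<^sup>2 \<le> a * (LINT t:{0<..a}|half_line. (g t)\<^sup>2)" using L2_primitive_sq_le[OF P] a by simp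
    also have "\<dots> \<le> a * G" unfolding G_def using a i(2)
      by (intro mult_left_mono set_integral_mono_half_line) (auto simp: Ioc_in_half_line)
    finally have "(U a)\<^sup>2 * (y + 8) \<le> a * G * (y + 8)" using y1 by (intro mult_right_mono) auto
    then show ?thesis using a(4) by linarith
  qed
  define k where "k = U a - U y"
  have k: "k\<^sup>2 \<le> 2 * (U a)\<^sup>2 + 2 * (U y)\<^sup>2" using square_add_le[of "U a" "- U y"] by (simp add: k_def)
  define b where "b = y + 1"
  define W where "W x = U (min (max x a) y) - U a + k * (min x (y + 1) - min x y)" for x
  define h where "h x = indicat_real {a<..} x * (indicat_real {0<..y} x * g x) + k * (indicat_real {0<..y + 1} x - indicat_real {0<..y} x)" for x
  have a0: "0 \<le> a" "0 \<le> y + 1" "min a y = a" using a y1 by auto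
  have PW: "L2_primitive W h"
    by (rule L2_primitive_cong[OF L2_primitive_lincomb[OF L2_primitive_start[OF L2_primitive_stop[OF P y1(2)] a0(1)]
          L2_primitive_lincomb[OF L2_primitive_ramp[OF a0(2)] L2_primitive_ramp[OF y1(2)], of 1 "-1"], of 1 k]])
      (auto simp: W_def h_def a0(3) algebra_simps)
  have Wz: "W x = 0" if "b \<le> x" for x using that a y1 by (auto simp: W_def b_def k_def min_def max_def)
  have hz: "h x = 0" if "0 < x" "x \<notin> {a<..b}" for x using that a y1 by (auto simp: h_def b_def indicator_def)
  define Q where "Q x = indicat_real {0<..a} x * F x + (U a)\<^sup>2 * indicat_real {0<..y} x + 2 * (indicat_real {y<..} x * F x) + 4 * k\<^sup>2 * indicat_real {y<..y + 1} x" for x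
  have pt: "(U x - W x)\<^sup>2 + (g x - h x)\<^sup>2 \<le> Q x" if x: "0 < x" for x
  proof -
    consider "x \<le> a" | "a < x" "x \<le> y" | "y < x" "x \<le> y + 1" | "y + 1 < x" by linarith
    then show ?thesis
    proof cases
      case 1
      then have "W x = 0" "h x = 0" using x a y1 by (auto simp: W_def h_def indicator_def min_def max_def)
      then show ?thesis using 1 x a y1 by (simp add: Q_def F_def)
    next
      case 2
      then have "U x - W x = U a" "h x = g x" using x a y1 by (auto simp: W_def h_def indicator_def min_def max_def)
      then show ?thesis using 2 x a y1 by (simp add: Q_def)
    next
      case 3
      then have WH: "W x = k * (x - y - 1)" "h x = k" using x a y1 by (auto simp: W_def h_def k_def indicator_def min_def max_def algebra_simps)
      have "(x - y - 1)\<^sup>2 \<le> 1" using 3 by (simp add: abs_square_le_1 abs_le_iff)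
      then have "(W x)\<^sup>2 \<le> k\<^sup>2 * 1" unfolding WH power_mult_distrib by (intro mult_left_mono) auto
      moreover have "(U x - W x)\<^sup>2 \<le> 2 * (U x)\<^sup>2 + 2 * (W x)\<^sup>2" using square_add_le[of "U x" "- W x"] by simp
      moreover have "(g x - h x)\<^sup>2 \<le> 2 * (g x)\<^sup>2 + 2 * k\<^sup>2" using square_add_le[of "g x" "- k"] WH by simp
      ultimately show ?thesis using 3 x a y1 by (simp add: Q_def F_def)
    next
      case 4
      then have "W x = 0" "h x = 0" using x a y1 Wz[of x] hz[of x] by (auto simp: b_def)
      then show ?thesis using 4 x a y1 F0[of x] by (simp add: Q_def F_def)
    qed
  qed
  have Qi: "integrable half_line (\<lambda>x. indicat_real {0<..a} x * F x)" "integrable half_line (\<lambda>x. indicat_real {y<..} x * F x)"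
    "integrable half_line (indicat_real {0<..y})" "integrable half_line (indicat_real {y<..y + 1})"
    using integrable_mult_indicator[OF Ioc_in_half_line[of 0 a] Fi] integrable_mult_indicator[OF sets Fi, of y] y1
      integrable_indicator_Ioc by auto
  have iQ: "integrable half_line Q" unfolding Q_def using Qi by simp
  have IQ: "(LINT x|half_line. Q x) = (LINT x:{0<..a}|half_line. F x) + (U a)\<^sup>2 * y + 2 * T + 4 * k\<^sup>2"
    unfolding Q_def T_def set_lebesgue_integral_def
    using Qi integral_indicator_Ioc[of 0 y] integral_indicator_Ioc[of y "y + 1"] y1 by simp
  note [measurable] = H1_primitiveD(5,6)[OF H] L2_primitiveD(1)[OF PW] L2_primitive_measurable[OF PW]
  have di: "integrable half_line (\<lambda>x. (U x - W x)\<^sup>2)" "integrable half_line (\<lambda>x. (g x - h x)\<^sup>2)"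
  proof -
    show "integrable half_line (\<lambda>x. (U x - W x)\<^sup>2)"
    proof (rule Bochner_Integration.integrable_bound[OF iQ])
      show "AE x in half_line. norm ((U x - W x)\<^sup>2) \<le> norm (Q x)"
        using half_line_pos_AE
      proof eventually_elim
        case (elim x) then show ?case using pt[OF elim] by (smt (verit) real_norm_def zero_le_power2)
      qed
    qed measurable
    show "integrable half_line (\<lambda>x. (g x - h x)\<^sup>2)"
    proof (rule Bochner_Integration.integrable_bound[OF iQ])
      show "AE x in half_line. norm ((g x - h x)\<^sup>2) \<le> norm (Q x)"
        using half_line_pos_AE
      proof eventually_elim
        case (elim x) then show ?case using pt[OF elim] by (smt (verit) real_norm_def zero_le_power2)
      qed
    qed measurable
  qed
  have "(LINT x|half_line. (U x - W x)\<^sup>2) + (LINT x|half_line. (g x - h x)\<^sup>2) = (LINT x|half_line. (U x - W x)\<^sup>2 + (g x - h x)\<^sup>2)"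
    using di by simp
  also have "\<dots> \<le> (LINT x|half_line. Q x)"
    by (rule integral_mono_AE) (use di iQ half_line_pos_AE pt in \<open>auto elim!: eventually_mono\<close>)
  also have "\<dots> < e"
  proof -
    have "(U a)\<^sup>2 * (y + 8) = (U a)\<^sup>2 * y + 8 * (U a)\<^sup>2" by (simp add: algebra_simps)
    then show ?thesis using IQ a(3) T k Uy Ua e1 unfolding e1_def by linarith
  qed
  finally have lt: "(LINT x|half_line. (U x - W x)\<^sup>2) + (LINT x|half_line. (g x - h x)\<^sup>2) < e" .
  have "integrable half_line (\<lambda>x. (1 * U x + (-1) * (U x - W x))\<^sup>2)"
    by (rule L2_lincomb_integrable) (use i di in auto)
  then have HW: "H1_primitive W h" using PW by (simp add: H1_primitive_def)
  have "a < b" using a y1 by (simp add: b_def)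
  from that[OF a(1) this HW Wz hz lt] show ?thesis .
qed

text \<open>The vanishing total integral makes the antiderivative return to \<open>0\<close> at
  \<open>b\<close>, after which it has no derivative left to move it.\<close>

lemma smooth_real_compact_antiderivative:
  assumes f: "smooth_real f'" "\<And>x. x \<notin> {a<..<b} \<Longrightarrow> f' x = 0" and ab: "0 < a" "a < b"
    and z: "(LINT x:{0<..b}|half_line. f' x) = 0"
  obtains f where "smooth_real f" "\<And>x. (f has_real_derivative f' x) (at x)" "\<And>x. x \<notin> {a<..<b} \<Longrightarrow> f x = 0"
    "L2_primitive f f'"
proof -
  have c: "continuous_on S f'" for S by (rule smooth_real_continuous[OF f(1)])
  \<comment> \<open>Starting to the left of the support makes the derivative at \<open>a\<close>
    two-sided.\<close>
  define f where "f x = integral {a - 1..x} f'" for x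
  have fa: "f x = 0" if "x \<le> a" for x
  proof -
    have "f x = integral {a - 1..x} (\<lambda>_. 0)" unfolding f_def
      by (rule Henstock_Kurzweil_Integration.integral_cong) (use that f(2) in auto)
    then show ?thesis by simp
  qed
  have d: "(f has_real_derivative f' x) (at x)" for x
  proof (cases "x < a")
    case True
    have "\<forall>\<^sub>F y in nhds x. f y = 0"
      using eventually_nhds_in_open[of "{..<a}" x] True fa by (auto elim!: eventually_mono)
    then have "(f has_real_derivative 0) (at x) \<longleftrightarrow> ((\<lambda>_. 0) has_real_derivative 0) (at x)"
      by (intro DERIV_cong_ev) auto
    then show ?thesis using f(2)[of x] True by simp
  next
    case False
    then have "((\<lambda>x. integral {a - 1..x} f') has_real_derivative f' x) (at x within {a - 1..x + 1})"
      by (intro integral_has_real_derivative c) auto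
    moreover have "at x within {a - 1..x + 1} = at x" by (rule at_within_Icc_at) (use False in auto)
    ultimately show ?thesis by (simp add: f_def[abs_def])
  qed
  have inc: "f t - f s = (LINT x:{s<..t}|half_line. f' x)" if "0 \<le> s" "s \<le> t" for s t
    by (rule FTC_half_line[OF that c])
      (use d has_real_derivative_iff_has_vector_derivative has_vector_derivative_at_within in blast)
  have f0: "f 0 = 0" using fa ab by simp
  have fb: "f b = 0" using inc[of 0 b] ab z f0 by simp
  have fz: "f x = 0" if "x \<notin> {a<..<b}" for x
  proof (cases "x \<le> a")
    case False
    then have bx: "b \<le> x" using that by auto
    have "f x - f b = (LINT t:{b<..x}|half_line. f' t)" using inc[of b x] bx ab by simp
    also have "\<dots> = (LINT t:{b<..x}|half_line. 0)"
      by (rule set_lebesgue_integral_cong) (use f(2) ab in \<open>auto intro!: Ioc_in_half_line\<close>)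
    finally show ?thesis using fb by simp
  qed (rule fa)
  have P: "L2_primitive f f'"
  proof (rule L2_primitive_compact_support)
    show "(f has_vector_derivative f' x) (at x)" for x
      using d[of x] by (simp add: has_real_derivative_iff_has_vector_derivative)
    show "continuous_on UNIV f'" by (rule c)
    show "f' x = 0" if "b < x" for x by (rule f(2)) (use that in auto)
  qed (rule f0)
  show ?thesis by (rule that[OF smooth_real_antiderivative[OF f(1) d] d fz P])
qed

text \<open>The derivative is approximated rather than the function: \<open>f1\<close> is smooth and
  close to \<open>h\<close>, and a multiple of the bump \<open>\<rho>\<close> corrects its mean to
  zero so that the antiderivative has compact support. As \<open>h\<close> has mean zero, the mean
  \<open>m\<close> of \<open>f1\<close> is small, and with it the correction.\<close>

lemma H1_smooth_approx:
  assumes H: "H1_primitive U g" and e: "0 < e"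
  obtains f f' a b where "0 < a" "smooth_real f" "\<And>x. x \<notin> {a<..<b} \<Longrightarrow> f x = 0" "H1_primitive f f'"
    "(LINT x|half_line. (U x - f x)\<^sup>2) + (LINT x|half_line. (g x - f' x)\<^sup>2) < e"
proof -
  have e4: "0 < e / 4" using e by simp
  obtain a b W h where ab: "0 < a" "a < b" and HW: "H1_primitive W h" and Wz: "\<And>x. b \<le> x \<Longrightarrow> W x = 0"
    and hz: "\<And>x. 0 < x \<Longrightarrow> x \<notin> {a<..b} \<Longrightarrow> h x = 0"
    and near: "(LINT x|half_line. (U x - W x)\<^sup>2) + (LINT x|half_line. (g x - h x)\<^sup>2) < e / 4"
    by (rule H1_compact_approx[OF H e4]) blast
  have a0: "0 \<le> a" "0 \<le> b" using ab by auto
  note PW = H1_primitiveD(1)[OF HW]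
  note hD = H1_primitiveD(6)[OF HW] H1_primitiveD(3)[OF HW]
  define \<rho> where "\<rho> = cutoff a b 0"
  have \<rho>s: "smooth_real \<rho>" unfolding \<rho>_def by (rule cutoff_smooth)
  have \<rho>z: "\<rho> x = 0" if "x \<notin> {a<..<b}" for x using that by (auto simp: \<rho>_def cutoff_eq)
  have \<rho>c: "continuous_on S \<rho>" for S by (rule smooth_real_continuous[OF \<rho>s])
  define I where "I = (LINT x:{0<..b}|half_line. \<rho> x)"
  define E where "E = (LINT x|half_line. (\<rho> x)\<^sup>2)"
  have \<rho>i: "integrable half_line \<rho>" "integrable half_line (\<lambda>x. (\<rho> x)\<^sup>2)"
    by (rule compact_support_integrable[of b]; use \<rho>z in \<open>auto intro!: continuous_intros \<rho>c\<close>)+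
  have I: "I = (LINT x|half_line. \<rho> x)" unfolding I_def by (rule set_integral_support) (use \<rho>z in auto)
  have I0: "0 < I"
  proof -
    have nn: "0 \<le> \<rho> x" for x unfolding \<rho>_def by (rule cutoff_bounds)
    have "I \<noteq> 0"
    proof
      assume "I = 0"
      then have "AE x in half_line. \<rho> x = 0" using integral_nonneg_eq_0_iff_AE[OF \<rho>i(1)] nn I by simp
      then have "AE x in half_line. indicat_real {a<..b} x = indicat_real {b<..b} x"
      proof -
        have "AE x in lebesgue. x \<notin> {b}" by (rule AE_not_in) simp
        then have "AE x in half_line. x \<notin> {b}" by (subst AE_restrict_space_iff) (auto elim!: eventually_mono)
        with \<open>AE x in half_line. \<rho> x = 0\<close> show ?thesis
        proof eventually_elim
          case (elim x)
          have "\<not> (a < x \<and> x < b)" using elim(1) by (auto simp: \<rho>_def cutoff_eq)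
          then show ?case using elim(2) by (auto simp: indicator_def)
        qed
      qed
      then have "(LINT x|half_line. indicat_real {a<..b} x) = (LINT x|half_line. indicat_real {b<..b} x)"
        by (intro integral_cong_AE borel_measurable_indicator Ioc_in_half_line a0) auto
      then show False using integral_indicator_Ioc[of a b] integral_indicator_Ioc[of b b] ab by simp
    qed
    moreover have "0 \<le> I" unfolding I by (rule Bochner_Integration.integral_nonneg) (rule nn)
    ultimately show ?thesis by simp
  qed
  have E0: "0 \<le> E" by (simp add: E_def)
  \<comment> \<open>The first factor accounts for the mean correction of the derivative, the second
    for passing from the derivative to the function on the interval up to \<open>b\<close>. With
    \<open>\<eta>\<close> below, the error against \<open>W\<close> is at most
    \<open>e / 8\<close>.\<close>
  define K where "K = (1 + b * E / I\<^sup>2) * (1 + b\<^sup>2)"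
  have K: "0 < K" unfolding K_def using E0 a0 by (intro mult_pos_pos) (auto intro!: add_pos_nonneg divide_nonneg_nonneg mult_nonneg_nonneg)
  define \<eta> where "\<eta> = e / (16 * K)"
  have \<eta>: "0 < \<eta>" using e K by (simp add: \<eta>_def)
  obtain f1 where f1: "smooth_real f1" "\<And>x. x \<notin> {a<..<b} \<Longrightarrow> f1 x = 0"
    "(LINT x|lebesgue_on {a<..b}. (h x - f1 x)\<^sup>2) < \<eta>"
    using approximable_L2[OF measurable_lebesgue_on_Ioc[OF a0(1) hD(1)] integrable_lebesgue_on_Ioc[OF a0(1) hD(2)], of b] \<eta>
    unfolding approximable_def by blast
  have f1c: "continuous_on S f1" for S by (rule smooth_real_continuous[OF f1(1)])
  have f1m: "f1 \<in> borel_measurable half_line"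
    by (rule borel_measurable_half_line[OF borel_measurable_continuous_onI[OF f1c]])
  have f1i: "integrable half_line (\<lambda>x. (f1 x)\<^sup>2)"
    by (rule compact_support_integrable[of b]) (use f1(2) in \<open>auto intro!: continuous_intros f1c\<close>)
  have d1i: "integrable half_line (\<lambda>x. (h x - f1 x)\<^sup>2)"
    using L2_lincomb_integrable[OF hD(1) f1m hD(2) f1i, of 1 "-1"] by simp
  define J where "J = (LINT x|half_line. (h x - f1 x)\<^sup>2)"
  have J: "J < \<eta>"
  proof -
    have "J = (LINT x:{a<..b}|half_line. (h x - f1 x)\<^sup>2)"
      unfolding J_def set_lebesgue_integral_def
    proof (rule Bochner_Integration.integral_cong[OF refl])
      fix x assume "x \<in> space half_line"
      then show "(h x - f1 x)\<^sup>2 = indicat_real {a<..b} x *\<^sub>R (h x - f1 x)\<^sup>2"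
        using hz[of x] f1(2)[of x] by (cases "x \<in> {a<..b}") (auto simp: space_half_line)
    qed
    then show ?thesis using f1(3) integral_lebesgue_on_Ioc[OF a0(1)] by simp
  qed
  define m where "m = (LINT x:{0<..b}|half_line. f1 x)"
  have f1si: "set_integrable half_line {0<..b} f1" by (rule continuous_set_integrable_Ioc[OF order_refl f1c])
  have m: "m\<^sup>2 \<le> b * J"
  proof -
    have hi: "set_integrable half_line {0<..b} h" by (rule L2_primitive_set_integrable[OF PW order_refl])
    have "(LINT x:{0<..b}|half_line. h x) = 0" using L2_primitiveD(3)[OF PW a0(2)] Wz[of b] by simp
    then have "(LINT x:{0<..b}|half_line. h x - f1 x) = - m"
      using set_integral_diff(2)[OF hi f1si] by (simp add: m_def)
    then have "m\<^sup>2 \<le> (b - 0) * (LINT x:{0<..b}|half_line. (norm (h x - f1 x))\<^sup>2)"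
      using L2_Holder[of "\<lambda>x. h x - f1 x" 0 b] hD(1) f1m d1i a0 by simp
    also have "\<dots> \<le> b * J" unfolding J_def
      using set_integral_mono_half_line[OF d1i, of "{0<..b}"] a0 by (simp add: mult_left_mono Ioc_in_half_line)
    finally show ?thesis .
  qed
  define f' where "f' x = f1 x - m / I * \<rho> x" for x
  have f's: "smooth_real f'" unfolding f'_def by (rule smooth_real_diff_scale[OF f1(1) \<rho>s])
  have f'z: "f' x = 0" if "x \<notin> {a<..<b}" for x using f1(2)[OF that] \<rho>z[OF that] by (simp add: f'_def)
  have zero: "(LINT x:{0<..b}|half_line. f' x) = 0"
  proof -
    have "set_integrable half_line {0<..b} \<rho>" by (rule continuous_set_integrable_Ioc[OF order_refl \<rho>c])
    then have "(LINT x:{0<..b}|half_line. f1 x - m / I * \<rho> x) = m - m / I * I"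
      using set_integral_diff(2)[OF f1si set_integrable_mult_right[of "m / I" half_line "{0<..b}" \<rho>]]
      unfolding m_def I_def by (simp only: set_integral_mult_right)
    then show ?thesis using I0 by (simp add: f'_def)
  qed
  obtain f where f: "smooth_real f" "\<And>x. (f has_real_derivative f' x) (at x)" "\<And>x. x \<notin> {a<..<b} \<Longrightarrow> f x = 0"
    "L2_primitive f f'"
    by (rule smooth_real_compact_antiderivative[OF f's f'z ab zero], assumption) blast
  have "integrable half_line (\<lambda>x. (f x)\<^sup>2)"
    by (rule compact_support_integrable[of b]) (use f(3) smooth_real_continuous[OF f(1)] in \<open>auto intro!: continuous_intros\<close>)
  then have Hf: "H1_primitive f f'" using f(4) by (simp add: H1_primitive_def)
  define Q where "Q = (LINT x|half_line. (h x - f' x)\<^sup>2)"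
  have Q0: "0 \<le> Q" by (simp add: Q_def)
  have Q: "Q \<le> 2 * \<eta> * (1 + b * E / I\<^sup>2)"
  proof -
    have "Q \<le> 2 * J + 2 * (LINT x|half_line. (f1 x - f' x)\<^sup>2)"
      unfolding Q_def J_def by (rule L2_triangle[OF hD(1) f1m H1_primitiveD(6)[OF Hf] hD(2) f1i H1_primitiveD(3)[OF Hf]])
    also have "(LINT x|half_line. (f1 x - f' x)\<^sup>2) = (m / I)\<^sup>2 * E"
      unfolding E_def f'_def using \<rho>i by (simp add: power_mult_distrib power_divide)
    also have "(m / I)\<^sup>2 * E \<le> (b * J / I\<^sup>2) * E"
      using m E0 by (intro mult_right_mono) (auto simp: power_divide divide_right_mono)
    finally have "Q \<le> 2 * J * (1 + b * E / I\<^sup>2)" by (simp add: algebra_simps)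
    also have "\<dots> \<le> 2 * \<eta> * (1 + b * E / I\<^sup>2)"
      using J E0 a0 by (intro mult_right_mono) (auto intro!: add_nonneg_nonneg divide_nonneg_nonneg mult_nonneg_nonneg)
    finally show ?thesis .
  qed
  have HD: "H1_primitive (\<lambda>x. 1 * W x + (-1) * f x) (\<lambda>x. 1 * h x + (-1) * f' x)" by (rule H1_primitive_lincomb[OF HW Hf])
  have "(LINT x|half_line. (W x - f x)\<^sup>2) \<le> (LINT x|half_line. b * Q * indicat_real {0<..b} x)"
  proof (rule integral_mono_AE)
    show "integrable half_line (\<lambda>x. (W x - f x)\<^sup>2)" using H1_primitiveD(2)[OF HD] by simp
    show "integrable half_line (\<lambda>x. b * Q * indicat_real {0<..b} x)" by (intro integrable_mult_right integrable_indicator_Ioc) simp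
    show "AE x in half_line. (W x - f x)\<^sup>2 \<le> b * Q * indicat_real {0<..b} x"
      using half_line_pos_AE
    proof eventually_elim
      case (elim x)
      show ?case
      proof (cases "x \<le> b")
        case True
        have "(W x - f x)\<^sup>2 \<le> x * (LINT t:{0<..x}|half_line. (h t - f' t)\<^sup>2)"
          using L2_primitive_sq_le[OF H1_primitiveD(1)[OF HD], of x] elim by simp
        also have "\<dots> \<le> x * Q" unfolding Q_def
          using set_integral_mono_half_line[of "\<lambda>x. (h x - f' x)\<^sup>2" "{0<..x}"] H1_primitiveD(3)[OF HD] elim
          by (simp add: mult_left_mono Ioc_in_half_line)
        also have "\<dots> \<le> b * Q" using True Q0 by (intro mult_right_mono)
        finally show ?thesis using True elim by simp
      next
        case False
        then show ?thesis using Wz[of x] f(3)[of x] by simp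
      qed
    qed
  qed
  also have "\<dots> = b\<^sup>2 * Q" using integral_indicator_Ioc[of 0 b] a0 by (simp add: power2_eq_square)
  finally have WF: "(LINT x|half_line. (W x - f x)\<^sup>2) + Q \<le> Q * (1 + b\<^sup>2)" by (simp add: algebra_simps)
  also have "\<dots> \<le> 2 * \<eta> * (1 + b * E / I\<^sup>2) * (1 + b\<^sup>2)" using Q by (intro mult_right_mono) auto
  also have "\<dots> = 2 * \<eta> * K" by (simp add: K_def)
  also have "\<dots> = e / 8" using K by (simp add: \<eta>_def)
  finally have far: "(LINT x|half_line. (W x - f x)\<^sup>2) + Q \<le> e / 8" .
  have "(LINT x|half_line. (U x - f x)\<^sup>2) \<le> 2 * (LINT x|half_line. (U x - W x)\<^sup>2) + 2 * (LINT x|half_line. (W x - f x)\<^sup>2)"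
    by (rule L2_triangle[OF H1_primitiveD(5)[OF H] H1_primitiveD(5)[OF HW] H1_primitiveD(5)[OF Hf]
          H1_primitiveD(2)[OF H] H1_primitiveD(2)[OF HW] H1_primitiveD(2)[OF Hf]])
  moreover have "(LINT x|half_line. (g x - f' x)\<^sup>2) \<le> 2 * (LINT x|half_line. (g x - h x)\<^sup>2) + 2 * Q"
    unfolding Q_def
    by (rule L2_triangle[OF H1_primitiveD(6)[OF H] H1_primitiveD(6)[OF HW] H1_primitiveD(6)[OF Hf]
          H1_primitiveD(3)[OF H] H1_primitiveD(3)[OF HW] H1_primitiveD(3)[OF Hf]])
  ultimately have close: "(LINT x|half_line. (U x - f x)\<^sup>2) + (LINT x|half_line. (g x - f' x)\<^sup>2) < e"
    using near far e by linarith
  show ?thesis by (rule that[OF ab(1) f(1) _ Hf close]) (rule f(3))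
qed

section \<open>Real primitives as elements of \<open>H10\<close>\<close>

lemma L2_primitive_of_real:
  assumes "L2_primitive U g"
  shows "L2_primitive (\<lambda>x. complex_of_real (U x)) (\<lambda>x. complex_of_real (g x))"
proof -
  note D = L2_primitiveD[OF assms]
  have "(LINT t:{0<..x}|half_line. complex_of_real (g t)) = complex_of_real (LINT t:{0<..x}|half_line. g t)" for x
    by (rule set_integral_complex_of_real)
  then show ?thesis using D by (simp add: L2_primitive_def)
qed

lemma H1_primitive_in_H10:
  assumes H: "H1_primitive U g"
  shows "(\<lambda>x. complex_of_real (U x)) \<in> H10"
    and "AE x in half_line. weak_deriv (\<lambda>x. complex_of_real (U x)) x = complex_of_real (g x)"
proof -
  have Lp: "(\<lambda>x. complex_of_real (V x)) \<in> Lp_space 2" "(\<lambda>x. complex_of_real (v x)) \<in> Lp_space 2"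
    "is_weak_derivative (\<lambda>x. complex_of_real (V x)) (\<lambda>x. complex_of_real (v x))"
    if "H1_primitive V v" for V v
    using H1_primitiveD[OF that] L2_primitive_weak_derivative[OF L2_primitive_of_real]
    by (auto simp: Lp_space_2)
  have ae: "AE x in half_line. weak_deriv (\<lambda>x. complex_of_real (V x)) x = complex_of_real (v x)"
    if "H1_primitive V v" for V v
    by (rule weak_deriv_AE) (rule Lp[OF that])+
  show "AE x in half_line. weak_deriv (\<lambda>x. complex_of_real (U x)) x = complex_of_real (g x)" by (rule ae[OF H])
  have H1: "(\<lambda>x. complex_of_real (V x)) \<in> H1" if "H1_primitive V v" for V v
    using Lp[OF that] unfolding H1_def by blast
  show "(\<lambda>x. complex_of_real (U x)) \<in> H10"
    unfolding H10_def
  proof (intro CollectI conjI allI impI)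
    show "(\<lambda>x. complex_of_real (U x)) \<in> H1" by (rule H1[OF H])
    fix \<epsilon> :: real assume \<epsilon>: "0 < \<epsilon>"
    then have e2: "0 < \<epsilon>\<^sup>2" by simp
    obtain f f' a b where f: "0 < a" "smooth_real f" "\<And>x. x \<notin> {a<..<b} \<Longrightarrow> f x = 0" "H1_primitive f f'"
      "(LINT x|half_line. (U x - f x)\<^sup>2) + (LINT x|half_line. (g x - f' x)\<^sup>2) < \<epsilon>\<^sup>2"
      by (rule H1_smooth_approx[OF H e2]) blast
    have HD: "H1_primitive (\<lambda>x. U x - f x) (\<lambda>x. g x - f' x)"
      using H1_primitive_lincomb[OF H f(4), of 1 "-1"] by simp
    define d where "d = (\<lambda>x. complex_of_real (U x) - complex_of_real (f x))"
    have d: "d = (\<lambda>x. complex_of_real (U x - f x))" by (simp add: d_def)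
    have [measurable]: "weak_deriv d \<in> borel_measurable half_line"
      using weak_deriv_spec(1)[OF H1[OF HD]] by (simp add: d Lp_space_2)
    have [measurable]: "(\<lambda>x. g x - f' x) \<in> borel_measurable half_line" by (rule H1_primitiveD(6)[OF HD])
    have "(LINT x|half_line. (norm (weak_deriv d x))\<^sup>2) = (LINT x|half_line. (g x - f' x)\<^sup>2)"
    proof (rule integral_cong_AE)
      show "AE x in half_line. (norm (weak_deriv d x))\<^sup>2 = (g x - f' x)\<^sup>2"
        using ae[OF HD] unfolding d by eventually_elim (simp only: norm_of_real power2_abs)
    qed measurable
    moreover have "(LINT x|half_line. (norm (d x))\<^sup>2) = (LINT x|half_line. (U x - f x)\<^sup>2)"
      unfolding d by (simp only: norm_of_real power2_abs)
    ultimately have "H1_norm d < sqrt (\<epsilon>\<^sup>2)"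
      unfolding H1_norm_eq using f(5) by (intro real_sqrt_less_mono) simp
    then have "H1_norm (\<lambda>x. complex_of_real (U x) - complex_of_real (f x)) < \<epsilon>" using \<epsilon> by (simp add: d_def)
    moreover have "(\<lambda>x. complex_of_real (f x)) \<in> test_functions" by (rule smooth_test_function[OF f(2,3,1)])
    ultimately show "\<exists>\<phi>\<in>test_functions. H1_norm (\<lambda>x. complex_of_real (U x) - \<phi> x) < \<epsilon>"
      by (intro bexI[of _ "\<lambda>x. complex_of_real (f x)"])
  qed
qed

section \<open>Ground states\<close>

context nls_params
begin

text \<open>The functionals see \<open>u\<close> only through its modulus and its weak derivative.
  \<open>N\<close> stands for the continuous representative of the modulus; the gradient term stays
  that of \<open>u\<close>, since passing to the modulus may lower it.\<close>

lemma functionals_eq: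
  assumes u: "u \<in> H1" and N: "adm N k" and ae: "AE x in half_line. norm (u x) = N x"
  shows "H_form c u = (LINT x|half_line. (norm (weak_deriv u x))\<^sup>2) - c * (LINT x|half_line. (N x)\<^sup>2 / x\<^sup>2)"
    and "(Lp_norm 2 u)\<^sup>2 = (LINT x|half_line. (N x)\<^sup>2)"
    and "Lp_norm (p + 1) u powr (p + 1) = mass N"
proof -
  have um[measurable]: "u \<in> borel_measurable half_line" using u by (auto simp: H1_def Lp_space_2)
  have v: "weak_deriv u \<in> borel_measurable half_line" "integrable half_line (\<lambda>x. (norm (weak_deriv u x))\<^sup>2)"
    using weak_deriv_spec(1)[OF u] by (auto simp: Lp_space_2)
  note [measurable] = v(1)
  note H = H1_primitiveD[OF admD(1)[OF N]]
  note [measurable] = H(5)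
  have [measurable]: "(\<lambda>x. x) \<in> borel_measurable half_line" by (rule borel_measurable_half_line) simp
  have "H_form c u = (LINT x|half_line. (norm (weak_deriv u x))\<^sup>2 - c * ((N x)\<^sup>2 / x\<^sup>2))"
    unfolding H_form_def
  proof (rule integral_cong_AE)
    show "AE x in half_line. (norm (weak_deriv u x))\<^sup>2 - c / x\<^sup>2 * (norm (u x))\<^sup>2
        = (norm (weak_deriv u x))\<^sup>2 - c * ((N x)\<^sup>2 / x\<^sup>2)"
      using ae by eventually_elim simp
  qed measurable
  also have "\<dots> = (LINT x|half_line. (norm (weak_deriv u x))\<^sup>2) - c * (LINT x|half_line. (N x)\<^sup>2 / x\<^sup>2)"
    using v(2) H(4) by (simp del: times_divide_eq_right)
  finally show "H_form c u = (LINT x|half_line. (norm (weak_deriv u x))\<^sup>2) - c * (LINT x|half_line. (N x)\<^sup>2 / x\<^sup>2)" .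
  show "(Lp_norm 2 u)\<^sup>2 = (LINT x|half_line. (N x)\<^sup>2)"
    unfolding Lp_norm_2_sq
  proof (rule integral_cong_AE)
    show "AE x in half_line. (norm (u x))\<^sup>2 = (N x)\<^sup>2" using ae by eventually_elim simp
  qed measurable
  have "Lp_norm (p + 1) u powr (p + 1) = (LINT x|half_line. norm (u x) powr (p + 1))"
    by (rule Lp_norm_powr) (use p in simp)
  also have "\<dots> = mass N"
    unfolding mass_def
  proof (rule integral_cong_AE)
    show "AE x in half_line. norm (u x) powr (p + 1) = N x powr (p + 1)" using ae by eventually_elim simp
  qed measurable
  finally show "Lp_norm (p + 1) u powr (p + 1) = mass N" .
qed

text \<open>The modulus has the same zero order terms, and its derivative is pointwise bounded by
  that of \<open>u\<close>. This reduces the complex problem to nonnegative real functions.\<close>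

lemma modulus_adm:
  assumes u: "u \<in> H10"
  obtains N k where "adm N k" "AE x in half_line. norm (u x) = N x"
    "energy N k \<le> H_form c u + \<omega> * (Lp_norm 2 u)\<^sup>2"
proof -
  have uH: "u \<in> H1" and u2: "u \<in> Lp_space 2" using u by (auto simp: H10_def H1_def)
  obtain U where U: "L2_primitive U (weak_deriv u)" "AE x in half_line. u x = U x" by (rule H10_primitive[OF u])
  define N k where "N x = norm (U x)" and "k x = (U x \<bullet> weak_deriv u x) / norm (U x)" for x
  have P: "L2_primitive N k" unfolding N_def k_def by (rule L2_primitive_norm[OF U(1)])
  have ae: "AE x in half_line. norm (u x) = N x" using U(2) by eventually_elim (simp add: N_def)
  note [measurable] = L2_primitive_measurable[OF P] u2[unfolded Lp_space_2, THEN conjunct1]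
  have N2: "integrable half_line (\<lambda>x. (N x)\<^sup>2)"
  proof (rule Bochner_Integration.integrable_cong_AE_imp)
    show "integrable half_line (\<lambda>x. (norm (u x))\<^sup>2)" using u2 by (simp add: Lp_space_2)
    show "AE x in half_line. (norm (u x))\<^sup>2 = (N x)\<^sup>2" using ae by eventually_elim simp
  qed measurable
  then have A: "adm N k" using P by (simp add: adm_def H1_primitive_def N_def)
  note F = functionals_eq[OF uH A ae]
  have "(LINT x|half_line. (k x)\<^sup>2) \<le> (LINT x|half_line. (norm (weak_deriv u x))\<^sup>2)"
  proof (rule integral_mono)
    show "integrable half_line (\<lambda>x. (k x)\<^sup>2)" by (rule H1_primitiveD(3)[OF admD(1)[OF A]])
    show "integrable half_line (\<lambda>x. (norm (weak_deriv u x))\<^sup>2)" by (rule L2_primitiveD(2)[OF U(1)])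
    fix x
    have "\<bar>k x\<bar>\<^sup>2 \<le> (norm (weak_deriv u x))\<^sup>2"
      unfolding k_def by (intro power_mono norm_derivative_le[OF U(1)]) simp
    then show "(k x)\<^sup>2 \<le> (norm (weak_deriv u x))\<^sup>2" by simp
  qed
  then have "energy N k \<le> H_form c u + \<omega> * (Lp_norm 2 u)\<^sup>2"
    unfolding energy_eq[OF admD(1)[OF A]] F by simp
  from that[OF A ae this] show ?thesis .
qed

text \<open>Vanishing of \<open>J_functional\<close> makes the action \<open>F\<close> times the
  mass and turns \<open>q * mass powr \<theta> \<le> energy\<close> into a lower bound for the mass
  alone. The constrained minimiser, moved along its ray to the Nehari manifold, attains that
  bound.\<close>

lemma ground_state_exists:
  "\<exists>u \<in> Nehari c \<omega> p. (AE x in half_line. u x \<in> \<real>\<^sub>\<ge>\<^sub>0) \<and> S_action c \<omega> p u = m_level c \<omega> p"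
proof -
  obtain W h where W: "adm W h" "mass W = 1" "energy W h = q" and q: "0 < q"
    by (rule minimizer_exists[OF adm_mass_1 q_line_lower q_less_q_line])
  define r where "r = 1 / (1 - \<theta>)"
  have r: "0 < r" "r * (1 - \<theta>) = 1" "r = (p + 1) / (p - 1)"
  proof -
    show "0 < r" "r * (1 - \<theta>) = 1" using \<theta> by (auto simp: r_def)
    have "1 - \<theta> = (p - 1) / (p + 1)" using p by (simp add: \<theta>_def field_simps)
    then show "r = (p + 1) / (p - 1)" by (simp add: r_def)
  qed
  define F where "F = 1 / 2 - 1 / (p + 1)"
  have F: "0 < F" unfolding F_def by (rule gap_factor(1))
  have S: "S_action c \<omega> p u = F * (Lp_norm (p + 1) u powr (p + 1))" if "J_functional c \<omega> p u = 0" for u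
  proof -
    have "H_form c u + \<omega> * (Lp_norm 2 u)\<^sup>2 = Lp_norm (p + 1) u powr (p + 1)"
      using that by (simp add: J_functional_def)
    moreover have "S_action c \<omega> p u = 1 / 2 * (H_form c u + \<omega> * (Lp_norm 2 u)\<^sup>2)
       - 1 / (p + 1) * Lp_norm (p + 1) u powr (p + 1)"
      unfolding S_action_def by (simp add: distrib_left)
    ultimately show ?thesis unfolding F_def by (simp only: left_diff_distrib)
  qed
  have lower: "F * q powr r \<le> S_action c \<omega> p u" if u: "u \<in> Nehari c \<omega> p" for u
  proof -
    have u10: "u \<in> H10" and nz: "\<not> (AE x in half_line. u x = 0)" and J: "J_functional c \<omega> p u = 0"
      using u by (auto simp: Nehari_def)
    have uH: "u \<in> H1" using u10 by (simp add: H10_def)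
    obtain N k where N: "adm N k" "AE x in half_line. norm (u x) = N x"
      "energy N k \<le> H_form c u + \<omega> * (Lp_norm 2 u)\<^sup>2" by (rule modulus_adm[OF u10])
    note F3 = functionals_eq(3)[OF uH N(1,2)]
    have m: "0 < mass N"
    proof (rule ccontr)
      assume "\<not> 0 < mass N"
      then have "mass N = 0" using mass_nonneg[of N] by simp
      then have "AE x in half_line. N x powr (p + 1) = 0"
        using integral_nonneg_eq_0_iff_AE[OF mass_integrable[OF N(1)]] by (simp add: mass_def)
      then have "AE x in half_line. u x = 0" using N(2) by eventually_elim simp
      then show False using nz by simp
    qed
    have "q * mass N powr \<theta> \<le> mass N"
      using q_mass_le[OF N(1)] N(3) J F3 by (simp add: J_functional_def)
    also have "\<dots> = mass N powr (1 - \<theta>) * mass N powr \<theta>" using m by (simp flip: powr_add)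
    finally have "q \<le> mass N powr (1 - \<theta>)" using m by simp
    then have "q powr r \<le> (mass N powr (1 - \<theta>)) powr r" using q r by (intro powr_mono2) auto
    also have "\<dots> = mass N" using m r(2) by (simp add: powr_powr mult.commute)
    finally show ?thesis unfolding S[OF J] F3 using F by simp
  qed
  \<comment> \<open>On the ray through \<open>W\<close> the energy is \<open>t\<^sup>2 * q\<close>
    and the mass \<open>t powr (p + 1)\<close>; they agree for this \<open>t\<close>, with common
    value \<open>q powr r\<close>.\<close>
  define t where "t = q powr (1 / (p - 1))"
  have t: "0 < t" "t powr (p - 1) = q" "t powr (p + 1) = q powr r"
    using q p by (auto simp: t_def powr_powr r(3))
  define V k where "V x = t * W x" and "k x = t * h x" for x
  have A: "adm V k" unfolding V_def[abs_def] k_def[abs_def] using adm_scale[OF W(1)] t by simp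
  define u where "u x = complex_of_real (V x)" for x
  have u10: "u \<in> H10" and wd: "AE x in half_line. weak_deriv u x = complex_of_real (k x)"
    using H1_primitive_in_H10[OF admD(1)[OF A]] by (auto simp: u_def[abs_def])
  have uH: "u \<in> H1" using u10 by (simp add: H10_def)
  have ae: "AE x in half_line. norm (u x) = V x"
    using half_line_pos_AE by eventually_elim (use admD(2)[OF A] in \<open>simp add: u_def\<close>)
  note F123 = functionals_eq[OF uH A ae]
  have [measurable]: "weak_deriv u \<in> borel_measurable half_line" using weak_deriv_spec(1)[OF uH] by (simp add: Lp_space_2)
  note [measurable] = H1_primitiveD(6)[OF admD(1)[OF A]]
  have "(LINT x|half_line. (norm (weak_deriv u x))\<^sup>2) = (LINT x|half_line. (k x)\<^sup>2)"
  proof (rule integral_cong_AE)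
    show "AE x in half_line. (norm (weak_deriv u x))\<^sup>2 = (k x)\<^sup>2" using wd by eventually_elim simp
  qed measurable
  then have "H_form c u + \<omega> * (Lp_norm 2 u)\<^sup>2 = energy V k"
    unfolding F123 energy_eq[OF admD(1)[OF A]] by simp
  also have "\<dots> = t\<^sup>2 * q" unfolding V_def k_def energy_scale W(3) ..
  also have "\<dots> = t powr (p + 1)" using powr_add[of t "p - 1" 2] t by (simp add: add.commute mult.commute)
  also have mV: "\<dots> = mass V" unfolding V_def using mass_scale[OF W(1), of t] W(2) t by simp
  finally have J: "J_functional c \<omega> p u = 0" unfolding J_functional_def F123(3) by simp
  have "\<not> (AE x in half_line. u x = 0)"
  proof
    assume "AE x in half_line. u x = 0"
    then have "AE x in half_line. V x powr (p + 1) = 0" by eventually_elim (simp add: u_def)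
    then have "mass V = 0"
      unfolding mass_def using integral_nonneg_eq_0_iff_AE[OF mass_integrable[OF A]] by simp
    then show False using mV t by simp
  qed
  then have N: "u \<in> Nehari c \<omega> p" using u10 J by (simp add: Nehari_def)
  have Su: "S_action c \<omega> p u = F * q powr r" unfolding S[OF J] F123(3) using mV t by simp
  have "m_level c \<omega> p = S_action c \<omega> p u"
    unfolding m_level_def
  proof (rule cInf_eq_minimum)
    show "S_action c \<omega> p u \<in> S_action c \<omega> p ` Nehari c \<omega> p" by (rule imageI[OF N])
    show "S_action c \<omega> p u \<le> s" if "s \<in> S_action c \<omega> p ` Nehari c \<omega> p" for s
      using that lower unfolding Su by auto
  qed
  moreover have "AE x in half_line. u x \<in> \<real>\<^sub>\<ge>\<^sub>0"
    using half_line_pos_AE by eventually_elim (use admD(2)[OF A] in \<open>simp add: u_def\<close>)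
  ultimately show ?thesis using N by auto
qed

end

theorem theorem2p9:
  fixes c p \<omega> :: real
  assumes "0 < c" and "c < 1 / 4" and "p > 1" and "\<omega> > 0"
  shows "\<exists>u \<in> Nehari c \<omega> p.
           (AE x in half_line. u x \<in> \<real>\<^sub>\<ge>\<^sub>0) \<and> S_action c \<omega> p u = m_level c \<omega> p"
proof -
  interpret nls_params c p \<omega> by unfold_locales (use assms in auto)
  show ?thesis by (rule ground_state_exists)
qed

end
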